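(* Let $M$ be a 6-dimensional manifold with an $\mathrm{SU}(3)$-structure $(\kappa,\Omega)$ and torsion forms $\pi_0,\sigma_0,\pi_1,\nu_1,\pi_2,\sigma_2,\nu_3$. Then the scalar curvature $s$ of the metric $g$ induced by $(\kappa,\Omega)$ is $$ s=\frac{15}{2}\pi_0^2+\frac{15}{2}\sigma_0^2+2d^*\pi_1+2d^*\nu_1-|\nu_1|^2-\frac12|\sigma_2|^2-\frac12|\pi_2|^2-\frac12|\nu_3|^2+4\langle\pi_1,\nu_1\rangle . $$
   Context: Notation: $e^{i_1\dots i_r}=e^{i_1}\wedge\dots\wedge e^{i_r}$. An $\mathrm{SU}(3)$-structure on a smooth 6-manifold $M$ is a pair $(\kappa,\Omega)$, with $\kappa$ a non-degenerate 2-form and $\Omega$ a 3-form such that at every point there is a coframe $e^1,\dots,e^6$ (called adapted) with $$\kappa=e^{12}+e^{34}+e^{56},\qquad \Omega=e^{135}-e^{146}-e^{245}-e^{236}$$ (i.e. $\Omega$ is a normalized $\kappa$-positive 3-form). In the dual frame the induced almost complex structure $J$ is $Je_1=e_2$, $Je_3=e_4$, $Je_5=e_6$; the induced metric is $g=\langle\cdot,\cdot\rangle=\sum_i e^i\otimes e^i$, i.e. $g(X,Y)=\kappa(X,JY)$; the orientation is given by $\kappa^3/6=e^{123456}$. $J$ acts on $r$-forms by $(J\alpha)(X_1,\dots,X_r)=\alpha(JX_1,\dots,JX_r)$. $*$ is the Hodge operator, $\alpha\wedge *\beta=\langle\alpha,\beta\rangle\kappa^3/6$, the inner product on $r$-forms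 being the one for which the $e^{i_1\dots i_r}$, $i_1<\dots<i_r$, are orthonormal. One has $J\Omega=*\Omega$. $d^*=-*d*$ is the codifferential. Let $\Lambda^2_8M=\{\varphi\in\Lambda^2M: J\varphi=\varphi,\ \varphi\wedge\kappa^2=0\}$ and $\Lambda^3_{12}M=\{\gamma\in\Lambda^3M:\gamma\wedge\kappa=0,\ \gamma\wedge\Omega=0,\ \gamma\wedge J\Omega=0\}$. The torsion forms are the uniquely determined functions $\pi_0,\sigma_0$, 1-forms $\pi_1,\nu_1$, 2-forms $\pi_2,\sigma_2\in\Lambda^2_8M$ and 3-form $\nu_3\in\Lambda^3_{12}M$ such that $$ d\kappa=-\tfrac32\sigma_0\Omega+\tfrac32\pi_0J\Omega+\nu_1\wedge\kappa+\nu_3,\quad d\Omega=\pi_0\kappa^2+\pi_1\wedge\Omega-\pi_2\wedge\kappa,\quad dJ\Omega=\sigma_0\kappa^2+J\pi_1\wedge\Omega-\sigma_2\wedge\kappa . $$ *)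

theory Defs
  imports "HOL-Analysis.Analysis"
begin

section \<open>Smooth 6-manifolds\<close>

text \<open>
  \<open>Ck_on k S f\<close>: \<open>f\<close> is \<open>k\<close> times continuously differentiable on \<open>S\<close>.
  It is only used for open \<open>S\<close>.
\<close>

primrec Ck_on :: "nat \<Rightarrow> 'a::real_normed_vector set \<Rightarrow> ('a \<Rightarrow> 'b::real_normed_vector) \<Rightarrow> bool" where
  "Ck_on 0 S f \<longleftrightarrow> continuous_on S f"
| "Ck_on (Suc k) S f \<longleftrightarrow>
     (\<forall>x\<in>S. f differentiable (at x)) \<and> (\<forall>v. Ck_on k S (\<lambda>x. frechet_derivative f (at x) v))"

definition smooth_on :: "'a::real_normed_vector set \<Rightarrow> ('a \<Rightarrow> 'b::real_normed_vector) \<Rightarrow> bool" where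
  "smooth_on S f \<longleftrightarrow> (\<forall>k. Ck_on k S f)"

text \<open>A chart is a pair of its domain and its coordinate map.\<close>

type_synonym 'a chart = "'a set \<times> ('a \<Rightarrow> real^6)"

definition chart_dom :: "'a chart \<Rightarrow> 'a set" where "chart_dom = fst"

definition chart_map :: "'a chart \<Rightarrow> 'a \<Rightarrow> real^6" where "chart_map = snd"

definition chart_img :: "'a chart \<Rightarrow> (real^6) set" where
  "chart_img c = chart_map c ` chart_dom c"

definition chart_inv :: "'a chart \<Rightarrow> real^6 \<Rightarrow> 'a" where
  "chart_inv c = inv_into (chart_dom c) (chart_map c)"

definition is_chart :: "'a topology \<Rightarrow> 'a chart \<Rightarrow> bool" where
  "is_chart X c \<longleftrightarrow> openin X (chart_dom c) \<and> open (chart_img c) \<and>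
     homeomorphic_map (subtopology X (chart_dom c)) (top_of_set (chart_img c)) (chart_map c)"

definition transition :: "'a chart \<Rightarrow> 'a chart \<Rightarrow> real^6 \<Rightarrow> real^6" where
  "transition c c' = chart_map c' \<circ> chart_inv c"

definition overlap :: "'a chart \<Rightarrow> 'a chart \<Rightarrow> (real^6) set" where
  "overlap c c' = chart_map c ` (chart_dom c \<inter> chart_dom c')"

definition smooth_6_manifold :: "'a topology \<Rightarrow> 'a chart set \<Rightarrow> bool" where
  "smooth_6_manifold X A \<longleftrightarrow>
     Hausdorff_space X \<and> second_countable X \<and>
     (\<forall>c\<in>A. is_chart X c) \<and> (\<Union>c\<in>A. chart_dom c) = topspace X \<and>
     (\<forall>c\<in>A. \<forall>c'\<in>A. smooth_on (overlap c c') (transition c c'))"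

definition smooth_function :: "'a chart set \<Rightarrow> ('a \<Rightarrow> real) \<Rightarrow> bool" where
  "smooth_function A f \<longleftrightarrow> (\<forall>c\<in>A. smooth_on (chart_img c) (f \<circ> chart_inv c))"


section \<open>Exterior algebra of a vector space\<close>

text \<open>
  An \<open>r\<close>-form is a function of vectors \<open>v 0, \<dots>, v (r - 1)\<close>. The first clause of \<open>alt_form\<close> makes
  it ignore the remaining entries of \<open>v\<close>, so that equality of \<open>r\<close>-forms is equality of functions.
\<close>

type_synonym 'v form = "(nat \<Rightarrow> 'v) \<Rightarrow> real"

definition alt_form :: "nat \<Rightarrow> ('v::real_vector) form \<Rightarrow> bool" where
  "alt_form r \<alpha> \<longleftrightarrow>
     (\<forall>v w. (\<forall>i<r. v i = w i) \<longrightarrow> \<alpha> v = \<alpha> w) \<and>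
     (\<forall>v. \<forall>i<r. linear (\<lambda>u. \<alpha> (v(i := u)))) \<and>
     (\<forall>v. \<forall>i<r. \<forall>j<r. i \<noteq> j \<and> v i = v j \<longrightarrow> \<alpha> v = 0)"

text \<open>Exterior product of an \<open>r\<close>-form and an \<open>s\<close>-form, normalized so that
  \<open>(a \<and> b)(u,w) = a(u) b(w) - a(w) b(u)\<close> for 1-forms.\<close>

definition wedge :: "nat \<Rightarrow> nat \<Rightarrow> 'v form \<Rightarrow> 'v form \<Rightarrow> 'v form" where
  "wedge r s \<alpha> \<beta> v =
     (\<Sum>p | p permutes {..<r+s}. of_int (sign p) * \<alpha> (\<lambda>i. v (p i)) * \<beta> (\<lambda>i. v (p (r + i))))
       / (fact r * fact s)"

text \<open>\<open>cowedge e [i\<^sub>1, \<dots>, i\<^sub>r]\<close> is the exterior product of the covectors \<open>e i\<^sub>1, \<dots>, e i\<^sub>r\<close>.\<close>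

primrec cowedge :: "(nat \<Rightarrow> 'v \<Rightarrow> real) \<Rightarrow> nat list \<Rightarrow> 'v form" where
  "cowedge e [] = (\<lambda>v. 1)"
| "cowedge e (i # is) = wedge 1 (length is) (\<lambda>v. e i (v 0)) (cowedge e is)"


section \<open>\<open>SU(3)\<close>-structures on a 6-dimensional vector space\<close>

definition coframe :: "(nat \<Rightarrow> real^6 \<Rightarrow> real) \<Rightarrow> bool" where
  "coframe e \<longleftrightarrow> (\<forall>i\<in>{1..6}. linear (e i)) \<and>
     (\<forall>a. (\<forall>u. (\<Sum>i=1..6. a i * e i u) = 0) \<longrightarrow> (\<forall>i\<in>{1..6}. a i = 0))"

definition dual_frame :: "(nat \<Rightarrow> real^6 \<Rightarrow> real) \<Rightarrow> nat \<Rightarrow> real^6" where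
  "dual_frame e i = (THE u. \<forall>j\<in>{1..6}. e j u = (if j = i then 1 else 0))"

definition nondegenerate :: "(real^6) form \<Rightarrow> bool" where
  "nondegenerate \<kappa> \<longleftrightarrow> (\<forall>u. (\<forall>w. \<kappa> ((!) [u, w]) = 0) \<longrightarrow> u = 0)"

definition adapted :: "(real^6) form \<Rightarrow> (real^6) form \<Rightarrow> (nat \<Rightarrow> real^6 \<Rightarrow> real) \<Rightarrow> bool" where
  "adapted \<kappa> \<Omega> e \<longleftrightarrow> coframe e \<and>
     \<kappa> = (\<lambda>v. cowedge e [1,2] v + cowedge e [3,4] v + cowedge e [5,6] v) \<and>
     \<Omega> = (\<lambda>v. cowedge e [1,3,5] v - cowedge e [1,4,6] v - cowedge e [2,4,5] v - cowedge e [2,3,6] v)"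

text \<open>
  The objects induced by \<open>(\<kappa>, \<Omega>)\<close> are expressed in some adapted coframe. They do not depend on which
  one, since two adapted coframes differ by an element of \<open>SU(3)\<close>, which preserves \<open>J\<close> and the metric.
\<close>

definition su3_coframe :: "(real^6) form \<Rightarrow> (real^6) form \<Rightarrow> nat \<Rightarrow> real^6 \<Rightarrow> real" where
  "su3_coframe \<kappa> \<Omega> = (SOME e. adapted \<kappa> \<Omega> e)"

definition su3_frame :: "(real^6) form \<Rightarrow> (real^6) form \<Rightarrow> nat \<Rightarrow> real^6" where
  "su3_frame \<kappa> \<Omega> = dual_frame (su3_coframe \<kappa> \<Omega>)"

definition su3_J :: "(real^6) form \<Rightarrow> (real^6) form \<Rightarrow> real^6 \<Rightarrow> real^6" where
  "su3_J \<kappa> \<Omega> u = (let e = su3_coframe \<kappa> \<Omega>; E = su3_frame \<kappa> \<Omega> in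
     e 1 u *\<^sub>R E 2 - e 2 u *\<^sub>R E 1 + e 3 u *\<^sub>R E 4 - e 4 u *\<^sub>R E 3 + e 5 u *\<^sub>R E 6 - e 6 u *\<^sub>R E 5)"

definition form_J :: "(real^6) form \<Rightarrow> (real^6) form \<Rightarrow> (real^6) form \<Rightarrow> (real^6) form" where
  "form_J \<kappa> \<Omega> \<alpha> v = \<alpha> (\<lambda>i. su3_J \<kappa> \<Omega> (v i))"

definition su3_metric :: "(real^6) form \<Rightarrow> (real^6) form \<Rightarrow> real^6 \<Rightarrow> real^6 \<Rightarrow> real" where
  "su3_metric \<kappa> \<Omega> u w = (\<Sum>i=1..6. su3_coframe \<kappa> \<Omega> i u * su3_coframe \<kappa> \<Omega> i w)"

text \<open>
  The inner product on \<open>r\<close>-forms in which the \<open>e\<^sup>I\<close>, \<open>I = {i\<^sub>1 < \<dots> < i\<^sub>r}\<close>, are orthonormal;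
  the coefficient of \<open>\<alpha>\<close> at \<open>e\<^sup>I\<close> is \<open>\<alpha>\<close> evaluated on the dual frame vectors with indices in \<open>I\<close>.
\<close>

definition form_inner ::
  "(real^6) form \<Rightarrow> (real^6) form \<Rightarrow> nat \<Rightarrow> (real^6) form \<Rightarrow> (real^6) form \<Rightarrow> real" where
  "form_inner \<kappa> \<Omega> r \<alpha> \<beta> =
     (\<Sum>I | I \<subseteq> {1..6} \<and> card I = r.
        \<alpha> (\<lambda>k. su3_frame \<kappa> \<Omega> (sorted_list_of_set I ! k)) *
        \<beta> (\<lambda>k. su3_frame \<kappa> \<Omega> (sorted_list_of_set I ! k)))"

definition su3_volume :: "(real^6) form \<Rightarrow> (real^6) form" where
  "su3_volume \<kappa> v = wedge 2 4 \<kappa> (wedge 2 2 \<kappa> \<kappa>) v / 6"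

definition hodge :: "(real^6) form \<Rightarrow> (real^6) form \<Rightarrow> nat \<Rightarrow> (real^6) form \<Rightarrow> (real^6) form" where
  "hodge \<kappa> \<Omega> r \<beta> = (THE \<gamma>. alt_form (6 - r) \<gamma> \<and>
     (\<forall>\<alpha>. alt_form r \<alpha> \<longrightarrow>
        wedge r (6 - r) \<alpha> \<gamma> = (\<lambda>v. form_inner \<kappa> \<Omega> r \<alpha> \<beta> * su3_volume \<kappa> v)))"


section \<open>Differential forms\<close>

text \<open>
  A differential form on the manifold is given by its expression in every chart of the atlas:
  \<open>\<omega> c x v\<close> is its value at the point with coordinates \<open>x\<close> in the chart \<open>c\<close> on the tangent vectors
  with components \<open>v 0, v 1, \<dots>\<close> in \<open>c\<close>. The expressions in two charts are related by pullback along the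
  transition map. Values at charts outside the atlas or outside the image of the chart are irrelevant.
\<close>

type_synonym 'a form_field = "'a chart \<Rightarrow> real^6 \<Rightarrow> (real^6) form"

definition diff_form :: "'a chart set \<Rightarrow> nat \<Rightarrow> 'a form_field \<Rightarrow> bool" where
  "diff_form A r \<omega> \<longleftrightarrow>
     (\<forall>c\<in>A. \<forall>x\<in>chart_img c. alt_form r (\<omega> c x)) \<and>
     (\<forall>c\<in>A. \<forall>v. smooth_on (chart_img c) (\<lambda>x. \<omega> c x v)) \<and>
     (\<forall>c\<in>A. \<forall>c'\<in>A. \<forall>x\<in>overlap c c'. \<forall>v.
        \<omega> c x v = \<omega> c' (transition c c' x) (\<lambda>i. frechet_derivative (transition c c') (at x) (v i)))"

text \<open>
  Exterior derivative of an \<open>r\<close>-form on an open subset of \<open>\<real>\<^sup>6\<close>: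
  \<open>d\<omega>(v\<^sub>0,\<dots>,v\<^sub>r) = \<Sum>\<^sub>i (-1)\<^sup>i \<partial>\<^sub>v\<^sub>i \<omega>(v\<^sub>0,\<dots>,v\<^sub>i\<^sub>-\<^sub>1,v\<^sub>i\<^sub>+\<^sub>1,\<dots>,v\<^sub>r)\<close> for constant \<open>v\<^sub>i\<close>.
\<close>

definition ext_deriv :: "nat \<Rightarrow> (real^6 \<Rightarrow> (real^6) form) \<Rightarrow> real^6 \<Rightarrow> (real^6) form" where
  "ext_deriv r \<omega> x v =
     (\<Sum>i\<le>r. (-1)^i *
        frechet_derivative (\<lambda>y. \<omega> y (\<lambda>j. if j < i then v j else v (Suc j))) (at x) (v i))"

definition codiff ::
  "'a form_field \<Rightarrow> 'a form_field \<Rightarrow> nat \<Rightarrow> 'a form_field \<Rightarrow> 'a form_field" where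
  "codiff \<kappa> \<Omega> r \<omega> c x v =
     - hodge (\<kappa> c x) (\<Omega> c x) (7 - r)
         (ext_deriv (6 - r) (\<lambda>y. hodge (\<kappa> c y) (\<Omega> c y) r (\<omega> c y)) x) v"

text \<open>The real number that a 0-form is.\<close>

definition form0_value :: "'v::zero form \<Rightarrow> real" where
  "form0_value \<alpha> = \<alpha> (\<lambda>_. 0)"

definition su3_structure :: "'a chart set \<Rightarrow> 'a form_field \<Rightarrow> 'a form_field \<Rightarrow> bool" where
  "su3_structure A \<kappa> \<Omega> \<longleftrightarrow> diff_form A 2 \<kappa> \<and> diff_form A 3 \<Omega> \<and>
     (\<forall>c\<in>A. \<forall>x\<in>chart_img c.
        nondegenerate (\<kappa> c x) \<and> (\<exists>e. adapted (\<kappa> c x) (\<Omega> c x) e))"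

definition form_field_J :: "'a form_field \<Rightarrow> 'a form_field \<Rightarrow> 'a form_field \<Rightarrow> 'a form_field" where
  "form_field_J \<kappa> \<Omega> \<omega> c x = form_J (\<kappa> c x) (\<Omega> c x) (\<omega> c x)"

definition Lambda2_8 :: "'a chart set \<Rightarrow> 'a form_field \<Rightarrow> 'a form_field \<Rightarrow> 'a form_field set" where
  "Lambda2_8 A \<kappa> \<Omega> = {\<phi>. diff_form A 2 \<phi> \<and>
     (\<forall>c\<in>A. \<forall>x\<in>chart_img c.
        form_field_J \<kappa> \<Omega> \<phi> c x = \<phi> c x \<and>
        wedge 2 4 (\<phi> c x) (wedge 2 2 (\<kappa> c x) (\<kappa> c x)) = (\<lambda>_. 0))}"

definition Lambda3_12 :: "'a chart set \<Rightarrow> 'a form_field \<Rightarrow> 'a form_field \<Rightarrow> 'a form_field set" where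
  "Lambda3_12 A \<kappa> \<Omega> = {\<gamma>. diff_form A 3 \<gamma> \<and>
     (\<forall>c\<in>A. \<forall>x\<in>chart_img c.
        wedge 3 2 (\<gamma> c x) (\<kappa> c x) = (\<lambda>_. 0) \<and>
        wedge 3 3 (\<gamma> c x) (\<Omega> c x) = (\<lambda>_. 0) \<and>
        wedge 3 3 (\<gamma> c x) (form_field_J \<kappa> \<Omega> \<Omega> c x) = (\<lambda>_. 0))}"

definition torsion_forms ::
  "'a chart set \<Rightarrow> 'a form_field \<Rightarrow> 'a form_field \<Rightarrow> ('a \<Rightarrow> real) \<Rightarrow> ('a \<Rightarrow> real) \<Rightarrow>
   'a form_field \<Rightarrow> 'a form_field \<Rightarrow> 'a form_field \<Rightarrow> 'a form_field \<Rightarrow> 'a form_field \<Rightarrow> bool" where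
  "torsion_forms A \<kappa> \<Omega> \<pi>0 \<sigma>0 \<pi>1 \<nu>1 \<pi>2 \<sigma>2 \<nu>3 \<longleftrightarrow>
     smooth_function A \<pi>0 \<and> smooth_function A \<sigma>0 \<and>
     diff_form A 1 \<pi>1 \<and> diff_form A 1 \<nu>1 \<and>
     \<pi>2 \<in> Lambda2_8 A \<kappa> \<Omega> \<and> \<sigma>2 \<in> Lambda2_8 A \<kappa> \<Omega> \<and> \<nu>3 \<in> Lambda3_12 A \<kappa> \<Omega> \<and>
     (\<forall>c\<in>A. \<forall>p\<in>chart_dom c. \<forall>x v. x = chart_map c p \<longrightarrow>
        ext_deriv 2 (\<kappa> c) x v =
          - 3/2 * \<sigma>0 p * \<Omega> c x v + 3/2 * \<pi>0 p * form_field_J \<kappa> \<Omega> \<Omega> c x v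
          + wedge 1 2 (\<nu>1 c x) (\<kappa> c x) v + \<nu>3 c x v \<and>
        ext_deriv 3 (\<Omega> c) x v =
          \<pi>0 p * wedge 2 2 (\<kappa> c x) (\<kappa> c x) v
          + wedge 1 3 (\<pi>1 c x) (\<Omega> c x) v - wedge 2 2 (\<pi>2 c x) (\<kappa> c x) v \<and>
        ext_deriv 3 (form_field_J \<kappa> \<Omega> \<Omega> c) x v =
          \<sigma>0 p * wedge 2 2 (\<kappa> c x) (\<kappa> c x) v
          + wedge 1 3 (form_field_J \<kappa> \<Omega> \<pi>1 c x) (\<Omega> c x) v - wedge 2 2 (\<sigma>2 c x) (\<kappa> c x) v)"


section \<open>Scalar curvature\<close>

text \<open>
  Levi-Civita connection and curvature of a metric \<open>g\<close> on an open subset of \<open>\<real>\<^sup>6\<close>, in coordinates: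
  \<open>\<nabla>\<^sub>i \<partial>\<^sub>j = \<Gamma>\<^sup>k\<^sub>i\<^sub>j \<partial>\<^sub>k\<close>, \<open>R(\<partial>\<^sub>i,\<partial>\<^sub>j)\<partial>\<^sub>k = R\<^sup>l\<^sub>k\<^sub>i\<^sub>j \<partial>\<^sub>l\<close> with \<open>R(X,Y) = [\<nabla>\<^sub>X,\<nabla>\<^sub>Y] - \<nabla>\<^sub>[\<^sub>X\<^sub>,\<^sub>Y\<^sub>]\<close>,
  \<open>Ric(Y,Z) = tr (X \<mapsto> R(X,Y)Z)\<close>, so that round spheres have positive scalar curvature.
\<close>

type_synonym metric_field = "real^6 \<Rightarrow> real^6 \<Rightarrow> real^6 \<Rightarrow> real"

definition partial :: "6 \<Rightarrow> (real^6 \<Rightarrow> real) \<Rightarrow> real^6 \<Rightarrow> real" where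
  "partial i f x = frechet_derivative f (at x) (axis i 1)"

definition metric_matrix :: "metric_field \<Rightarrow> real^6 \<Rightarrow> real^6^6" where
  "metric_matrix g x = (\<chi> i j. g x (axis i 1) (axis j 1))"

definition inverse_metric :: "metric_field \<Rightarrow> real^6 \<Rightarrow> real^6^6" where
  "inverse_metric g x = matrix_inv (metric_matrix g x)"

text \<open>\<open>christoffel g k i j\<close> is \<open>\<Gamma>\<^sup>k\<^sub>i\<^sub>j\<close>.\<close>

definition christoffel :: "metric_field \<Rightarrow> 6 \<Rightarrow> 6 \<Rightarrow> 6 \<Rightarrow> real^6 \<Rightarrow> real" where
  "christoffel g k i j x =
     (\<Sum>l\<in>UNIV. inverse_metric g x $ k $ l *
        (partial i (\<lambda>y. metric_matrix g y $ j $ l) x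
       + partial j (\<lambda>y. metric_matrix g y $ i $ l) x
       - partial l (\<lambda>y. metric_matrix g y $ i $ j) x)) / 2"

text \<open>\<open>riemann g l k i j\<close> is \<open>R\<^sup>l\<^sub>k\<^sub>i\<^sub>j\<close>.\<close>

definition riemann :: "metric_field \<Rightarrow> 6 \<Rightarrow> 6 \<Rightarrow> 6 \<Rightarrow> 6 \<Rightarrow> real^6 \<Rightarrow> real" where
  "riemann g l k i j x =
     partial i (christoffel g l j k) x - partial j (christoffel g l i k) x
     + (\<Sum>m\<in>UNIV. christoffel g l i m x * christoffel g m j k x
                 - christoffel g l j m x * christoffel g m i k x)"

definition ricci :: "metric_field \<Rightarrow> 6 \<Rightarrow> 6 \<Rightarrow> real^6 \<Rightarrow> real" where
  "ricci g j k x = (\<Sum>i\<in>UNIV. riemann g i k i j x)"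

definition scalar_curvature :: "metric_field \<Rightarrow> real^6 \<Rightarrow> real" where
  "scalar_curvature g x = (\<Sum>j\<in>UNIV. \<Sum>k\<in>UNIV. inverse_metric g x $ j $ k * ricci g j k x)"

text \<open>The expression in the chart \<open>c\<close> of the metric induced by an \<open>SU(3)\<close>-structure.\<close>

definition induced_metric :: "'a form_field \<Rightarrow> 'a form_field \<Rightarrow> 'a chart \<Rightarrow> metric_field" where
  "induced_metric \<kappa> \<Omega> c x = su3_metric (\<kappa> c x) (\<Omega> c x)"

definition inner_at ::
  "'a form_field \<Rightarrow> 'a form_field \<Rightarrow> nat \<Rightarrow> 'a form_field \<Rightarrow> 'a form_field \<Rightarrow> 'a chart \<Rightarrow> real^6 \<Rightarrow> real" where
  "inner_at \<kappa> \<Omega> r \<alpha> \<beta> c x = form_inner (\<kappa> c x) (\<Omega> c x) r (\<alpha> c x) (\<beta> c x)"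

end

theory Submission
  imports Defs
begin

text \<open>Let \<open>\<omega>\<close> be the matrix of Levi-Civita connection forms in a smooth local adapted frame \<open>E\<close>, and
  \<open>F = d\<omega> + \<omega> \<and> \<omega>\<close> its curvature, so that \<open>s = \<Sum>\<^sub>a\<^sub>b F\<^sub>a\<^sub>b(E\<^sub>a, E\<^sub>b)\<close>. The two-forms \<open>\<kappa>\<close> and \<open>\<iota>\<^sub>k\<Omega>\<close>, the
  contractions of \<open>\<Omega>\<close> with the frame vectors, span the orthogonal complement of \<open>su(3)\<close> in the two-forms, and
  \<open>\<kappa>\<^sub>a\<^sub>b \<kappa>\<^sub>i\<^sub>j + \<Sum>\<^sub>k \<Omega>\<^sub>k\<^sub>a\<^sub>b \<Omega>\<^sub>k\<^sub>i\<^sub>j\<close> differs from \<open>\<delta>\<^sub>a\<^sub>i \<delta>\<^sub>b\<^sub>j - \<delta>\<^sub>a\<^sub>j \<delta>\<^sub>b\<^sub>i\<close> by a multiple of \<open>\<kappa> \<and> \<kappa>\<close>, which the Bianchi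
  identity annihilates. Hence \<open>s\<close> is twice the trace of \<open>F\<close> over this complement
  (\<open>scalar_eq_su3_perp_trace\<close>).

  This trace involves derivatives only of the components \<open>m = \<omega>(\<kappa>)\<close> and \<open>t\<^sub>k = \<omega>(\<iota>\<^sub>k\<Omega>)\<close> of the connection, which
  form the intrinsic torsion. Its value is the divergence of a vector field \<open>V\<close>, linear in \<open>m\<close> and \<open>t\<close>, plus a
  quadratic form \<open>Q(m, t)\<close>; the \<open>su(3)\<close> part of \<open>\<omega>\<close> enters only through the divergence
  (\<open>su3_perp_trace_quadratic\<close>). As \<open>SU(3)\<close> fixes \<open>\<kappa>\<close> and \<open>\<Omega>\<close>, the derivatives \<open>d\<kappa>\<close>, \<open>d\<Omega>\<close>, \<open>dJ\<Omega>\<close> are linear in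
  \<open>m\<close> and \<open>t\<close>, and comparing them with the torsion forms determines \<open>m\<close> and \<open>t\<close> (locale
  \<open>torsion_equations\<close>). The result is \<open>V = - (\<pi>\<^sub>1 + \<nu>\<^sub>1)\<close>, whose divergence is \<open>d\<^sup>*\<pi>\<^sub>1 + d\<^sup>*\<nu>\<^sub>1\<close>, while \<open>2 Q(m, t)\<close>
  is the sum of the quadratic terms of the formula.

  The remaining work connects these computations with the definitions. The metric is a quotient of smooth
  functions because \<open>\<iota>\<^sub>u\<Omega> \<and> \<iota>\<^sub>w\<Omega> \<and> \<kappa> = 2 g(u, w) vol\<close> (\<open>metric_form\<close>), so that the Gram-Schmidt process
  gives smooth adapted frames (\<open>smooth_frame\<close>). Exterior products, which are sums over permutations, are
  evaluated by the rule that contraction is an antiderivation (\<open>wedge_contract\<close>). The codifferential of a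
  one-form is minus a divergence because \<open>*\<theta>\<close> is the contraction of the volume form with the vector dual to
  \<open>\<theta>\<close> (\<open>codiff_one_form\<close>).\<close>

section \<open>Alternating forms\<close>

lemma alt_form_cong:
  "alt_form r \<alpha> \<Longrightarrow> (\<And>i. i < r \<Longrightarrow> v i = w i) \<Longrightarrow> \<alpha> v = \<alpha> w"
  unfolding alt_form_def by blast

lemma alt_form_linear:
  "alt_form r \<alpha> \<Longrightarrow> i < r \<Longrightarrow> linear (\<lambda>u. \<alpha> (v(i := u)))"
  unfolding alt_form_def by blast

lemma alt_form_eq_args:
  "alt_form r \<alpha> \<Longrightarrow> i < r \<Longrightarrow> j < r \<Longrightarrow> i \<noteq> j \<Longrightarrow> v i = v j \<Longrightarrow> \<alpha> v = 0"
  unfolding alt_form_def by blast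

lemma comp_transpose_upd:
  "v \<circ> Transposition.transpose i j = v(i := v j, j := v i)"
  by (auto simp: fun_eq_iff Transposition.transpose_def)

lemma alt_form_swap:
  assumes a: "alt_form r \<alpha>" and i: "i < r" and j: "j < r" and ij: "i \<noteq> j"
  shows "\<alpha> (v \<circ> Transposition.transpose i j) = - \<alpha> v"
proof -
  define f where "f a b = \<alpha> (v(i := a, j := b))" for a b
  have l2: "linear (f a)" for a
    unfolding f_def by (rule alt_form_linear[OF a j])
  have l1: "linear (\<lambda>a. f a b)" for b
    using alt_form_linear[OF a i, of "v(j := b)"] ij unfolding f_def by (simp add: fun_upd_twist)
  have z: "f a a = 0" for a
    unfolding f_def by (rule alt_form_eq_args[OF a i j ij]) (use ij in simp)
  have "f (x + y) (x + y) = f x x + f x y + f y x + f y y" for x y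
    by (simp add: linear_add[OF l1] linear_add[OF l2])
  then have "f x y = - f y x" for x y by (simp add: z eq_neg_iff_add_eq_0)
  then have "f (v j) (v i) = - f (v i) (v j)" .
  then show ?thesis by (simp add: f_def comp_transpose_upd)
qed

lemma alt_form_permute:
  assumes a: "alt_form r \<alpha>" and p: "p permutes {..<r}"
  shows "\<alpha> (v \<circ> p) = of_int (sign p) * \<alpha> v"
  using p finite_lessThan
proof (induction arbitrary: v rule: permutes_induct)
  case id
  then show ?case by (simp add: sign_id)
next
  case (swap x y p)
  have "sign (Transposition.transpose x y \<circ> p) = - sign p"
    using swap permutes_imp_permutation[OF finite_lessThan, of p]
    by (subst sign_compose) (auto simp: permutation_swap_id sign_swap_id)
  moreover have "\<alpha> (v \<circ> (Transposition.transpose x y \<circ> p)) = of_int (sign p) * \<alpha> (v \<circ> Transposition.transpose x y)"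
    unfolding o_assoc by (rule swap.IH)
  moreover have "\<alpha> (v \<circ> Transposition.transpose x y) = - \<alpha> v"
    using swap by (intro alt_form_swap[OF a]) auto
  ultimately show ?case by (simp only: of_int_minus mult_minus_left mult_minus_right)
qed

text \<open>More arguments than the dimension are linearly dependent, and a form that vanishes when two
  arguments agree also vanishes when one argument lies in the span of the others.\<close>

lemma alt_form_above_dimension:
  fixes \<omega> :: "('v::euclidean_space) form"
  assumes a: "alt_form n \<omega>" and n: "DIM('v) < n"
  shows "\<omega> v = 0"
proof (cases "inj_on v {..<n}")
  case False
  then show ?thesis using alt_form_eq_args[OF a] unfolding inj_on_def by (metis lessThan_iff)
next
  case True
  then have "card (v ` {..<n}) = n" by (simp add: card_image)
  then have "dependent (v ` {..<n})" using n by (intro dependent_biggerset) auto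
  then obtain i where i: "i < n" "v i \<in> span (v ` {..<n} - {v i})"
    unfolding dependent_def by auto
  have "\<omega> (v(i := u)) = 0" if u: "u \<in> span (v ` {..<n} - {v i})" for u
  proof (rule linear_eq_0_on_span[OF alt_form_linear[OF a i(1)] _ u])
    fix x assume "x \<in> v ` {..<n} - {v i}"
    then obtain j where "j < n" "x = v j" "j \<noteq> i" by auto
    then show "\<omega> (v(i := x)) = 0" by (intro alt_form_eq_args[OF a i(1) \<open>j < n\<close>]) auto
  qed
  from this[OF i(2)] show ?thesis by simp
qed

text \<open>Arguments are moved into the basis one at a time.\<close>

lemma alt_form_eq_0_on_basis:
  assumes a: "alt_form n \<omega>" and sp: "span B = UNIV" and z: "\<And>v. (\<And>i. i < n \<Longrightarrow> v i \<in> B) \<Longrightarrow> \<omega> v = 0"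
  shows "\<omega> v = 0"
proof -
  have "\<omega> v = 0" if "j \<le> n" "\<And>i. j \<le> i \<Longrightarrow> i < n \<Longrightarrow> v i \<in> B" for j v
    using that
  proof (induction j arbitrary: v)
    case 0
    then show ?case by (intro z) auto
  next
    case (Suc j)
    then have j: "j < n" by simp
    have "\<omega> (v(j := u)) = 0" if "u \<in> span B" for u
    proof (rule linear_eq_0_on_span[OF alt_form_linear[OF a j] _ that])
      fix x assume "x \<in> B"
      then show "\<omega> (v(j := x)) = 0" using Suc.prems by (intro Suc.IH) auto
    qed
    from this[of "v j"] show ?case by (simp add: sp)
  qed
  from this[of n v] show ?thesis by simp
qed

text \<open>A form of top degree is determined by its value on one basis, because on basis vectors it vanishes
  or takes that value up to a sign.\<close>

lemma top_form_eq_0: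
  assumes a: "alt_form n \<omega>" and sp: "span (E ` {..<n}) = UNIV" and z: "\<omega> E = 0"
  shows "\<omega> v = 0"
proof (rule alt_form_eq_0_on_basis[OF a sp])
  fix v assume "\<And>i. i < n \<Longrightarrow> v i \<in> E ` {..<n}"
  then have "\<forall>i\<in>{..<n}. \<exists>k. k < n \<and> v i = E k" by auto
  then obtain f where f: "\<And>i. i < n \<Longrightarrow> f i < n \<and> v i = E (f i)"
    by (metis lessThan_iff)
  show "\<omega> v = 0"
  proof (cases "inj_on f {..<n}")
    case False
    then show ?thesis using alt_form_eq_args[OF a] f unfolding inj_on_def by (metis lessThan_iff)
  next
    case True
    define p where "p i = (if i < n then f i else i)" for i
    have "inj_on p {..<n}" using True unfolding p_def inj_on_def by auto
    then have p: "p permutes {..<n}"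
      by (intro inj_imp_permutes) (auto simp: p_def f)
    have "\<omega> v = \<omega> (E \<circ> p)" by (rule alt_form_cong[OF a]) (simp add: p_def f)
    then show ?thesis by (simp add: alt_form_permute[OF a p] z)
  qed
qed

lemma alt_form_add: "alt_form r \<alpha> \<Longrightarrow> alt_form r \<beta> \<Longrightarrow> alt_form r (\<lambda>v. \<alpha> v + \<beta> v)"
  unfolding alt_form_def
proof (elim conjE, intro conjI allI impI)
  fix v w :: "nat \<Rightarrow> 'a" assume "\<forall>v w. (\<forall>i<r. v i = w i) \<longrightarrow> \<alpha> v = \<alpha> w"
    "\<forall>v w. (\<forall>i<r. v i = w i) \<longrightarrow> \<beta> v = \<beta> w" "\<forall>i<r. v i = w i"
  then show "\<alpha> v + \<beta> v = \<alpha> w + \<beta> w" by metis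
qed (simp_all add: linear_compose_add)

lemma linear_cmult_real: "linear f \<Longrightarrow> linear (\<lambda>x. c * (f x :: real))"
  using linear_compose_scale_right[of f c] by simp

lemma alt_form_cmul: "alt_form r \<alpha> \<Longrightarrow> alt_form r (\<lambda>v. c * \<alpha> v)"
  unfolding alt_form_def
proof (elim conjE, intro conjI allI impI)
  fix v w :: "nat \<Rightarrow> 'a" assume "\<forall>v w. (\<forall>i<r. v i = w i) \<longrightarrow> \<alpha> v = \<alpha> w" "\<forall>i<r. v i = w i"
  then show "c * \<alpha> v = c * \<alpha> w" by metis
qed (simp_all add: linear_cmult_real)

lemma alt_form_diff: "alt_form r \<alpha> \<Longrightarrow> alt_form r \<beta> \<Longrightarrow> alt_form r (\<lambda>v. \<alpha> v - \<beta> v)"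
  using alt_form_add[of r \<alpha> "\<lambda>v. (-1) * \<beta> v"] alt_form_cmul[of r \<beta> "-1"] by simp

lemma alt_form_1I: "linear a \<Longrightarrow> alt_form 1 (\<lambda>v. a (v 0))"
  unfolding alt_form_def by simp

lemma alt_form_0I: "alt_form 0 (\<lambda>v. c)"
  unfolding alt_form_def by simp

definition contract :: "'v \<Rightarrow> 'v form \<Rightarrow> 'v form" where
  "contract u \<alpha> v = \<alpha> (case_nat u v)"

lemma alt_form_contract:
  assumes a: "alt_form (Suc r) \<alpha>"
  shows "alt_form r (contract u \<alpha>)"
proof -
  have upd: "case_nat u (v(i := x)) = (case_nat u v)(Suc i := x)" for v i and x
    by (auto simp: fun_eq_iff split: nat.split)
  show ?thesis
    unfolding alt_form_def contract_def
  proof (intro conjI allI impI; (elim conjE)?)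
    show "\<alpha> (case_nat u v) = \<alpha> (case_nat u w)" if "\<forall>i<r. v i = w i" for v w
      by (rule alt_form_cong[OF a]) (use that in \<open>auto split: nat.split\<close>)
    show "linear (\<lambda>x. \<alpha> (case_nat u (v(i := x))))" if "i < r" for v i
      unfolding upd by (rule alt_form_linear[OF a]) (use that in simp)
    show "\<alpha> (case_nat u v) = 0" if "i < r" "j < r" "i \<noteq> j" "v i = v j" for v i j
      by (rule alt_form_eq_args[OF a, of "Suc i" "Suc j"]) (use that in simp_all)
  qed
qed

section \<open>Evaluation of exterior products\<close>

lemma alt_form_wedge:
  assumes a: "alt_form r \<alpha>" and b: "alt_form s \<beta>"
  shows "alt_form (r + s) (wedge r s \<alpha> \<beta>)"
proof -
  let ?P = "{p. p permutes {..<r+s}}"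
  let ?t = "\<lambda>v p. of_int (sign p) * \<alpha> (\<lambda>i. v (p i)) * \<beta> (\<lambda>i. v (p (r + i)))"
  have lt: "p i < r + s" if "p \<in> ?P" "i < r + s" for p i
    using that permutes_in_image[of p "{..<r+s}" i] by simp
  have cong: "wedge r s \<alpha> \<beta> v = wedge r s \<alpha> \<beta> w" if vw: "\<forall>i<r+s. v i = w i" for v w
  proof -
    have "?t v p = ?t w p" if p: "p \<in> ?P" for p
    proof -
      have "\<alpha> (\<lambda>i. v (p i)) = \<alpha> (\<lambda>i. w (p i))" by (rule alt_form_cong[OF a]) (simp add: vw lt[OF p])
      moreover have "\<beta> (\<lambda>i. v (p (r + i))) = \<beta> (\<lambda>i. w (p (r + i)))"
        by (rule alt_form_cong[OF b]) (simp add: vw lt[OF p])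
      ultimately show ?thesis by simp
    qed
    then have "(\<Sum>p\<in>?P. ?t v p) = (\<Sum>p\<in>?P. ?t w p)" by (rule sum.cong[OF refl])
    then show ?thesis unfolding wedge_def by simp
  qed
  have lin_t: "linear (\<lambda>u. ?t (v(i := u)) p)" if i: "i < r + s" and p: "p \<in> ?P" for v i p
  proof -
    obtain k where k: "p k = i" "k < r + s"
    proof -
      have "i \<in> p ` {..<r+s}" using i p by (simp add: permutes_image)
      then show ?thesis using that by auto
    qed
    have inj: "p x = i \<longleftrightarrow> x = k" for x
      using p k(1) permutes_inj[of p "{..<r+s}"] inj_eq[of p x k] by auto
    show ?thesis
    proof (cases "k < r")
      case True
      have "(\<lambda>j. (v(i := u)) (p j)) = (\<lambda>j. v (p j))(k := u)" for u by (auto simp: fun_eq_iff inj k)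
      moreover have "(\<lambda>j. (v(i := u)) (p (r + j))) = (\<lambda>j. v (p (r + j)))" for u
        using True by (auto simp: fun_eq_iff inj)
      ultimately have "(\<lambda>u. ?t (v(i := u)) p) =
          (\<lambda>u. (of_int (sign p) * \<beta> (\<lambda>j. v (p (r + j)))) * \<alpha> ((\<lambda>j. v (p j))(k := u)))"
        by (simp only: mult.assoc mult.commute mult.left_commute)
      then show ?thesis by (simp only:) (intro linear_cmult_real alt_form_linear[OF a True])
    next
      case False
      then have k': "k - r < s" using k by simp
      have "(\<lambda>j. (v(i := u)) (p (r + j))) = (\<lambda>j. v (p (r + j)))(k - r := u)" for u
        using False by (auto simp: fun_eq_iff inj k)
      moreover have "\<alpha> (\<lambda>j. (v(i := u)) (p j)) = \<alpha> (\<lambda>j. v (p j))" for u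
        using False by (intro alt_form_cong[OF a]) (auto simp: inj)
      ultimately have "(\<lambda>u. ?t (v(i := u)) p) =
          (\<lambda>u. (of_int (sign p) * \<alpha> (\<lambda>j. v (p j))) * \<beta> ((\<lambda>j. v (p (r + j)))(k - r := u)))"
        by (simp only: mult.assoc mult.commute mult.left_commute)
      then show ?thesis by (simp only:) (intro linear_cmult_real alt_form_linear[OF b k'])
    qed
  qed
  have lin: "linear (\<lambda>u. wedge r s \<alpha> \<beta> (v(i := u)))" if i: "i < r + s" for v i
  proof -
    have "linear (\<lambda>u. (1 / (fact r * fact s)) * (\<Sum>p\<in>?P. ?t (v(i := u)) p))"
      by (intro linear_cmult_real linear_compose_sum ballI lin_t[OF i])
    then show ?thesis unfolding wedge_def by simp
  qed
  have alt: "wedge r s \<alpha> \<beta> v = 0" if ij: "i < r + s" "j < r + s" "i \<noteq> j" "v i = v j" for v i j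
  proof -
    let ?\<tau> = "Transposition.transpose i j"
    have v: "v (?\<tau> x) = v x" for x using ij by (simp add: Transposition.transpose_def)
    have "(\<Sum>p\<in>?P. ?t v p) = (\<Sum>p\<in>?P. ?t v (?\<tau> \<circ> p))"
      by (rule setum_permutations_compose_left) (use ij in \<open>auto intro: permutes_swap_id\<close>)
    also have "\<dots> = (\<Sum>p\<in>?P. - ?t v p)"
    proof (rule sum.cong[OF refl])
      fix p assume p: "p \<in> ?P"
      have "sign (?\<tau> \<circ> p) = - sign p"
        using ij p permutes_imp_permutation[OF finite_lessThan, of p] by (subst sign_compose) (auto simp: permutation_swap_id sign_swap_id)
      then show "?t v (?\<tau> \<circ> p) = - ?t v p" by (simp add: v)
    qed
    finally have "(\<Sum>p\<in>?P. ?t v p) = 0" by (simp add: sum_negf)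
    then show ?thesis unfolding wedge_def by simp
  qed
  show ?thesis unfolding alt_form_def using cong lin alt by blast
qed

text \<open>The cycle that brings position \<open>r\<close> to the front and moves the positions below \<open>r\<close> up by one.\<close>

primrec to_front :: "nat \<Rightarrow> nat \<Rightarrow> nat" where
  "to_front 0 = id"
| "to_front (Suc r) = to_front r \<circ> Transposition.transpose r (Suc r)"

lemma to_front_permutes: "to_front r permutes {..r}"
proof (induction r)
  case (Suc r)
  have "Transposition.transpose r (Suc r) permutes {..Suc r}" by (rule permutes_swap_id) auto
  moreover have "to_front r permutes {..Suc r}" by (rule permutes_subset[OF Suc]) auto
  ultimately show ?case unfolding to_front.simps by (intro permutes_compose)
qed (simp add: permutes_id id_def[symmetric])

lemma to_front_apply:
  "to_front r i = (if i = r then 0 else if i < r then Suc i else i)"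
  by (induction r arbitrary: i) (auto simp: Transposition.transpose_def)

lemma sign_to_front: "sign (to_front r) = (-1) ^ r"
proof (induction r)
  case (Suc r)
  have "permutation (to_front r)" using to_front_permutes[of r] permutation_permutes by blast
  then have "sign (to_front (Suc r)) = sign (to_front r) * sign (Transposition.transpose r (Suc r))"
    unfolding to_front.simps by (intro sign_compose permutation_swap_id)
  then show ?case unfolding Suc.IH by (simp only: sign_swap_id n_not_Suc_n if_False power_Suc2)
qed (simp add: sign_id id_def[symmetric])

text \<open>Permutations of \<open>{1..n}\<close>, as extensions of permutations of the indices of the \<open>n\<close> arguments that are left
  after the first one has been contracted.\<close>

definition shift_perm :: "(nat \<Rightarrow> nat) \<Rightarrow> nat \<Rightarrow> nat" where
  "shift_perm p i = (case i of 0 \<Rightarrow> 0 | Suc j \<Rightarrow> Suc (p j))"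

lemma shift_perm_eq_map_permutation:
  assumes "p permutes {..<n}"
  shows "shift_perm p = map_permutation {..<n} Suc p"
proof
  fix i
  show "shift_perm p i = map_permutation {..<n} Suc p i"
  proof (cases i)
    case 0
    then show ?thesis by (simp add: shift_perm_def map_permutation_def restrict_id_def)
  next
    case (Suc j)
    have "inv_into {..<n} Suc (Suc j) = j" if "j < n"
      using that by (intro inv_into_f_eq) auto
    then show ?thesis using Suc permutes_not_in[OF assms, of j]
      by (auto simp: shift_perm_def map_permutation_def restrict_id_def)
  qed
qed

lemma bij_betw_Suc_lessThan: "bij_betw Suc {..<n} {1..<Suc n}"
  by (simp add: bij_betw_def image_Suc_lessThan atLeastLessThanSuc_atLeastAtMost)

lemma shift_perm_permutes: "p permutes {..<n} \<Longrightarrow> shift_perm p permutes {1..<Suc n}"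
  unfolding shift_perm_eq_map_permutation by (rule map_permutation_permutes[OF bij_betw_Suc_lessThan])

lemma sum_permutes_shift:
  "(\<Sum>q | q permutes {1..<Suc n}. f q) = (\<Sum>p | p permutes {..<n}. f (shift_perm p))"
proof -
  show ?thesis
  proof (rule sum.reindex_bij_witness[where i = "shift_perm" and j = "\<lambda>q i. q (Suc i) - 1"])
    fix q assume "q \<in> {q. q permutes {1..<Suc n}}"
    then have q: "q permutes {1..<Suc n}" by simp
    have q0: "q 0 = 0" using permutes_not_in[OF q, of 0] by simp
    have qS: "q (Suc i) \<noteq> 0" for i using q0 permutes_inj[OF q] by (metis injD nat.distinct(1))
    show *: "shift_perm (\<lambda>i. q (Suc i) - 1) = q"
    proof
      fix i show "shift_perm (\<lambda>i. q (Suc i) - 1) i = q i"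
        using qS by (cases i) (use qS[of "i - 1"] in \<open>simp_all add: shift_perm_def q0\<close>)
    qed
    show "(\<lambda>i. q (Suc i) - 1) \<in> {p. p permutes {..<n}}"
    proof (rule CollectI, rule inj_imp_permutes)
      show "inj_on (\<lambda>i. q (Suc i) - 1) {..<n}"
      proof (rule inj_onI)
        fix i j assume "q (Suc i) - 1 = q (Suc j) - 1"
        then have "q (Suc i) = q (Suc j)" using qS[of i] qS[of j] by arith
        then show "i = j" using permutes_inj[OF q] by (auto dest: injD)
      qed
      show "q (Suc i) - 1 \<in> {..<n}" if "i \<in> {..<n}" for i
        using permutes_in_image[OF q, of "Suc i"] that by auto
      show "q (Suc x) - 1 = x" if "x \<notin> {..<n}" for x
        using permutes_not_in[OF q, of "Suc x"] that by simp
    qed simp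
    show "f (shift_perm (\<lambda>i. q (Suc i) - 1)) = f q" by (simp only: *)
  next
    fix p assume "p \<in> {p. p permutes {..<n}}"
    then have p: "p permutes {..<n}" by simp
    show "(\<lambda>i. shift_perm p (Suc i) - 1) = p" by (simp add: shift_perm_def fun_eq_iff)
    show "shift_perm p \<in> {q. q permutes {1..<Suc n}}"
      using shift_perm_permutes[OF p] by simp
  qed
qed

lemma sign_shift_perm: "p permutes {..<n} \<Longrightarrow> sign (shift_perm p) = sign p"
  by (simp add: shift_perm_eq_map_permutation sign_map_permutation)

text \<open>Contraction with the first argument is an antiderivation. In the sum over permutations the terms in
  which \<open>v 0\<close> is an argument of \<open>\<alpha>\<close> all contribute the same, and so do those in which it is an argument
  of \<open>\<beta>\<close>; the factors \<open>r\<close> and \<open>s\<close> that arise turn the normalization \<open>1/(r! s!)\<close> into the ones of the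
  two smaller products.\<close>

lemma sum_perms_by_position:
  fixes \<alpha> \<beta> :: "('v::real_vector) form"
  assumes a: "alt_form r \<alpha>" and b: "alt_form s \<beta>" and rs: "r + s = Suc n"
  defines "g \<equiv> (\<lambda>v p. of_int (sign p) * \<alpha> (\<lambda>i. v (p i)) * \<beta> (\<lambda>i. v (p (r + i))))"
  shows "(\<Sum>p | p permutes {..<Suc n}. g v p) =
    r * (\<Sum>q | q permutes {1..<Suc n}. g v q) + s * (\<Sum>q | q permutes {1..<Suc n}. g v (q \<circ> to_front r))"
proof -
  let ?S = "{1..<Suc n}" and ?T = "Transposition.transpose :: nat \<Rightarrow> nat \<Rightarrow> nat \<Rightarrow> nat"
  have ins: "{..<Suc n} = insert 0 ?S" by auto
  have perm: "permutation q" if "q permutes ?S" for q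
    by (rule permutes_imp_permutation[OF _ that]) simp
  have invT: "inv (?T 0 k) = ?T 0 k" for k by (simp add: inv_swap_id)
  have "(\<Sum>p | p permutes {..<Suc n}. g v p) = (\<Sum>p | p permutes insert 0 ?S. g v (inv p))"
    unfolding ins by (rule sum_permutations_inverse)
  also have "\<dots> = (\<Sum>k\<in>insert 0 ?S. \<Sum>q | q permutes ?S. g v (inv (?T 0 k \<circ> q)))"
    by (rule sum_over_permutations_insert) auto
  also have "\<dots> = (\<Sum>k\<in>insert 0 ?S. \<Sum>q | q permutes ?S. g v (inv q \<circ> ?T 0 k))"
  proof (intro sum.cong refl)
    fix k q assume "q \<in> {q. q permutes ?S}"
    then have "inv (?T 0 k \<circ> q) = inv q \<circ> inv (?T 0 k)"
      by (intro permutation_inverse_compose permutation_swap_id perm) simp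
    then show "g v (inv (?T 0 k \<circ> q)) = g v (inv q \<circ> ?T 0 k)" by (simp only: invT)
  qed
  also have "\<dots> = (\<Sum>k\<in>insert 0 ?S. \<Sum>q | q permutes ?S. g v (q \<circ> ?T 0 k))"
  proof (rule sum.cong[OF refl])
    fix k show "(\<Sum>q | q permutes ?S. g v (inv q \<circ> ?T 0 k)) = (\<Sum>q | q permutes ?S. g v (q \<circ> ?T 0 k))"
      by (rule sum_permutations_inverse[symmetric, of "\<lambda>q. g v (q \<circ> ?T 0 k)"])
  qed
  also have "\<dots> = (\<Sum>k\<in>{..<Suc n}. if k < r then (\<Sum>q | q permutes ?S. g v q)
      else (\<Sum>q | q permutes ?S. g v (q \<circ> to_front r)))"
    unfolding ins
  proof (rule sum.cong[OF refl])
    fix k assume k: "k \<in> insert 0 ?S"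
    show "(\<Sum>q | q permutes ?S. g v (q \<circ> ?T 0 k)) = (if k < r then (\<Sum>q | q permutes ?S. g v q)
      else (\<Sum>q | q permutes ?S. g v (q \<circ> to_front r)))"
    proof (cases "k < r")
      case True
      have "g v (q \<circ> ?T 0 k) = g v q" if "q permutes ?S" for q
      proof (cases "k = 0")
        case False
        have "sign (q \<circ> ?T 0 k) = - sign q"
          using False by (subst sign_compose) (auto simp: permutation_swap_id sign_swap_id intro: perm[OF that])
        moreover have "\<alpha> (\<lambda>i. v ((q \<circ> ?T 0 k) i)) = - \<alpha> (\<lambda>i. v (q i))"
          using alt_form_swap[OF a, of 0 k "\<lambda>i. v (q i)"] True False by (simp add: o_def)
        moreover have "(\<lambda>i. v ((q \<circ> ?T 0 k) (r + i))) = (\<lambda>i. v (q (r + i)))"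
          using True by (auto simp: fun_eq_iff Transposition.transpose_def)
        ultimately show ?thesis unfolding g_def by simp
      qed simp
      then have "(\<Sum>q | q permutes ?S. g v (q \<circ> ?T 0 k)) = (\<Sum>q | q permutes ?S. g v q)"
        by (intro sum.cong[OF refl]) (simp only: mem_Collect_eq)
      then show ?thesis using True by (simp only: if_True)
    next
      case False
      then have rk: "r \<le> k" "k < Suc n" using k by auto
      let ?d = "to_front r \<circ> ?T r k \<circ> ?T 0 k"
      have "?d permutes {..<Suc n}"
      proof (intro permutes_compose permutes_swap_id)
        show "to_front r permutes {..<Suc n}"
          by (rule permutes_subset[OF to_front_permutes]) (use rk in auto)
      qed (use rk in auto)
      moreover have "?d 0 = 0" using rk
        by (auto simp: Transposition.transpose_def to_front_apply)
      ultimately have d: "?d permutes ?S"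
        unfolding ins permutes_def by (metis insert_iff)
      have "(\<Sum>q | q permutes ?S. g v (q \<circ> ?T 0 k)) = (\<Sum>q | q permutes ?S. g v (q \<circ> ?d \<circ> ?T 0 k))"
        by (rule sum_permutations_compose_right[OF d])
      also have "\<dots> = (\<Sum>q | q permutes ?S. g v (q \<circ> to_front r))"
      proof (rule sum.cong[OF refl])
        fix q assume "q \<in> {q. q permutes ?S}"
        then have q: "permutation (q \<circ> to_front r)"
          using perm[of q] to_front_permutes[of r]
          by (auto intro!: permutation_compose intro: permutes_imp_permutation)
        have "q \<circ> ?d \<circ> ?T 0 k = (q \<circ> to_front r) \<circ> ?T r k"
          by (simp add: fun_eq_iff)
        moreover have "g v ((q \<circ> to_front r) \<circ> ?T r k) = g v (q \<circ> to_front r)"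
        proof (cases "k = r")
          case False
          let ?w = "\<lambda>i. v ((q \<circ> to_front r) (r + i))"
          have "sign ((q \<circ> to_front r) \<circ> ?T r k) = - sign (q \<circ> to_front r)"
            using False q sign_compose[OF q permutation_swap_id, of r k] by (simp add: sign_swap_id)
          moreover have "\<beta> (\<lambda>i. v (((q \<circ> to_front r) \<circ> ?T r k) (r + i))) = - \<beta> ?w"
          proof -
            have "(\<lambda>i. v (((q \<circ> to_front r) \<circ> ?T r k) (r + i))) = ?w \<circ> ?T 0 (k - r)"
              using rk by (auto simp: fun_eq_iff Transposition.transpose_def)
            moreover have "\<beta> (?w \<circ> ?T 0 (k - r)) = - \<beta> ?w"
              using rk rs False by (intro alt_form_swap[OF b]) auto
            ultimately show ?thesis by (simp only:)
          qed
          moreover have "\<alpha> (\<lambda>i. v (((q \<circ> to_front r) \<circ> ?T r k) i)) = \<alpha> (\<lambda>i. v ((q \<circ> to_front r) i))"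
            by (rule alt_form_cong[OF a]) (use rk in \<open>auto simp: Transposition.transpose_def\<close>)
          ultimately show ?thesis unfolding g_def
            by (simp only: of_int_minus mult_minus_left mult_minus_right minus_minus)
        qed simp
        ultimately show "g v (q \<circ> ?d \<circ> ?T 0 k) = g v (q \<circ> to_front r)" by (simp only:)
      qed
      finally show ?thesis using False by (simp only: if_False)
    qed
  qed
  also have "\<dots> = (\<Sum>k<r. \<Sum>q | q permutes ?S. g v q) + (\<Sum>k=r..<Suc n. \<Sum>q | q permutes ?S. g v (q \<circ> to_front r))"
  proof -
    have "{..<Suc n} \<inter> {k. k < r} = {..<r}" "{..<Suc n} \<inter> - {k. k < r} = {r..<Suc n}" using rs by auto
    then show ?thesis by (simp only: sum.If_cases finite_lessThan)
  qed
  also have "\<dots> = r * (\<Sum>q | q permutes ?S. g v q) + s * (\<Sum>q | q permutes ?S. g v (q \<circ> to_front r))"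
  proof -
    have "Suc n - r = s" using rs by simp
    then show ?thesis by (simp only: sum_constant card_lessThan card_atLeastLessThan)
  qed
  finally show ?thesis .
qed

lemma wedge_contract:
  fixes \<alpha> \<beta> :: "('v::real_vector) form"
  assumes a: "alt_form r \<alpha>" and b: "alt_form s \<beta>" and rs: "r + s = Suc n"
  shows "wedge r s \<alpha> \<beta> v =
    (if r = 0 then 0 else wedge (r - 1) s (contract (v 0) \<alpha>) \<beta> (\<lambda>i. v (Suc i))) +
    (if s = 0 then 0 else (-1) ^ r * wedge r (s - 1) \<alpha> (contract (v 0) \<beta>) (\<lambda>i. v (Suc i)))"
proof -
  let ?g = "\<lambda>p. of_int (sign p) * \<alpha> (\<lambda>i. v (p i)) * \<beta> (\<lambda>i. v (p (r + i)))"
  let ?P = "{p. p permutes {..<n}}"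
  have A: "(\<Sum>q | q permutes {1..<Suc n}. ?g q) =
      fact (r - 1) * fact s * wedge (r - 1) s (contract (v 0) \<alpha>) \<beta> (\<lambda>i. v (Suc i))" if "r \<noteq> 0"
  proof -
    have "r - 1 + s = n" using rs that by simp
    moreover have "?g (shift_perm p) = of_int (sign p) * contract (v 0) \<alpha> (\<lambda>i. v (Suc (p i)))
        * \<beta> (\<lambda>i. v (Suc (p (r - 1 + i))))" if p: "p \<in> ?P" for p
    proof -
      have "(\<lambda>i. v (shift_perm p i)) = case_nat (v 0) (\<lambda>i. v (Suc (p i)))"
        by (auto simp: fun_eq_iff shift_perm_def split: nat.split)
      moreover have "(\<lambda>i. v (shift_perm p (r + i))) = (\<lambda>i. v (Suc (p (r - 1 + i))))"
        using \<open>r \<noteq> 0\<close> by (cases r) (simp_all add: shift_perm_def)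
      ultimately show ?thesis using sign_shift_perm[of p n] p by (simp add: contract_def)
    qed
    then have "(\<Sum>p\<in>?P. ?g (shift_perm p)) = (\<Sum>p\<in>?P. of_int (sign p) *
        contract (v 0) \<alpha> (\<lambda>i. v (Suc (p i))) * \<beta> (\<lambda>i. v (Suc (p (r - 1 + i)))))"
      by (rule sum.cong[OF refl])
    ultimately show ?thesis
      unfolding wedge_def sum_permutes_shift by simp
  qed
  have B: "(\<Sum>q | q permutes {1..<Suc n}. ?g (q \<circ> to_front r)) =
      (-1) ^ r * (fact r * fact (s - 1) * wedge r (s - 1) \<alpha> (contract (v 0) \<beta>) (\<lambda>i. v (Suc i)))" if "s \<noteq> 0"
  proof -
    have "r + (s - 1) = n" using rs that by simp
    moreover have "?g (shift_perm p \<circ> to_front r) = (-1) ^ r * (of_int (sign p) * \<alpha> (\<lambda>i. v (Suc (p i)))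
        * contract (v 0) \<beta> (\<lambda>i. v (Suc (p (r + i)))))" if p: "p \<in> ?P" for p
    proof -
      have "permutation (shift_perm p)"
        using permutes_imp_permutation[OF _ shift_perm_permutes, of n p] p by simp
      then have "sign (shift_perm p \<circ> to_front r) = sign p * (-1) ^ r"
        using sign_compose[of "shift_perm p" "to_front r"] to_front_permutes[of r] sign_shift_perm[of p n] p
          permutes_imp_permutation[of "{..r}" "to_front r"] by (simp add: sign_to_front)
      moreover have "\<alpha> (\<lambda>i. v ((shift_perm p \<circ> to_front r) i)) = \<alpha> (\<lambda>i. v (Suc (p i)))"
        by (rule alt_form_cong[OF a]) (simp add: to_front_apply shift_perm_def)
      moreover have "(\<lambda>i. v ((shift_perm p \<circ> to_front r) (r + i))) = case_nat (v 0) (\<lambda>i. v (Suc (p (r + i))))"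
        by (auto simp: fun_eq_iff shift_perm_def to_front_apply split: nat.split)
      ultimately show ?thesis by (simp add: contract_def)
    qed
    then have "(\<Sum>p\<in>?P. ?g (shift_perm p \<circ> to_front r)) = (\<Sum>p\<in>?P. (-1) ^ r * (of_int (sign p) *
        \<alpha> (\<lambda>i. v (Suc (p i))) * contract (v 0) \<beta> (\<lambda>i. v (Suc (p (r + i))))))"
      by (rule sum.cong[OF refl])
    ultimately show ?thesis
      unfolding wedge_def sum_permutes_shift by (simp add: sum_distrib_left[symmetric])
  qed
  have "wedge r s \<alpha> \<beta> v = (r * (\<Sum>q | q permutes {1..<Suc n}. ?g q)
      + s * (\<Sum>q | q permutes {1..<Suc n}. ?g (q \<circ> to_front r))) / (fact r * fact s)"
    unfolding wedge_def using sum_perms_by_position[OF a b rs, of v] rs by simp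
  also have "\<dots> = (if r = 0 then 0 else wedge (r - 1) s (contract (v 0) \<alpha>) \<beta> (\<lambda>i. v (Suc i))) +
    (if s = 0 then 0 else (-1) ^ r * wedge r (s - 1) \<alpha> (contract (v 0) \<beta>) (\<lambda>i. v (Suc i)))"
  proof -
    have fr: "fact r = real r * fact (r - 1)" if "r \<noteq> 0" using that fact_reduce[of r] by simp
    have fs: "fact s = real s * fact (s - 1)" if "s \<noteq> 0" using that fact_reduce[of s] by simp
    have F: "fact r * fact s \<noteq> (0::real)" by simp
    have "r * (\<Sum>q | q permutes {1..<Suc n}. ?g q) = (fact r * fact s) *
      (if r = 0 then 0 else wedge (r - 1) s (contract (v 0) \<alpha>) \<beta> (\<lambda>i. v (Suc i)))"
    proof (cases "r = 0")
      case False
      show ?thesis unfolding A[OF False] fr[OF False] using False by simp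
    qed simp
    moreover have "s * (\<Sum>q | q permutes {1..<Suc n}. ?g (q \<circ> to_front r)) = (fact r * fact s) *
      (if s = 0 then 0 else (-1) ^ r * wedge r (s - 1) \<alpha> (contract (v 0) \<beta>) (\<lambda>i. v (Suc i)))"
    proof (cases "s = 0")
      case False
      show ?thesis unfolding B[OF False] fs[OF False] using False by simp
    qed simp
    ultimately show ?thesis
      by (simp only: distrib_left[symmetric] nonzero_mult_div_cancel_left[OF F])
  qed
  finally show ?thesis .
qed

text \<open>Iterating the antiderivation rule evaluates an exterior product on a list of vectors: the sum runs over the
  ways to distribute the list over the two factors, with the sign of the shuffle.\<close>

fun shuffle :: "nat \<Rightarrow> nat \<Rightarrow> ('v list \<Rightarrow> real) \<Rightarrow> ('v list \<Rightarrow> real) \<Rightarrow> 'v list \<Rightarrow> real" where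
  "shuffle 0 s a b xs = a [] * b xs"
| "shuffle (Suc r) 0 a b xs = a xs * b []"
| "shuffle (Suc r) (Suc s) a b [] = 0"
| "shuffle (Suc r) (Suc s) a b (x # xs) =
     shuffle r (Suc s) (\<lambda>l. a (x # l)) b xs + (-1) ^ Suc r * shuffle (Suc r) s a (\<lambda>l. b (x # l)) xs"

lemma case_nat_nth: "case_nat x ((!) xs) = (!) (x # xs)"
  by (auto simp: fun_eq_iff split: nat.split)

lemma contract_nth: "contract x \<alpha> ((!) xs) = \<alpha> ((!) (x # xs))"
  by (simp add: contract_def case_nat_nth)

lemma wedge_eq_shuffle:
  fixes \<alpha> \<beta> :: "('v::real_vector) form"
  assumes "alt_form r \<alpha>" "alt_form s \<beta>" "length xs = r + s"
  shows "wedge r s \<alpha> \<beta> ((!) xs) = shuffle r s (\<lambda>l. \<alpha> ((!) l)) (\<lambda>l. \<beta> ((!) l)) xs"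
  using assms
proof (induction "r + s" arbitrary: r s \<alpha> \<beta> xs)
  case 0
  then show ?case by (auto simp: wedge_def)
next
  case (Suc n)
  note a = Suc.prems(1) and b = Suc.prems(2)
  obtain x ys where xs: "xs = x # ys" using Suc.prems(3) Suc.hyps(2) by (cases xs) auto
  have sh: "(\<lambda>i. (x # ys) ! Suc i) = (!) ys" by (simp add: fun_eq_iff)
  note step = wedge_contract[OF a b Suc.hyps(2)[symmetric], of "(!) xs", unfolded xs sh nth_Cons_0]
  have L: "wedge (r - 1) s (contract x \<alpha>) \<beta> ((!) ys) =
      shuffle (r - 1) s (\<lambda>l. \<alpha> ((!) (x # l))) (\<lambda>l. \<beta> ((!) l)) ys" if "r \<noteq> 0"
    using Suc.hyps(1)[of "r - 1" s "contract x \<alpha>" \<beta> ys] alt_form_contract[of "r - 1" \<alpha> x] a b that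
      Suc.hyps(2) Suc.prems(3) xs by (simp add: contract_nth)
  have R: "wedge r (s - 1) \<alpha> (contract x \<beta>) ((!) ys) =
      shuffle r (s - 1) (\<lambda>l. \<alpha> ((!) l)) (\<lambda>l. \<beta> ((!) (x # l))) ys" if "s \<noteq> 0"
    using Suc.hyps(1)[of r "s - 1" \<alpha> "contract x \<beta>" ys] alt_form_contract[of "s - 1" \<beta> x] a b that
      Suc.hyps(2) Suc.prems(3) xs by (simp add: contract_nth)
  show ?case
  proof (cases r)
    case 0
    then obtain s' where "s = Suc s'" using Suc.hyps(2) by (cases s) auto
    then show ?thesis unfolding xs step using 0 R by simp
  next
    case r: (Suc r')
    show ?thesis
    proof (cases s)
      case 0
      have "shuffle r' 0 (\<lambda>l. \<alpha> ((!) (x # l))) (\<lambda>l. \<beta> ((!) l)) ys = \<alpha> ((!) (x # ys)) * \<beta> ((!) [])"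
        using Suc.prems(3) xs r 0 by (cases r') auto
      then show ?thesis unfolding xs step using r 0 L by simp
    next
      case (Suc s')
      then show ?thesis unfolding xs step using r L R by simp
    qed
  qed
qed

section \<open>Functions of class C^k\<close>

lemma Ck_on_subset: "Ck_on k S f \<Longrightarrow> T \<subseteq> S \<Longrightarrow> Ck_on k T f"
  by (induction k arbitrary: f) (auto intro: continuous_on_subset)

lemma Ck_on_Suc_imp: "Ck_on (Suc k) S f \<Longrightarrow> Ck_on k S f"
proof (induction k arbitrary: f)
  case 0
  then show ?case
    by (auto intro!: continuous_at_imp_continuous_on differentiable_imp_continuous_within)
next
  case (Suc k)
  have "\<forall>x\<in>S. f differentiable (at x)" using Suc.prems by simp
  moreover have "Ck_on k S (\<lambda>x. frechet_derivative f (at x) v)" for v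
    by (rule Suc.IH) (use Suc.prems in auto)
  ultimately show ?case by simp
qed

lemma Ck_on_differentiable: "Ck_on (Suc k) S f \<Longrightarrow> x \<in> S \<Longrightarrow> f differentiable (at x)"
  by simp

lemma Ck_on_deriv: "Ck_on (Suc k) S f \<Longrightarrow> Ck_on k S (\<lambda>x. frechet_derivative f (at x) v)"
  by simp

lemma Ck_on_cong:
  assumes S: "open S" and eq: "\<And>x. x \<in> S \<Longrightarrow> f x = g x" and f: "Ck_on k S f"
  shows "Ck_on k S g"
  using f eq
proof (induction k arbitrary: f g)
  case 0
  then show ?case by (simp cong: continuous_on_cong)
next
  case (Suc k)
  have d: "f differentiable (at x)" if "x \<in> S" for x using Suc.prems that by simp
  have hd: "(g has_derivative frechet_derivative f (at x)) (at x)" if "x \<in> S" for x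
    using has_derivative_transform_within_open[OF _ S that Suc.prems(2)] d[OF that]
    by (simp add: frechet_derivative_works)
  have "Ck_on k S (\<lambda>x. frechet_derivative g (at x) v)" for v
  proof (rule Suc.IH)
    show "Ck_on k S (\<lambda>x. frechet_derivative f (at x) v)" using Suc.prems by simp
    show "frechet_derivative f (at x) v = frechet_derivative g (at x) v" if "x \<in> S" for x
      using frechet_derivative_at[OF hd[OF that]] by simp
  qed
  then show ?case using hd by (auto simp: differentiable_def)
qed

lemma frechet_derivative_eqI: "(f has_derivative f') (at x) \<Longrightarrow> frechet_derivative f (at x) v = f' v"
  by (metis frechet_derivative_at)

lemma has_frechet_derivative:
  "f differentiable (at x) \<Longrightarrow> (f has_derivative frechet_derivative f (at x)) (at x)"
  by (simp add: frechet_derivative_works)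

text \<open>The class \<open>C\<^sup>k\<close> is defined through the selected derivative; by this rule any explicit formula for the
  derivative on an open set will do.\<close>

lemma Ck_on_SucI:
  assumes S: "open S" and hd: "\<And>x. x \<in> S \<Longrightarrow> (f has_derivative f' x) (at x)"
    and "\<And>v. Ck_on k S (\<lambda>x. f' x v)"
  shows "Ck_on (Suc k) S f"
proof -
  have "Ck_on k S (\<lambda>x. frechet_derivative f (at x) v)" for v
    by (rule Ck_on_cong[OF S _ assms(3)[of v]]) (simp add: frechet_derivative_eqI[OF hd])
  then show ?thesis using hd by (auto simp: differentiable_def)
qed

lemma Ck_on_const: "Ck_on k S (\<lambda>x. c)"
  by (induction k arbitrary: c) auto

lemma Ck_on_add:
  assumes S: "open S"
  shows "Ck_on k S f \<Longrightarrow> Ck_on k S g \<Longrightarrow> Ck_on k S (\<lambda>x. f x + g x)"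
proof (induction k arbitrary: f g)
  case 0
  then show ?case by (auto intro: continuous_intros)
next
  case (Suc k)
  show ?case
  proof (rule Ck_on_SucI[OF S])
    show "((\<lambda>x. f x + g x) has_derivative
        (\<lambda>v. frechet_derivative f (at x) v + frechet_derivative g (at x) v)) (at x)" if "x \<in> S" for x
      using Suc.prems that by (intro has_derivative_add has_frechet_derivative) auto
  qed (use Suc.prems in \<open>auto intro: Suc.IH\<close>)
qed

lemma Ck_on_mult:
  fixes f g :: "'a::real_normed_vector \<Rightarrow> real"
  assumes S: "open S"
  shows "Ck_on k S f \<Longrightarrow> Ck_on k S g \<Longrightarrow> Ck_on k S (\<lambda>x. f x * g x)"
proof (induction k arbitrary: f g)
  case 0
  then show ?case by (auto intro: continuous_intros)
next
  case (Suc k)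
  show ?case
  proof (rule Ck_on_SucI[OF S])
    show "((\<lambda>x. f x * g x) has_derivative
        (\<lambda>v. f x * frechet_derivative g (at x) v + frechet_derivative f (at x) v * g x)) (at x)" if "x \<in> S" for x
      using Suc.prems that by (intro has_derivative_mult has_frechet_derivative) auto
    show "Ck_on k S (\<lambda>x. f x * frechet_derivative g (at x) v + frechet_derivative f (at x) v * g x)" for v
      using Ck_on_Suc_imp[OF Suc.prems(1)] Ck_on_Suc_imp[OF Suc.prems(2)] Suc.prems
      by (intro Ck_on_add[OF S] Suc.IH) auto
  qed
qed

lemma Ck_on_uminus:
  fixes f :: "'a::real_normed_vector \<Rightarrow> real"
  shows "open S \<Longrightarrow> Ck_on k S f \<Longrightarrow> Ck_on k S (\<lambda>x. - f x)"
  using Ck_on_mult[OF _ Ck_on_const[of k S "-1"], of f] by simp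

lemma Ck_on_diff:
  fixes f g :: "'a::real_normed_vector \<Rightarrow> real"
  shows "open S \<Longrightarrow> Ck_on k S f \<Longrightarrow> Ck_on k S g \<Longrightarrow> Ck_on k S (\<lambda>x. f x - g x)"
  using Ck_on_add[of S k f "\<lambda>x. - g x"] Ck_on_uminus[of S k g] by simp

lemma Ck_on_sum:
  fixes f :: "'i \<Rightarrow> 'a::real_normed_vector \<Rightarrow> real"
  shows "open S \<Longrightarrow> (\<And>i. i \<in> I \<Longrightarrow> Ck_on k S (f i)) \<Longrightarrow> Ck_on k S (\<lambda>x. \<Sum>i\<in>I. f i x)"
  by (induction I rule: infinite_finite_induct) (auto intro: Ck_on_const Ck_on_add simp del: Ck_on.simps)

lemma Ck_on_prod:
  fixes f :: "'i \<Rightarrow> 'a::real_normed_vector \<Rightarrow> real"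
  shows "open S \<Longrightarrow> (\<And>i. i \<in> I \<Longrightarrow> Ck_on k S (f i)) \<Longrightarrow> Ck_on k S (\<lambda>x. \<Prod>i\<in>I. f i x)"
  by (induction I rule: infinite_finite_induct) (auto intro: Ck_on_const Ck_on_mult simp del: Ck_on.simps)

lemma Ck_on_inverse:
  fixes f :: "'a::real_normed_vector \<Rightarrow> real"
  assumes S: "open S" and nz: "\<And>x. x \<in> S \<Longrightarrow> f x \<noteq> 0"
  shows "Ck_on k S f \<Longrightarrow> Ck_on k S (\<lambda>x. inverse (f x))"
proof (induction k)
  case 0
  then show ?case using nz by (auto intro!: continuous_intros)
next
  case (Suc k)
  show ?case
  proof (rule Ck_on_SucI[OF S])
    show "((\<lambda>x. inverse (f x)) has_derivative
        (\<lambda>v. - (inverse (f x) * frechet_derivative f (at x) v * inverse (f x)))) (at x)" if "x \<in> S" for x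
      using Suc.prems that nz by (intro Deriv.has_derivative_inverse has_frechet_derivative) auto
    show "Ck_on k S (\<lambda>x. - (inverse (f x) * frechet_derivative f (at x) v * inverse (f x)))" for v
      using Suc.IH[OF Ck_on_Suc_imp[OF Suc.prems]] Suc.prems
      by (intro Ck_on_uminus[OF S] Ck_on_mult[OF S]) auto
  qed
qed

lemma Ck_on_divide:
  fixes f g :: "'a::real_normed_vector \<Rightarrow> real"
  assumes "open S" and "\<And>x. x \<in> S \<Longrightarrow> g x \<noteq> 0" and "Ck_on k S f" and "Ck_on k S g"
  shows "Ck_on k S (\<lambda>x. f x / g x)"
  unfolding divide_inverse using assms by (intro Ck_on_mult Ck_on_inverse) auto

lemma Ck_on_sqrt:
  fixes f :: "'a::real_normed_vector \<Rightarrow> real"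
  assumes S: "open S" and pos: "\<And>x. x \<in> S \<Longrightarrow> f x > 0"
  shows "Ck_on k S f \<Longrightarrow> Ck_on k S (\<lambda>x. sqrt (f x))"
proof (induction k)
  case 0
  then show ?case by (auto intro!: continuous_intros)
next
  case (Suc k)
  have IH: "Ck_on k S (\<lambda>x. sqrt (f x))" by (rule Suc.IH[OF Ck_on_Suc_imp[OF Suc.prems]])
  show ?case
  proof (rule Ck_on_SucI[OF S])
    show "((\<lambda>x. sqrt (f x)) has_derivative
        (\<lambda>v. frechet_derivative f (at x) v * (inverse (sqrt (f x)) / 2))) (at x)" if x: "x \<in> S" for x
      using has_derivative_compose[OF has_frechet_derivative[of f]
          DERIV_real_sqrt[OF pos[OF x], unfolded has_field_derivative_def]] Suc.prems x
      by (simp add: mult_ac)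
    show "Ck_on k S (\<lambda>x. frechet_derivative f (at x) v * (inverse (sqrt (f x)) / 2))" for v
      unfolding divide_inverse using Suc.prems pos
      by (intro Ck_on_mult[OF S] Ck_on_inverse[OF S] IH Ck_on_const) (auto simp: less_imp_neq[symmetric])
  qed
qed

lemma Ck_on_det:
  fixes M :: "'a::real_normed_vector \<Rightarrow> real^'n^'n"
  assumes "open S" "\<And>i j. Ck_on k S (\<lambda>x. M x $ i $ j)"
  shows "Ck_on k S (\<lambda>x. det (M x))"
  unfolding det_def
  by (intro Ck_on_sum[OF assms(1)] Ck_on_mult[OF assms(1)] Ck_on_prod[OF assms(1)] Ck_on_const assms(2))

text \<open>By Cramer's rule the solution of a linear system is as regular as its coefficients.\<close>

lemma Ck_on_linear_system:
  fixes M :: "'a::real_normed_vector \<Rightarrow> real^'n^'n"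
  assumes S: "open S" and M: "\<And>i j. Ck_on k S (\<lambda>x. M x $ i $ j)" and b: "\<And>i. Ck_on k S (\<lambda>x. b x $ i)"
    and nz: "\<And>x. x \<in> S \<Longrightarrow> det (M x) \<noteq> 0" and sol: "\<And>x. x \<in> S \<Longrightarrow> M x *v z x = b x"
  shows "Ck_on k S (\<lambda>x. z x $ l)"
proof (rule Ck_on_cong[OF S])
  show "det (\<chi> i j. if j = l then b x $ i else M x $ i $ j) / det (M x) = z x $ l" if "x \<in> S" for x
    using iffD1[OF cramer[OF nz[OF that]] sol[OF that]] by (simp add: vec_eq_iff)
  have "Ck_on k S (\<lambda>x. if j = l then b x $ i else M x $ i $ j)" for i j
    using M b by (cases "j = l") auto
  then show "Ck_on k S (\<lambda>x. det (\<chi> i j. if j = l then b x $ i else M x $ i $ j) / det (M x))"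
    by (intro Ck_on_divide[OF S] Ck_on_det[OF S] nz) (simp_all add: M)
qed

text \<open>Both mixed derivatives are limits of the same second difference quotient over small squares.\<close>

lemma mixed_derivative_square:
  fixes f :: "'a::real_normed_vector \<Rightarrow> real"
  assumes U: "\<And>s t. 0 \<le> s \<Longrightarrow> s \<le> h \<Longrightarrow> 0 \<le> t \<Longrightarrow> t \<le> h \<Longrightarrow> x + s *\<^sub>R u + t *\<^sub>R v \<in> U"
    and f: "Ck_on 2 U f" and h: "h > 0"
  obtains s t where "0 \<le> s" "s \<le> h" "0 \<le> t" "t \<le> h"
    "f (x + h *\<^sub>R u + h *\<^sub>R v) - f (x + h *\<^sub>R u) - f (x + h *\<^sub>R v) + f x =
      h * h * frechet_derivative (\<lambda>y. frechet_derivative f (at y) u) (at (x + s *\<^sub>R u + t *\<^sub>R v)) v"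
proof -
  have f1: "f differentiable (at y)" "(\<lambda>y. frechet_derivative f (at y) u) differentiable (at y)" if "y \<in> U" for y
    using f that by (simp_all add: numeral_2_eq_2)
  let ?D = "\<lambda>y. frechet_derivative f (at y)"
  let ?p = "\<lambda>s t. x + s *\<^sub>R u + t *\<^sub>R v"
  let ?\<phi> = "\<lambda>s. f (?p s h) - f (?p s 0)"
  have ds: "((\<lambda>s. f (?p s t)) has_real_derivative ?D (?p s t) u) (at s)" if "0 \<le> s" "s \<le> h" "0 \<le> t" "t \<le> h" for s t
  proof -
    have lin: "?D (?p s t) (c *\<^sub>R u) = c * ?D (?p s t) u" for c
      using linear_frechet_derivative[OF f1(1)[OF U[OF that]]] by (simp add: linear_cmul)
    have "((\<lambda>s. ?p s t) has_derivative (\<lambda>c. c *\<^sub>R u)) (at s)" by (auto intro!: derivative_eq_intros)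
    from has_derivative_compose[OF this has_frechet_derivative[OF f1(1)[OF U[OF that]]]]
    show ?thesis unfolding has_field_derivative_def lin by (simp only: mult_commute_abs)
  qed
  have "\<exists>z>0. z < h \<and> ?\<phi> h - ?\<phi> 0 = (h - 0) * (?D (?p z h) u - ?D (?p z 0) u)"
    by (rule MVT2[OF h], rule DERIV_diff; rule ds) (use h in simp_all)
  then obtain s where s: "0 < s" "s < h" "?\<phi> h - ?\<phi> 0 = h * (?D (?p s h) u - ?D (?p s 0) u)" by auto
  let ?G = "\<lambda>y. frechet_derivative (\<lambda>y. ?D y u) (at y)"
  have dt: "((\<lambda>t. ?D (?p s t) u) has_real_derivative ?G (?p s t) v) (at t)" if "0 \<le> t" "t \<le> h" for t
  proof -
    have st: "?p s t \<in> U" using U s that by simp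
    have lin: "?G (?p s t) (c *\<^sub>R v) = c * ?G (?p s t) v" for c
      using linear_frechet_derivative[OF f1(2)[OF st]] by (simp add: linear_cmul)
    have "((\<lambda>t. ?p s t) has_derivative (\<lambda>c. c *\<^sub>R v)) (at t)" by (auto intro!: derivative_eq_intros)
    from has_derivative_compose[OF this has_frechet_derivative[OF f1(2)[OF st]]]
    show ?thesis unfolding has_field_derivative_def lin by (simp only: mult_commute_abs)
  qed
  have "\<exists>z>0. z < h \<and> ?D (?p s h) u - ?D (?p s 0) u = (h - 0) * ?G (?p s z) v"
    by (rule MVT2[OF h], rule dt) simp_all
  then obtain t where t: "0 < t" "t < h" "?D (?p s h) u - ?D (?p s 0) u = h * ?G (?p s t) v" by auto
  show ?thesis by (rule that[of s t]) (use s t in auto)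
qed

lemma mixed_derivatives_commute:
  fixes f :: "'a::real_normed_vector \<Rightarrow> real"
  assumes U: "open U" "x \<in> U" and f: "Ck_on 2 U f"
  shows "frechet_derivative (\<lambda>y. frechet_derivative f (at y) u) (at x) v =
    frechet_derivative (\<lambda>y. frechet_derivative f (at y) v) (at x) u"
proof -
  define G where "G u v y = frechet_derivative (\<lambda>y. frechet_derivative f (at y) u) (at y) v" for u v y
  have contG: "isCont (G u v) x" for u v
  proof -
    have "continuous_on U (G u v)" using f by (simp add: numeral_2_eq_2 G_def)
    then show ?thesis using U by (simp add: continuous_on_eq_continuous_at)
  qed
  have "dist (G u v x) (G v u x) < e" if e: "e > 0" for e
  proof -
    have "eventually (\<lambda>y. dist (G u v y) (G u v x) < e / 2 \<and> dist (G v u y) (G v u x) < e / 2 \<and> y \<in> U) (nhds x)"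
      using contG[of u v] contG[of v u] e U
      by (intro eventually_conj tendstoD eventually_nhds_in_open) (auto simp: isCont_def tendsto_at_iff_tendsto_nhds)
    then obtain d where d: "d > 0" "\<And>y. dist y x < d \<Longrightarrow>
        dist (G u v y) (G u v x) < e / 2 \<and> dist (G v u y) (G v u x) < e / 2 \<and> y \<in> U"
      unfolding eventually_nhds_metric by blast
    define h where "h = d / (norm u + norm v + 1)"
    have n1: "norm u + norm v + 1 > 0" by (simp add: add_nonneg_pos)
    have h: "h > 0" using d(1) n1 by (simp add: h_def)
    have near: "dist (x + s *\<^sub>R u + t *\<^sub>R v) x < d" if "0 \<le> s" "s \<le> h" "0 \<le> t" "t \<le> h" for s t
    proof -
      have "dist (x + s *\<^sub>R u + t *\<^sub>R v) x = norm (s *\<^sub>R u + t *\<^sub>R v)" by (simp add: dist_norm)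
      also have "\<dots> \<le> s * norm u + t * norm v" using norm_triangle_ineq[of "s *\<^sub>R u" "t *\<^sub>R v"] that by simp
      also have "\<dots> \<le> h * norm u + h * norm v" using that by (intro add_mono mult_right_mono) auto
      also have "\<dots> < h * (norm u + norm v + 1)" using h by (simp add: algebra_simps)
      also have "\<dots> = d" using n1 by (simp add: h_def)
      finally show ?thesis .
    qed
    have near': "dist (x + s *\<^sub>R v + t *\<^sub>R u) x < d" if "0 \<le> s" "s \<le> h" "0 \<le> t" "t \<le> h" for s t
      using near[of t s] that by (simp add: add.assoc add.commute[of "s *\<^sub>R v"])
    obtain s t where st: "0 \<le> s" "s \<le> h" "0 \<le> t" "t \<le> h"
      "f (x + h *\<^sub>R u + h *\<^sub>R v) - f (x + h *\<^sub>R u) - f (x + h *\<^sub>R v) + f x = h * h * G u v (x + s *\<^sub>R u + t *\<^sub>R v)"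
      using mixed_derivative_square[of h x u v U f] d(2) near f h unfolding G_def by metis
    obtain s' t' where st': "0 \<le> s'" "s' \<le> h" "0 \<le> t'" "t' \<le> h"
      "f (x + h *\<^sub>R v + h *\<^sub>R u) - f (x + h *\<^sub>R v) - f (x + h *\<^sub>R u) + f x = h * h * G v u (x + s' *\<^sub>R v + t' *\<^sub>R u)"
      using mixed_derivative_square[of h x v u U f] d(2) near' f h unfolding G_def by metis
    have "x + h *\<^sub>R v + h *\<^sub>R u = x + h *\<^sub>R u + h *\<^sub>R v" by simp
    then have "h * h * G u v (x + s *\<^sub>R u + t *\<^sub>R v) = h * h * G v u (x + s' *\<^sub>R v + t' *\<^sub>R u)"
      using st(5) st'(5) by (simp only:)
    then have "G u v (x + s *\<^sub>R u + t *\<^sub>R v) = G v u (x + s' *\<^sub>R v + t' *\<^sub>R u)" using h by simp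
    moreover have "dist (G u v (x + s *\<^sub>R u + t *\<^sub>R v)) (G u v x) < e / 2" using d(2)[OF near] st by blast
    moreover have "dist (G v u (x + s' *\<^sub>R v + t' *\<^sub>R u)) (G v u x) < e / 2" using d(2)[OF near'] st' by blast
    ultimately show ?thesis by (metis dist_triangle_half_r)
  qed
  then have "\<not> dist (G u v x) (G v u x) > 0" by (metis less_irrefl)
  then show ?thesis by (simp add: G_def)
qed

section \<open>Exterior products in low degree\<close>

lemma alt_form_args:
  "alt_form 0 \<alpha> \<Longrightarrow> \<alpha> v = \<alpha> ((!) [])"
  "alt_form 1 \<alpha> \<Longrightarrow> \<alpha> v = \<alpha> ((!) [v 0])"
  "alt_form 2 \<alpha> \<Longrightarrow> \<alpha> v = \<alpha> ((!) [v 0, v 1])"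
  "alt_form 3 \<alpha> \<Longrightarrow> \<alpha> v = \<alpha> ((!) [v 0, v 1, v 2])"
proof -
  show "alt_form 0 \<alpha> \<Longrightarrow> \<alpha> v = \<alpha> ((!) [])" by (erule alt_form_cong) simp
  show "alt_form 1 \<alpha> \<Longrightarrow> \<alpha> v = \<alpha> ((!) [v 0])" by (erule alt_form_cong) simp
  show "alt_form 2 \<alpha> \<Longrightarrow> \<alpha> v = \<alpha> ((!) [v 0, v 1])"
    by (erule alt_form_cong) (auto simp: numeral_2_eq_2 less_Suc_eq)
  show "alt_form 3 \<alpha> \<Longrightarrow> \<alpha> v = \<alpha> ((!) [v 0, v 1, v 2])"
    by (erule alt_form_cong) (auto simp: numeral_3_eq_3 numeral_2_eq_2 less_Suc_eq)
qed

lemma wedge_0_1: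
  assumes "alt_form 1 \<alpha>"
  shows "wedge 1 0 \<alpha> (\<lambda>v. 1) v = \<alpha> ((!) [v 0])"
proof -
  have "alt_form 1 (wedge 1 0 \<alpha> (\<lambda>v. 1))"
    using alt_form_wedge[OF assms alt_form_0I[of 1]] by simp
  then have "wedge 1 0 \<alpha> (\<lambda>v. 1) v = wedge 1 0 \<alpha> (\<lambda>v. 1) ((!) [v 0])" by (rule alt_form_args(2))
  also have "\<dots> = \<alpha> ((!) [v 0])"
    using wedge_eq_shuffle[OF assms alt_form_0I[of 1], of "[v 0]"] by simp
  finally show ?thesis .
qed

lemma wedge_1_1:
  "alt_form 1 \<alpha> \<Longrightarrow> alt_form 1 \<beta> \<Longrightarrow>
    wedge 1 1 \<alpha> \<beta> ((!) [x, y]) = \<alpha> ((!) [x]) * \<beta> ((!) [y]) - \<alpha> ((!) [y]) * \<beta> ((!) [x])"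
  using wedge_eq_shuffle[of 1 \<alpha> 1 \<beta> "[x, y]"] by simp

lemma wedge_1_2:
  "alt_form 1 \<alpha> \<Longrightarrow> alt_form 2 \<beta> \<Longrightarrow> wedge 1 2 \<alpha> \<beta> ((!) [x, y, z]) =
    \<alpha> ((!) [x]) * \<beta> ((!) [y, z]) - \<alpha> ((!) [y]) * \<beta> ((!) [x, z]) + \<alpha> ((!) [z]) * \<beta> ((!) [x, y])"
  using wedge_eq_shuffle[of 1 \<alpha> 2 \<beta> "[x, y, z]"] by (simp add: eval_nat_numeral)

lemma wedge_1_3:
  "alt_form 1 \<alpha> \<Longrightarrow> alt_form 3 \<beta> \<Longrightarrow> wedge 1 3 \<alpha> \<beta> ((!) [x, y, z, w]) =
    \<alpha> ((!) [x]) * \<beta> ((!) [y, z, w]) - \<alpha> ((!) [y]) * \<beta> ((!) [x, z, w])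
    + \<alpha> ((!) [z]) * \<beta> ((!) [x, y, w]) - \<alpha> ((!) [w]) * \<beta> ((!) [x, y, z])"
  using wedge_eq_shuffle[of 1 \<alpha> 3 \<beta> "[x, y, z, w]"] by (simp add: eval_nat_numeral)

lemma wedge_2_2:
  "alt_form 2 \<alpha> \<Longrightarrow> alt_form 2 \<beta> \<Longrightarrow> wedge 2 2 \<alpha> \<beta> ((!) [x, y, z, w]) =
    \<alpha> ((!) [x, y]) * \<beta> ((!) [z, w]) - \<alpha> ((!) [x, z]) * \<beta> ((!) [y, w]) + \<alpha> ((!) [x, w]) * \<beta> ((!) [y, z])
    + \<alpha> ((!) [y, z]) * \<beta> ((!) [x, w]) - \<alpha> ((!) [y, w]) * \<beta> ((!) [x, z]) + \<alpha> ((!) [z, w]) * \<beta> ((!) [x, y])"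
  using wedge_eq_shuffle[of 2 \<alpha> 2 \<beta> "[x, y, z, w]"] by (simp add: eval_nat_numeral)

lemma wedge_2_4:
  assumes "alt_form 2 \<alpha>" "alt_form 4 \<beta>"
  shows "wedge 2 4 \<alpha> \<beta> ((!) [a, b, c, d, e, f]) =
    \<alpha> ((!) [a, b]) * \<beta> ((!) [c, d, e, f]) - \<alpha> ((!) [a, c]) * \<beta> ((!) [b, d, e, f])
    + \<alpha> ((!) [a, d]) * \<beta> ((!) [b, c, e, f]) - \<alpha> ((!) [a, e]) * \<beta> ((!) [b, c, d, f])
    + \<alpha> ((!) [a, f]) * \<beta> ((!) [b, c, d, e]) + \<alpha> ((!) [b, c]) * \<beta> ((!) [a, d, e, f])
    - \<alpha> ((!) [b, d]) * \<beta> ((!) [a, c, e, f]) + \<alpha> ((!) [b, e]) * \<beta> ((!) [a, c, d, f])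
    - \<alpha> ((!) [b, f]) * \<beta> ((!) [a, c, d, e]) + \<alpha> ((!) [c, d]) * \<beta> ((!) [a, b, e, f])
    - \<alpha> ((!) [c, e]) * \<beta> ((!) [a, b, d, f]) + \<alpha> ((!) [c, f]) * \<beta> ((!) [a, b, d, e])
    + \<alpha> ((!) [d, e]) * \<beta> ((!) [a, b, c, f]) - \<alpha> ((!) [d, f]) * \<beta> ((!) [a, b, c, e])
    + \<alpha> ((!) [e, f]) * \<beta> ((!) [a, b, c, d])"
  using wedge_eq_shuffle[OF assms, of "[a, b, c, d, e, f]"] by (simp add: eval_nat_numeral)

lemma wedge_3_2:
  assumes "alt_form 3 \<alpha>" "alt_form 2 \<beta>"
  shows "wedge 3 2 \<alpha> \<beta> ((!) [a, b, c, d, e]) =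
    \<alpha> ((!) [a, b, c]) * \<beta> ((!) [d, e]) - \<alpha> ((!) [a, b, d]) * \<beta> ((!) [c, e])
    + \<alpha> ((!) [a, b, e]) * \<beta> ((!) [c, d]) + \<alpha> ((!) [a, c, d]) * \<beta> ((!) [b, e])
    - \<alpha> ((!) [a, c, e]) * \<beta> ((!) [b, d]) + \<alpha> ((!) [a, d, e]) * \<beta> ((!) [b, c])
    - \<alpha> ((!) [b, c, d]) * \<beta> ((!) [a, e]) + \<alpha> ((!) [b, c, e]) * \<beta> ((!) [a, d])
    - \<alpha> ((!) [b, d, e]) * \<beta> ((!) [a, c]) + \<alpha> ((!) [c, d, e]) * \<beta> ((!) [a, b])"
  using wedge_eq_shuffle[OF assms, of "[a, b, c, d, e]"] by (simp add: eval_nat_numeral)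

lemma wedge_3_3:
  assumes "alt_form 3 \<alpha>" "alt_form 3 \<beta>"
  shows "wedge 3 3 \<alpha> \<beta> ((!) [a, b, c, d, e, f]) =
    \<alpha> ((!) [a, b, c]) * \<beta> ((!) [d, e, f]) - \<alpha> ((!) [a, b, d]) * \<beta> ((!) [c, e, f])
    + \<alpha> ((!) [a, b, e]) * \<beta> ((!) [c, d, f]) - \<alpha> ((!) [a, b, f]) * \<beta> ((!) [c, d, e])
    + \<alpha> ((!) [a, c, d]) * \<beta> ((!) [b, e, f]) - \<alpha> ((!) [a, c, e]) * \<beta> ((!) [b, d, f])
    + \<alpha> ((!) [a, c, f]) * \<beta> ((!) [b, d, e]) + \<alpha> ((!) [a, d, e]) * \<beta> ((!) [b, c, f])
    - \<alpha> ((!) [a, d, f]) * \<beta> ((!) [b, c, e]) + \<alpha> ((!) [a, e, f]) * \<beta> ((!) [b, c, d])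
    - \<alpha> ((!) [b, c, d]) * \<beta> ((!) [a, e, f]) + \<alpha> ((!) [b, c, e]) * \<beta> ((!) [a, d, f])
    - \<alpha> ((!) [b, c, f]) * \<beta> ((!) [a, d, e]) - \<alpha> ((!) [b, d, e]) * \<beta> ((!) [a, c, f])
    + \<alpha> ((!) [b, d, f]) * \<beta> ((!) [a, c, e]) - \<alpha> ((!) [b, e, f]) * \<beta> ((!) [a, c, d])
    + \<alpha> ((!) [c, d, e]) * \<beta> ((!) [a, b, f]) - \<alpha> ((!) [c, d, f]) * \<beta> ((!) [a, b, e])
    + \<alpha> ((!) [c, e, f]) * \<beta> ((!) [a, b, d]) - \<alpha> ((!) [d, e, f]) * \<beta> ((!) [a, b, c])"
  using wedge_eq_shuffle[OF assms, of "[a, b, c, d, e, f]"] by (simp add: eval_nat_numeral)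

lemma alt_form_cowedge:
  "(\<And>i. i \<in> set is \<Longrightarrow> linear (e i)) \<Longrightarrow> alt_form (length is) (cowedge e is)"
proof (induction "is")
  case Nil
  then show ?case by (simp add: alt_form_0I)
next
  case (Cons i "is")
  then show ?case
    using alt_form_wedge[OF alt_form_1I[of "e i"], of "length is" "cowedge e is"] by simp
qed

lemma alt_form_cowedge_1: "linear (e i) \<Longrightarrow> alt_form 1 (cowedge e [i])"
  using alt_form_cowedge[of "[i]" e] by (simp del: cowedge.simps)

lemma alt_form_cowedge_2: "linear (e i) \<Longrightarrow> linear (e j) \<Longrightarrow> alt_form 2 (cowedge e [i, j])"
  using alt_form_cowedge[of "[i, j]" e] by (auto simp: numeral_2_eq_2 simp del: cowedge.simps)

lemma alt_form_cowedge_3: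
  "linear (e i) \<Longrightarrow> linear (e j) \<Longrightarrow> linear (e k) \<Longrightarrow> alt_form 3 (cowedge e [i, j, k])"
  using alt_form_cowedge[of "[i, j, k]" e] by (auto simp: numeral_3_eq_3 simp del: cowedge.simps)

lemma cowedge_1:
  assumes "linear (e i)" shows "cowedge e [i] v = e i (v 0)"
  using wedge_0_1[OF alt_form_1I[OF assms], of v] by simp

lemma cowedge_2:
  assumes "linear (e i)" "linear (e j)"
  shows "cowedge e [i, j] v = e i (v 0) * e j (v 1) - e i (v 1) * e j (v 0)"
proof -
  have "cowedge e [i, j] v = cowedge e [i, j] ((!) [v 0, v 1])"
    by (rule alt_form_args(3)[OF alt_form_cowedge_2[of e, OF assms]])
  also have "\<dots> = e i (v 0) * e j (v 1) - e i (v 1) * e j (v 0)"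
    using wedge_1_1[OF alt_form_1I[OF assms(1)] alt_form_cowedge_1[of e, OF assms(2)], of "v 0" "v 1"]
    by (simp add: cowedge_1[of e, OF assms(2)] cowedge.simps(2)[of e i] del: cowedge.simps)
  finally show ?thesis .
qed

lemma cowedge_3:
  assumes "linear (e i)" "linear (e j)" "linear (e k)"
  shows "cowedge e [i, j, k] v =
    e i (v 0) * (e j (v 1) * e k (v 2) - e j (v 2) * e k (v 1))
    - e i (v 1) * (e j (v 0) * e k (v 2) - e j (v 2) * e k (v 0))
    + e i (v 2) * (e j (v 0) * e k (v 1) - e j (v 1) * e k (v 0))"
proof -
  have a: "alt_form 2 (cowedge e [j, k])"
    by (rule alt_form_cowedge_2[of e, OF assms(2,3)])
  have "cowedge e [i, j, k] v = cowedge e [i, j, k] ((!) [v 0, v 1, v 2])"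
    by (rule alt_form_args(4)[OF alt_form_cowedge_3[of e, OF assms]])
  also have "\<dots> = wedge 1 2 (\<lambda>v. e i (v 0)) (cowedge e [j, k]) ((!) [v 0, v 1, v 2])"
    by (simp add: numeral_2_eq_2)
  also have "\<dots> = e i (v 0) * (e j (v 1) * e k (v 2) - e j (v 2) * e k (v 1))
    - e i (v 1) * (e j (v 0) * e k (v 2) - e j (v 2) * e k (v 0))
    + e i (v 2) * (e j (v 0) * e k (v 1) - e j (v 1) * e k (v 0))"
    unfolding wedge_1_2[OF alt_form_1I[OF assms(1)] a] cowedge_2[of e, OF assms(2,3)] by simp
  finally show ?thesis .
qed

section \<open>Adapted frames\<close>

lemma sum_1_6: "(\<Sum>i=1..6. f i) = f 1 + f 2 + f 3 + f 4 + f 5 + f (6::nat)"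
  by (simp add: eval_nat_numeral add.assoc)

lemma ball_1_6: "(\<forall>i\<in>{1..6}. P i) \<longleftrightarrow> P 1 \<and> P 2 \<and> P 3 \<and> P 4 \<and> P 5 \<and> P (6::nat)"
proof -
  have "{1..6} = {1, 2, 3, 4, 5, 6::nat}" by auto
  then show ?thesis by simp
qed

text \<open>Six independent functionals on a six-dimensional space have a dual frame: no nonzero vector is
  orthogonal to the range of the map that they define, which is therefore bijective.\<close>

lemma coframe_dual:
  assumes e: "coframe e"
  shows "(\<forall>i\<in>{1..6}. \<forall>j\<in>{1..6}. e j (dual_frame e i) = (if j = i then 1 else 0))"
    and "(\<forall>j\<in>{1..6}. e j u = 0) \<Longrightarrow> u = 0"
proof -
  have lin: "linear (e i)" if "i \<in> {1..6}" for i using e that unfolding coframe_def by simp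
  obtain h :: "6 \<Rightarrow> nat" where h: "bij_betw h UNIV {1..6}"
    using finite_same_card_bij[of "UNIV :: 6 set" "{1..6::nat}"] by auto
  then have inj_h: "inj h" and ran_h: "range h = {1..6}" by (simp_all only: bij_betw_def)
  have h16: "h k \<in> {1..6}" for k using ran_h by blast
  define L where "L u = (\<chi> k. e (h k) u)" for u
  have L: "linear L"
    unfolding L_def
    by (rule linearI) (simp_all add: vec_eq_iff linear_add[OF lin[OF h16]] linear_cmul[OF lin[OF h16]])
  have "range L = UNIV"
  proof (rule ccontr)
    assume "range L \<noteq> UNIV"
    moreover have "span (range L) = range L" using linear_subspace_image[OF L subspace_UNIV] by simp
    ultimately have "span (range L) \<subset> span UNIV" by (simp only: span_UNIV psubset_eq subset_UNIV simp_thms)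
    then obtain a where a: "a \<noteq> 0" "\<And>y. y \<in> span (range L) \<Longrightarrow> orthogonal a y"
      using orthogonal_to_subspace_exists_gen[of "range L" UNIV] by auto
    define b where "b i = a $ inv h i" for i
    have "(\<Sum>i=1..6. b i * e i u) = 0" for u
    proof -
      have "0 = a \<bullet> L u" using a(2)[of "L u"] by (auto simp: orthogonal_def span_base)
      also have "\<dots> = (\<Sum>k\<in>UNIV. a $ k * e (h k) u)" by (simp add: inner_vec_def L_def)
      also have "\<dots> = (\<Sum>k\<in>UNIV. b (h k) * e (h k) u)"
        by (simp add: b_def inv_f_f[OF inj_h])
      also have "\<dots> = (\<Sum>i=1..6. b i * e i u)" by (rule sum.reindex_bij_betw[OF h])
      finally show ?thesis by simp
    qed
    then have "\<forall>i\<in>{1..6}. b i = 0" using e unfolding coframe_def by blast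
    then have "a $ k = 0" for k using h16[of k] by (metis b_def inv_f_f inj_h)
    then show False using a(1) by (simp add: vec_eq_iff)
  qed
  then have inj: "inj L" using linear_surjective_imp_injective[OF L] by simp
  show 0: "u = 0" if "\<forall>j\<in>{1..6}. e j u = 0" for u
  proof -
    have "L u = L 0" using that h16 by (simp add: L_def vec_eq_iff linear_0[OF lin])
    then show ?thesis using inj by (simp add: inj_eq)
  qed
  have "\<exists>!u. \<forall>j\<in>{1..6}. e j u = (if j = i then 1 else 0)" if i: "i \<in> {1..6}" for i
  proof -
    obtain k where k: "h k = i" using i unfolding ran_h[symmetric] by blast
    obtain u where u: "L u = axis k 1" using \<open>range L = UNIV\<close> by (metis surjD)
    have "e j u = (if j = i then 1 else 0)" if "j \<in> {1..6}" for j
    proof -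
      obtain l where l: "h l = j" using \<open>j \<in> {1..6}\<close> unfolding ran_h[symmetric] by blast
      have "e j u = axis k 1 $ l" using u l by (metis L_def vec_lambda_beta)
      also have "\<dots> = (if j = i then 1 else 0)" using k l inj_eq[OF inj_h, of l k] by (auto simp: axis_def)
      finally show ?thesis .
    qed
    moreover have "w = u" if "\<forall>j\<in>{1..6}. e j w = (if j = i then 1 else 0)"
        "\<forall>j\<in>{1..6}. e j u = (if j = i then 1 else 0)" for w u
      using 0[of "w - u"] that by (simp add: linear_diff[OF lin])
    ultimately show ?thesis by blast
  qed
  from theI'[OF this] show "\<forall>i\<in>{1..6}. \<forall>j\<in>{1..6}. e j (dual_frame e i) = (if j = i then 1 else 0)"
    unfolding dual_frame_def by blast
qed

lemma coframe_expand:
  assumes co: "coframe e" and dual: "\<And>i j. i \<in> {1..6} \<Longrightarrow> j \<in> {1..6} \<Longrightarrow> e i (E j) = (if i = j then 1 else 0)"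
  shows "u = (\<Sum>i=1..6. e i u *\<^sub>R E i)"
proof -
  have lin: "linear (e i)" if "i \<in> {1..6}" for i using co that unfolding coframe_def by simp
  have "e j (u - (\<Sum>i=1..6. e i u *\<^sub>R E i)) = 0" if j: "j \<in> {1..6}" for j
  proof -
    have "e j (u - (\<Sum>i=1..6. e i u *\<^sub>R E i)) = e j u - (\<Sum>i=1..6. e i u * e j (E i))"
      by (simp add: linear_diff[OF lin[OF j]] linear_sum[OF lin[OF j]] linear_cmul[OF lin[OF j]])
    also have "(\<Sum>i=1..6. e i u * e j (E i)) = (\<Sum>i=1..6. if j = i then e i u else 0)"
      by (rule sum.cong) (use j dual in auto)
    also have "\<dots> = e j u" using j by simp
    finally show ?thesis by simp
  qed
  then have "u - (\<Sum>i=1..6. e i u *\<^sub>R E i) = 0" by (intro coframe_dual(2)[OF co]) blast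
  then show ?thesis by (simp only: right_minus_eq)
qed

lemma coframe_span:
  assumes co: "coframe e" and dual: "\<And>i j. i \<in> {1..6} \<Longrightarrow> j \<in> {1..6} \<Longrightarrow> e i (E j) = (if i = j then 1 else 0)"
  shows "span (E ` {1..6}) = UNIV"
proof -
  have "u \<in> span (E ` {1..6})" for u
  proof -
    have "(\<Sum>i=1..6. e i u *\<^sub>R E i) \<in> span (E ` {1..6})"
      by (intro span_sum span_scale span_base imageI)
    then show ?thesis using coframe_expand[OF co dual, of u] by simp
  qed
  then show ?thesis by auto
qed

definition adapted_frame ::
  "(real^6) form \<Rightarrow> (real^6) form \<Rightarrow> (nat \<Rightarrow> real^6 \<Rightarrow> real) \<Rightarrow> (nat \<Rightarrow> real^6) \<Rightarrow> bool" where
  "adapted_frame \<kappa> \<Omega> e E \<longleftrightarrow> adapted \<kappa> \<Omega> e \<and>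
     (\<forall>i\<in>{1..6}. \<forall>j\<in>{1..6}. e i (E j) = (if i = j then 1 else 0))"

lemma adapted_frame_dual: "adapted \<kappa> \<Omega> e \<Longrightarrow> adapted_frame \<kappa> \<Omega> e (dual_frame e)"
  using coframe_dual(1)[of e] by (simp add: adapted_frame_def adapted_def)

locale SU3_frame =
  fixes \<kappa> \<Omega> e E
  assumes adapted_frame: "adapted_frame \<kappa> \<Omega> e E"
begin

lemma coframe: "coframe e"
  using adapted_frame by (simp add: adapted_frame_def adapted_def)

lemma lin: "i \<in> {1..6} \<Longrightarrow> linear (e i)"
  using coframe by (simp add: coframe_def)

lemma dual: "i \<in> {1..6} \<Longrightarrow> j \<in> {1..6} \<Longrightarrow> e i (E j) = (if i = j then 1 else 0)"
  using adapted_frame by (simp add: adapted_frame_def)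

lemma expand: "u = (\<Sum>i=1..6. e i u *\<^sub>R E i)"
  by (rule coframe_expand[OF coframe dual])

lemma dual_explicit [simp]:
  "e 1 (E 1) = 1" "e 1 (E 2) = 0" "e 1 (E 3) = 0" "e 1 (E 4) = 0" "e 1 (E 5) = 0" "e 1 (E 6) = 0"
  "e 2 (E 1) = 0" "e 2 (E 2) = 1" "e 2 (E 3) = 0" "e 2 (E 4) = 0" "e 2 (E 5) = 0" "e 2 (E 6) = 0"
  "e 3 (E 1) = 0" "e 3 (E 2) = 0" "e 3 (E 3) = 1" "e 3 (E 4) = 0" "e 3 (E 5) = 0" "e 3 (E 6) = 0"
  "e 4 (E 1) = 0" "e 4 (E 2) = 0" "e 4 (E 3) = 0" "e 4 (E 4) = 1" "e 4 (E 5) = 0" "e 4 (E 6) = 0"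
  "e 5 (E 1) = 0" "e 5 (E 2) = 0" "e 5 (E 3) = 0" "e 5 (E 4) = 0" "e 5 (E 5) = 1" "e 5 (E 6) = 0"
  "e 6 (E 1) = 0" "e 6 (E 2) = 0" "e 6 (E 3) = 0" "e 6 (E 4) = 0" "e 6 (E 5) = 0" "e 6 (E 6) = 1"
  by (simp_all add: dual)

lemmas e_add = linear_add[OF lin] and e_diff = linear_diff[OF lin] and e_scaleR = linear_cmul[OF lin]

lemma kappa: "\<kappa> v = e 1 (v 0) * e 2 (v 1) - e 1 (v 1) * e 2 (v 0) + (e 3 (v 0) * e 4 (v 1) - e 3 (v 1) * e 4 (v 0))
    + (e 5 (v 0) * e 6 (v 1) - e 5 (v 1) * e 6 (v 0))"
  using adapted_frame by (simp add: adapted_frame_def adapted_def cowedge_2 lin del: cowedge.simps)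

lemma Omega: "\<Omega> v = cowedge e [1,3,5] v - cowedge e [1,4,6] v - cowedge e [2,4,5] v - cowedge e [2,3,6] v"
  using adapted_frame unfolding adapted_frame_def adapted_def by (simp del: cowedge.simps)

lemma Omega_explicit: "\<Omega> v =
    (e 1 (v 0) * (e 3 (v 1) * e 5 (v 2) - e 3 (v 2) * e 5 (v 1))
    - e 1 (v 1) * (e 3 (v 0) * e 5 (v 2) - e 3 (v 2) * e 5 (v 0))
    + e 1 (v 2) * (e 3 (v 0) * e 5 (v 1) - e 3 (v 1) * e 5 (v 0)))
    - (e 1 (v 0) * (e 4 (v 1) * e 6 (v 2) - e 4 (v 2) * e 6 (v 1))
    - e 1 (v 1) * (e 4 (v 0) * e 6 (v 2) - e 4 (v 2) * e 6 (v 0))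
    + e 1 (v 2) * (e 4 (v 0) * e 6 (v 1) - e 4 (v 1) * e 6 (v 0)))
    - (e 2 (v 0) * (e 4 (v 1) * e 5 (v 2) - e 4 (v 2) * e 5 (v 1))
    - e 2 (v 1) * (e 4 (v 0) * e 5 (v 2) - e 4 (v 2) * e 5 (v 0))
    + e 2 (v 2) * (e 4 (v 0) * e 5 (v 1) - e 4 (v 1) * e 5 (v 0)))
    - (e 2 (v 0) * (e 3 (v 1) * e 6 (v 2) - e 3 (v 2) * e 6 (v 1))
    - e 2 (v 1) * (e 3 (v 0) * e 6 (v 2) - e 3 (v 2) * e 6 (v 0))
    + e 2 (v 2) * (e 3 (v 0) * e 6 (v 1) - e 3 (v 1) * e 6 (v 0)))"
  unfolding Omega by (simp only: cowedge_3 lin atLeastAtMost_iff one_le_numeral numeral_le_iff le_num_simps order_refl semiring_norm simp_thms)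

lemma alt_kappa: "alt_form 2 \<kappa>"
proof -
  have "alt_form 2 (cowedge e [i, j])" if "i \<in> {1..6}" "j \<in> {1..6}" for i j
    by (intro alt_form_cowedge_2 lin that)
  then show ?thesis
    using adapted_frame unfolding adapted_frame_def adapted_def
    by (auto intro!: alt_form_add simp del: cowedge.simps)
qed

lemma alt_Omega: "alt_form 3 \<Omega>"
proof -
  have "alt_form 3 (cowedge e [i, j, k])" if "i \<in> {1..6}" "j \<in> {1..6}" "k \<in> {1..6}" for i j k
    by (intro alt_form_cowedge_3 lin that)
  then show ?thesis
    using adapted_frame unfolding adapted_frame_def adapted_def
    by (auto intro!: alt_form_diff simp del: cowedge.simps)
qed

text \<open>The complex structure and the metric as given by one adapted coframe. That every adapted coframe gives the
  same ones follows below, where both are recovered from \<open>\<kappa>\<close> and \<open>\<Omega>\<close>.\<close>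

definition J :: "real^6 \<Rightarrow> real^6" where
  "J u = e 1 u *\<^sub>R E 2 - e 2 u *\<^sub>R E 1 + e 3 u *\<^sub>R E 4 - e 4 u *\<^sub>R E 3 + e 5 u *\<^sub>R E 6 - e 6 u *\<^sub>R E 5"

definition g :: "real^6 \<Rightarrow> real^6 \<Rightarrow> real" where
  "g u w = (\<Sum>i=1..6. e i u * e i w)"

lemma g_explicit: "g u w = e 1 u * e 1 w + e 2 u * e 2 w + e 3 u * e 3 w + e 4 u * e 4 w + e 5 u * e 5 w + e 6 u * e 6 w"
  unfolding g_def sum_1_6 ..

lemma e_J [simp]:
  "e 1 (J u) = - e 2 u" "e 2 (J u) = e 1 u" "e 3 (J u) = - e 4 u" "e 4 (J u) = e 3 u"
  "e 5 (J u) = - e 6 u" "e 6 (J u) = e 5 u"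
  unfolding J_def by (simp_all add: e_add e_diff e_scaleR del: One_nat_def)

lemma g_J: "g (J u) w = \<kappa> ((!) [u, w])"
  by (simp add: g_explicit kappa del: One_nat_def)

lemma g_nondegenerate: "(\<And>w. g u w = 0) \<Longrightarrow> u = 0"
proof (rule coframe_dual(2)[OF coframe])
  assume z: "\<And>w. g u w = 0"
  show "\<forall>j\<in>{1..6}. e j u = 0"
    using z[of "E 1"] z[of "E 2"] z[of "E 3"] z[of "E 4"] z[of "E 5"] z[of "E 6"]
    unfolding ball_1_6 by (simp add: g_explicit del: One_nat_def)
qed

lemma span_frame: "span ((!) [E 1, E 2, E 3, E 4, E 5, E 6] ` {..<6}) = UNIV"
proof -
  have "(!) [E 1, E 2, E 3, E 4, E 5, E 6] ` {..<6} = {E 1, E 2, E 3, E 4, E 5, E 6}"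
    by (simp add: lessThan_Suc eval_nat_numeral insert_commute)
  moreover have "u \<in> span {E 1, E 2, E 3, E 4, E 5, E 6}" for u
    by (subst expand[of u], unfold sum_1_6) (intro span_add span_scale span_base; simp)
  ultimately show ?thesis by auto
qed

lemma wedge_kappa_kappa:
  "alt_form 4 (wedge 2 2 \<kappa> \<kappa>)"
  using alt_form_wedge[OF alt_kappa alt_kappa] by simp

lemma alt_volume: "alt_form 6 (su3_volume \<kappa>)"
  using alt_form_cmul[OF alt_form_wedge[OF alt_kappa wedge_kappa_kappa], of "1/6"]
  by (simp add: su3_volume_def[abs_def])

lemma volume_frame: "su3_volume \<kappa> ((!) [E 1, E 2, E 3, E 4, E 5, E 6]) = 1"
  unfolding su3_volume_def wedge_2_4[OF alt_kappa wedge_kappa_kappa] wedge_2_2[OF alt_kappa alt_kappa]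
  by (simp add: kappa del: One_nat_def)

lemma volume_nonzero:
  assumes "span (v ` {..<6}) = UNIV"
  shows "su3_volume \<kappa> v \<noteq> 0"
  using top_form_eq_0[OF alt_volume assms, of "(!) [E 1, E 2, E 3, E 4, E 5, E 6]"] volume_frame by auto

lemma alt_contract_Omega: "alt_form 2 (contract u \<Omega>)"
  using alt_form_contract[of 2 \<Omega> u] alt_Omega by (simp add: eval_nat_numeral)

text \<open>The metric is determined by \<open>\<kappa>\<close> and \<open>\<Omega>\<close> alone, and polynomially up to the volume form. Both sides are of
  top degree, so they agree if they agree on the frame.\<close>

lemma metric_form:
  "wedge 2 4 (contract u \<Omega>) (wedge 2 2 (contract w \<Omega>) \<kappa>) v = 2 * g u w * su3_volume \<kappa> v"
proof -
  let ?W = "wedge 2 4 (contract u \<Omega>) (wedge 2 2 (contract w \<Omega>) \<kappa>)"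
  have a4: "alt_form 4 (wedge 2 2 (contract w \<Omega>) \<kappa>)"
    using alt_form_wedge[OF alt_contract_Omega alt_kappa] by simp
  have "alt_form 6 ?W"
    using alt_form_wedge[OF alt_contract_Omega a4] by simp
  then have "alt_form 6 (\<lambda>v. ?W v - 2 * g u w * su3_volume \<kappa> v)"
    by (intro alt_form_diff alt_form_cmul alt_volume)
  moreover have "?W ((!) [E 1, E 2, E 3, E 4, E 5, E 6]) - 2 * g u w * su3_volume \<kappa> ((!) [E 1, E 2, E 3, E 4, E 5, E 6]) = 0"
    unfolding volume_frame wedge_2_4[OF alt_contract_Omega a4] wedge_2_2[OF alt_contract_Omega alt_kappa]
    by (simp add: contract_nth kappa Omega_explicit g_explicit del: One_nat_def)
  ultimately have "?W v - 2 * g u w * su3_volume \<kappa> v = 0"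
    by (rule top_form_eq_0[OF _ span_frame])
  then show ?thesis by simp
qed

lemma g_eq:
  assumes "adapted \<kappa> \<Omega> e'"
  shows "(\<Sum>i=1..6. e' i u * e' i w) = g u w"
proof -
  interpret o: SU3_frame \<kappa> \<Omega> e' "dual_frame e'"
    by unfold_locales (rule adapted_frame_dual[OF assms])
  have "2 * o.g u w = 2 * g u w"
    using o.metric_form[of u w "(!) [E 1, E 2, E 3, E 4, E 5, E 6]"]
      metric_form[of u w "(!) [E 1, E 2, E 3, E 4, E 5, E 6]"] unfolding volume_frame by simp
  then show ?thesis by (simp add: o.g_def)
qed

lemma adapted_su3_coframe: "adapted \<kappa> \<Omega> (su3_coframe \<kappa> \<Omega>)"
  using adapted_frame unfolding su3_coframe_def adapted_frame_def by (metis someI_ex)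

lemma su3_metric_eq: "su3_metric \<kappa> \<Omega> u w = g u w"
  unfolding su3_metric_def by (rule g_eq[OF adapted_su3_coframe])

lemma g_diff_left: "g (u - v) w = g u w - g v w"
  by (simp add: g_explicit e_diff algebra_simps del: One_nat_def)

text \<open>The complex structure is determined by the metric and \<open>\<kappa> = g(J\<cdot>, \<cdot>)\<close>.\<close>

lemma su3_J_eq: "su3_J \<kappa> \<Omega> u = J u"
proof -
  interpret o: SU3_frame \<kappa> \<Omega> "su3_coframe \<kappa> \<Omega>" "dual_frame (su3_coframe \<kappa> \<Omega>)"
    by unfold_locales (rule adapted_frame_dual[OF adapted_su3_coframe])
  have J: "su3_J \<kappa> \<Omega> u = o.J u"
    by (simp add: su3_J_def o.J_def su3_frame_def Let_def)
  have "g (o.J u - J u) w = 0" for w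
  proof -
    have "g (o.J u) w = o.g (o.J u) w" using g_eq[OF adapted_su3_coframe] by (simp add: o.g_def)
    then show ?thesis by (simp add: g_diff_left o.g_J g_J)
  qed
  then show ?thesis using g_nondegenerate[of "o.J u - J u"] J by simp
qed

text \<open>\<open>\<Omega>\<close> is the real part of \<open>(e\<^sup>1 + i e\<^sup>2) \<and> (e\<^sup>3 + i e\<^sup>4) \<and> (e\<^sup>5 + i e\<^sup>6)\<close>, which is complex linear in every
  argument. Hence \<open>J\<close> may be moved between arguments, and moving it in twice changes the sign.\<close>

lemma Omega_J_left: "\<Omega> ((!) [J u, v, w]) = \<Omega> ((!) [u, J v, w])"
  by (simp add: Omega_explicit del: One_nat_def) algebra

lemma Omega_J_right: "\<Omega> ((!) [u, J v, w]) = \<Omega> ((!) [u, v, J w])"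
  by (simp add: Omega_explicit del: One_nat_def) algebra

lemma Omega_JJ: "\<Omega> ((!) [u, J v, J w]) = - \<Omega> ((!) [u, v, w])"
  by (simp add: Omega_explicit del: One_nat_def) algebra

lemma Omega_swap: "\<Omega> ((!) [v, u, w]) = - \<Omega> ((!) [u, v, w])" "\<Omega> ((!) [u, w, v]) = - \<Omega> ((!) [u, v, w])"
  by (simp add: Omega_explicit del: One_nat_def, algebra)+

lemma Omega_pair: "\<Omega> ((!) [u, J u, w]) = 0"
  using Omega_J_left[of u u w] Omega_swap(1)[of "J u" u w] by simp

lemma g_JJ: "g (J u) (J w) = g u w" and g_J_skew: "g u (J w) = - g (J u) w" and g_sym: "g u w = g w u"
  by (simp_all add: g_explicit mult.commute del: One_nat_def)

lemma linear_g: "linear (g u)"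
  by (rule linearI) (simp_all add: g_explicit e_add e_scaleR algebra_simps del: One_nat_def)

lemma g_pos: "u \<noteq> 0 \<Longrightarrow> g u u > 0"
proof -
  assume "u \<noteq> 0"
  have nn: "g u u \<ge> 0" unfolding g_def by (rule sum_nonneg) simp
  have "g u u \<noteq> 0"
  proof
    assume "g u u = 0"
    then have "\<forall>i\<in>{1..6}. e i u * e i u = 0" unfolding g_def by (subst (asm) sum_nonneg_eq_0_iff) auto
    then show False using coframe_dual(2)[OF coframe, of u] \<open>u \<noteq> 0\<close> by simp
  qed
  then show ?thesis using nn by simp
qed

text \<open>A Hermitian-orthonormal pair \<open>x, z\<close> extends to an adapted frame by the vector metrically dual to
  \<open>\<Omega>(x, z, _)\<close>: it is orthogonal to \<open>x\<close>, \<open>z\<close> and their images under \<open>J\<close> by the symmetries of \<open>\<Omega>\<close>, and it is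
  a unit vector by the Lagrange identity for the complex cross product. Frames are indexed from 1, and the
  entry at index 0 is a filler.\<close>

definition pair_frame :: "real^6 \<Rightarrow> real^6 \<Rightarrow> nat \<Rightarrow> real^6" where
  "pair_frame x z i = (let y = (\<Sum>k=1..6. \<Omega> ((!) [x, z, E k]) *\<^sub>R E k) in
     [0, x, J x, z, J z, y, J y] ! i)"

lemma g_cross: "g (\<Sum>k=1..6. \<Omega> ((!) [x, z, E k]) *\<^sub>R E k) w = \<Omega> ((!) [x, z, w])"
  unfolding sum_1_6 by (simp add: g_explicit Omega_explicit e_add e_scaleR del: One_nat_def) algebra

lemma g_cross_norm:
  fixes x z
  defines "y \<equiv> (\<Sum>k=1..6. \<Omega> ((!) [x, z, E k]) *\<^sub>R E k)"
  shows "g y y = g x x * g z z - (g x z)\<^sup>2 - (g (J x) z)\<^sup>2"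
proof -
  have "g y y = \<Omega> ((!) [x, z, y])" unfolding y_def g_cross ..
  also have "\<dots> = g x x * g z z - (g x z)\<^sup>2 - (g (J x) z)\<^sup>2"
    unfolding y_def sum_1_6
    by (simp add: g_explicit Omega_explicit e_add e_scaleR del: One_nat_def) algebra
  finally show ?thesis .
qed

text \<open>Arguments from a basis can be sorted at the cost of a sign, so increasing index tuples suffice.\<close>

lemma alt_form_3_eq_0:
  fixes \<omega> :: "(real^6) form"
  assumes a: "alt_form 3 \<omega>" and sp: "span (F ` {1..6::nat}) = UNIV"
    and z: "\<And>i j k. 1 \<le> i \<Longrightarrow> i < j \<Longrightarrow> j < k \<Longrightarrow> k \<le> 6 \<Longrightarrow> \<omega> ((!) [F i, F j, F k]) = 0"
  shows "\<omega> v = 0"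
proof (rule alt_form_eq_0_on_basis[OF a sp])
  fix v :: "nat \<Rightarrow> real^6" assume "\<And>i. i < 3 \<Longrightarrow> v i \<in> F ` {1..6}"
  from this[of 0] this[of 1] this[of 2] obtain i j k where ijk: "v 0 = F i" "v 1 = F j" "v 2 = F k"
    "i \<in> {1..6}" "j \<in> {1..6}" "k \<in> {1..6}" by auto
  define T where "T i j k = \<omega> ((!) [F i, F j, F k])" for i j k
  have s1: "T j i k = - T i j k" for i j k
  proof -
    have "(!) [F j, F i, F k] = (!) [F i, F j, F k] \<circ> Transposition.transpose 0 1"
      by (auto simp: fun_eq_iff Transposition.transpose_def nth_Cons split: nat.split)
    then show ?thesis using alt_form_swap[OF a, of 0 1 "(!) [F i, F j, F k]"] by (simp add: T_def)
  qed
  have s2: "T i k j = - T i j k" for i j k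
  proof -
    have "(!) [F i, F k, F j] = (!) [F i, F j, F k] \<circ> Transposition.transpose 1 2"
      by (auto simp: fun_eq_iff Transposition.transpose_def nth_Cons numeral_2_eq_2 split: nat.split)
    then show ?thesis using alt_form_swap[OF a, of 1 2 "(!) [F i, F j, F k]"] by (simp add: T_def)
  qed
  have d: "T i j k = 0" if "i = j \<or> j = k \<or> i = k" for i j k
    using that s1[of i i k] s2[of i j j] s1[of i j i] s2[of j i i] by auto
  have z': "T i j k = 0" if "i \<in> {1..6}" "j \<in> {1..6}" "k \<in> {1..6}" "i < j" "j < k" for i j k
    using z[of i j k] that by (simp add: T_def)
  have "T i j k = 0"
  proof (cases "i = j \<or> j = k \<or> i = k")
    case False
    then consider "i < j" "j < k" | "i < k" "k < j" | "j < i" "i < k" | "j < k" "k < i" | "k < i" "i < j" | "k < j" "j < i"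
      by linarith
    moreover note s1[of j i k] s2[of i k j] s2[of j k i] s1[of k i j] s2[of k j i]
    ultimately show ?thesis
      using z'[of i j k] z'[of i k j] z'[of j i k] z'[of j k i] z'[of k i j] z'[of k j i] ijk(4-6)
      by cases simp_all
  qed (rule d)
  then show "\<omega> v = 0" using alt_form_args(4)[OF a, of v] ijk by (simp add: T_def)
qed

lemma alt_form_2_eq_0:
  fixes \<omega> :: "(real^6) form"
  assumes a: "alt_form 2 \<omega>" and sp: "span (F ` {1..6::nat}) = UNIV"
    and z: "\<And>i j. 1 \<le> i \<Longrightarrow> i < j \<Longrightarrow> j \<le> 6 \<Longrightarrow> \<omega> ((!) [F i, F j]) = 0"
  shows "\<omega> v = 0"
proof (rule alt_form_eq_0_on_basis[OF a sp])
  fix v :: "nat \<Rightarrow> real^6" assume "\<And>i. i < 2 \<Longrightarrow> v i \<in> F ` {1..6}"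
  from this[of 0] this[of 1] obtain i j where ij: "v 0 = F i" "v 1 = F j"
    "i \<in> {1..6}" "j \<in> {1..6}" by auto
  define T where "T i j = \<omega> ((!) [F i, F j])" for i j
  have s1: "T j i = - T i j" for i j
  proof -
    have "(!) [F j, F i] = (!) [F i, F j] \<circ> Transposition.transpose 0 1"
      by (auto simp: fun_eq_iff Transposition.transpose_def nth_Cons split: nat.split)
    then show ?thesis using alt_form_swap[OF a, of 0 1 "(!) [F i, F j]"] by (simp add: T_def)
  qed
  have z': "T i j = 0" if "i \<in> {1..6}" "j \<in> {1..6}" "i < j" for i j
    using z[of i j] that by (simp add: T_def)
  have "T i j = 0"
    using s1[of i i] s1[of i j] z'[of i j] z'[of j i] ij by (cases i j rule: linorder_cases) auto
  then show "\<omega> v = 0" using alt_form_args(3)[OF a, of v] ij by (simp add: T_def)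
qed

end

context SU3_frame
begin

lemma Omega_pair': "\<Omega> ((!) [u, w, J w]) = 0"
  using Omega_J_right[of u w w] Omega_swap(2)[of u "J w" w] by simp

lemma Omega_JJ': "\<Omega> ((!) [J u, J v, w]) = - \<Omega> ((!) [u, v, w])"
  by (simp add: Omega_explicit del: One_nat_def) algebra

lemma g_JJ_left: "g (J (J u)) w = - g u w"
  by (simp add: g_explicit del: One_nat_def)

text \<open>\<open>\<kappa>\<close> has the required components since the frame is orthonormal and compatible with \<open>J\<close>. For \<open>\<Omega>\<close>, the choice
  of the last vector \<open>y\<close> gives \<open>\<Omega>(x, z, y) = |y|\<^sup>2 = 1\<close> and \<open>\<Omega>(x, z, Jy) = g(y, Jy) = 0\<close>; complex linearity
  yields the other components.\<close>

lemma pair_frame_adapted: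
  assumes xx: "g x x = 1" and zz: "g z z = 1" and xz: "g x z = 0" and Jxz: "g (J x) z = 0"
  shows "adapted_frame \<kappa> \<Omega> (\<lambda>i. g (pair_frame x z i)) (pair_frame x z)"
proof -
  define F where "F = pair_frame x z"
  define y where "y = (\<Sum>k=1..6. \<Omega> ((!) [x, z, E k]) *\<^sub>R E k)"
  have F: "F 1 = x" "F 2 = J x" "F 3 = z" "F 4 = J z" "F 5 = y" "F 6 = J y"
    by (simp_all add: F_def pair_frame_def y_def Let_def)
  have gy: "g y w = \<Omega> ((!) [x, z, w])" for w unfolding y_def by (rule g_cross)
  have yy: "g y y = 1"
    using g_cross_norm[of x z] xx zz xz Jxz by (simp add: y_def)
  have self: "g u (J u) = 0" "g (J u) u = 0" for u
    using g_J_skew[of u u] g_sym[of u "J u"] by simp_all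
  have y0: "g y x = 0" "g y z = 0" "g y (J x) = 0" "g y (J z) = 0"
    using Omega_pair'[of x z] Omega_swap(2)[of x x z] Omega_swap(1)[of x x z] Omega_swap(2)[of x z z]
      Omega_pair[of x z] Omega_swap(2)[of x "J x" z]
    unfolding gy by simp_all
  have o: "g x (J x) = 0" "g x z = 0" "g x (J z) = 0" "g x y = 0" "g x (J y) = 0" "g (J x) z = 0"
    "g (J x) (J z) = 0" "g (J x) y = 0" "g (J x) (J y) = 0" "g z (J z) = 0" "g z y = 0" "g z (J y) = 0"
    "g (J z) y = 0" "g (J z) (J y) = 0" "g y (J y) = 0"
    using self y0 xz Jxz g_J_skew[of x z] g_J_skew[of x y] g_J_skew[of z y]
      g_sym[of y x] g_sym[of y z] g_sym[of y "J x"] g_sym[of y "J z"]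
    by (simp_all add: g_JJ)
  note o' = o[THEN trans[OF g_sym]]
  have G: "\<forall>i\<in>{1..6}. \<forall>j\<in>{1..6}. g (F i) (F j) = (if i = j then 1 else 0)"
    unfolding ball_1_6 F by (simp add: o o' xx zz yy g_JJ)
  have linF: "linear (g (F i))" for i by (rule linear_g)
  have co: "coframe (\<lambda>i. g (F i))"
    unfolding coframe_def
  proof (intro conjI ballI allI impI)
    fix a j assume a: "\<forall>u. (\<Sum>i=1..6. a i * g (F i) u) = 0" and j: "j \<in> {1..6::nat}"
    have "(\<Sum>i=1..6. a i * g (F i) (F j)) = (\<Sum>i=1..6. if i = j then a i else 0)"
      by (rule sum.cong) (use G j in auto)
    then show "a j = 0" using a j by simp
  qed (rule linear_g)
  have sp: "span (F ` {1..6}) = UNIV"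
    by (rule coframe_span[OF co]) (use G in auto)
  have K: "\<kappa> ((!) [u, w]) = g (J u) w" for u w by (simp add: g_J)
  let ?e = "\<lambda>i. g (F i)"
  have kap: "\<kappa> v = cowedge ?e [1,2] v + cowedge ?e [3,4] v + cowedge ?e [5,6] v" for v
  proof -
    have A: "alt_form 2 (\<lambda>v. \<kappa> v - (cowedge ?e [1,2] v + cowedge ?e [3,4] v + cowedge ?e [5,6] v))"
      by (intro alt_form_diff alt_form_add alt_kappa alt_form_cowedge_2 linF)
    have B: "\<forall>i\<in>{1..6}. \<forall>j\<in>{1..6}. i < j \<longrightarrow> \<kappa> ((!) [F i, F j]) -
        (cowedge ?e [1,2] ((!) [F i, F j]) + cowedge ?e [3,4] ((!) [F i, F j]) + cowedge ?e [5,6] ((!) [F i, F j])) = 0"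
      unfolding cowedge_2[of ?e, OF linF linF] ball_1_6 K F
      by (simp add: F o o' xx zz yy g_JJ g_JJ_left del: One_nat_def)
    have "\<kappa> v - (cowedge ?e [1,2] v + cowedge ?e [3,4] v + cowedge ?e [5,6] v) = 0"
      by (rule alt_form_2_eq_0[OF A sp], rule B[rule_format]) simp_all
    then show ?thesis by simp
  qed
  have T: "\<Omega> ((!) [x, z, y]) = 1" "\<Omega> ((!) [x, z, J y]) = 0" using gy yy o by simp_all
  have T': "\<Omega> ((!) [x, J z, y]) = 0" "\<Omega> ((!) [x, J z, J y]) = -1" "\<Omega> ((!) [J x, z, y]) = 0"
     "\<Omega> ((!) [J x, z, J y]) = -1" "\<Omega> ((!) [J x, J z, y]) = -1" "\<Omega> ((!) [J x, J z, J y]) = 0"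
    using T Omega_JJ[of x z y] by (simp_all only: Omega_J_right[of x z y] Omega_J_left[of x z] Omega_JJ' minus_zero)
  have om: "\<Omega> v = cowedge ?e [1,3,5] v - cowedge ?e [1,4,6] v - cowedge ?e [2,4,5] v - cowedge ?e [2,3,6] v" for v
  proof -
    let ?d = "\<lambda>v. \<Omega> v - (cowedge ?e [1,3,5] v - cowedge ?e [1,4,6] v - cowedge ?e [2,4,5] v - cowedge ?e [2,3,6] v)"
    have A: "alt_form 3 ?d"
      by (intro alt_form_diff alt_Omega alt_form_cowedge_3 linF)
    have B: "\<forall>i\<in>{1..6}. \<forall>j\<in>{1..6}. \<forall>k\<in>{1..6}. i < j \<longrightarrow> j < k \<longrightarrow> ?d ((!) [F i, F j, F k]) = 0"
      unfolding cowedge_3[of ?e, OF linF linF linF] ball_1_6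
      by (simp add: F o o' xx zz yy g_JJ T T' Omega_pair Omega_pair' del: One_nat_def)
    have "?d v = 0"
      by (rule alt_form_3_eq_0[OF A sp], rule B[rule_format]) simp_all
    then show ?thesis by simp
  qed
  show ?thesis
    unfolding adapted_frame_def adapted_def F_def[symmetric]
  proof (intro conjI co)
    show "\<kappa> = (\<lambda>v. cowedge ?e [1,2] v + cowedge ?e [3,4] v + cowedge ?e [5,6] v)" using kap by (rule ext)
    show "\<Omega> = (\<lambda>v. cowedge ?e [1,3,5] v - cowedge ?e [1,4,6] v - cowedge ?e [2,4,5] v - cowedge ?e [2,3,6] v)"
      using om by (rule ext)
  qed (rule G)
qed

end

section \<open>Smooth adapted frames\<close>

lemma Ck_on_wedge:
  assumes "open S" "\<And>v. Ck_on k S (\<lambda>y. \<alpha> y v)" "\<And>v. Ck_on k S (\<lambda>y. \<beta> y v)"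
  shows "Ck_on k S (\<lambda>y. wedge r s (\<alpha> y) (\<beta> y) v)"
  unfolding wedge_def divide_inverse
  by (intro Ck_on_mult[OF assms(1)] Ck_on_sum[OF assms(1)] Ck_on_const assms(2,3))

lemma vec_expand: "(u::real^'n) = (\<Sum>i\<in>UNIV. u $ i *\<^sub>R axis i 1)"
  using basis_expansion[of u] by (simp add: scalar_mult_eq_scaleR)

lemma linear_vec_expand:
  fixes f :: "real^'n \<Rightarrow> real"
  assumes "linear f" shows "f u = (\<Sum>i\<in>UNIV. u $ i * f (axis i 1))"
proof -
  have "f u = f (\<Sum>i\<in>UNIV. u $ i *\<^sub>R axis i 1)" by (rule arg_cong[OF vec_expand])
  then show ?thesis by (simp add: linear_sum[OF assms] linear_cmul[OF assms])
qed

text \<open>Multilinearity expresses the value on varying arguments through values on constant basis vectors. The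
  arguments are expanded one at a time.\<close>

lemma Ck_on_apply_alt_form:
  fixes \<omega> :: "'a::real_normed_vector \<Rightarrow> (real^'n) form"
  assumes S: "open S" and a: "\<And>y. y \<in> S \<Longrightarrow> alt_form r (\<omega> y)"
    and C: "\<And>v. Ck_on k S (\<lambda>y. \<omega> y v)" and X: "\<And>i l. i < r \<Longrightarrow> Ck_on k S (\<lambda>y. X i y $ l)"
  shows "Ck_on k S (\<lambda>y. \<omega> y (\<lambda>i. X i y))"
proof -
  have "Ck_on k S (\<lambda>y. \<omega> y (\<lambda>i. if i < j then X i y else v i))" if "j \<le> r" for j v
    using that
  proof (induction j arbitrary: v)
    case 0
    then show ?case by (simp add: C)
  next
    case (Suc j)
    then have j: "j < r" by simp
    let ?w = "\<lambda>y l i. if i < j then X i y else (v(j := axis l 1)) i"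
    have eq: "(\<Sum>l\<in>UNIV. X j y $ l * \<omega> y (?w y l)) = \<omega> y (\<lambda>i. if i < Suc j then X i y else v i)" if y: "y \<in> S" for y
    proof -
      let ?b = "\<lambda>i. if i < j then X i y else v i"
      note lin = alt_form_linear[OF a[OF y] j, of ?b]
      have "(\<lambda>i. if i < Suc j then X i y else v i) = ?b(j := \<Sum>l\<in>UNIV. X j y $ l *\<^sub>R axis l 1)"
        using vec_expand[of "X j y"] by (auto simp: fun_eq_iff)
      then have "\<omega> y (\<lambda>i. if i < Suc j then X i y else v i) = (\<Sum>l\<in>UNIV. X j y $ l * \<omega> y (?b(j := axis l 1)))"
        by (simp only: linear_sum[OF lin] linear_cmul[OF lin] real_scaleR_def)
      moreover have "?b(j := axis l 1) = ?w y l" for l by (auto simp: fun_eq_iff)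
      ultimately show ?thesis by (simp only:)
    qed
    show ?case
    proof (rule Ck_on_cong[OF S])
      show "Ck_on k S (\<lambda>y. \<Sum>l\<in>UNIV. X j y $ l * \<omega> y (?w y l))"
        by (intro Ck_on_sum[OF S] Ck_on_mult[OF S] X j Suc.IH) (use j in simp)
    qed (rule eq)
  qed
  from this[of r] have "Ck_on k S (\<lambda>y. \<omega> y (\<lambda>i. if i < r then X i y else v i))" for v by simp
  then show ?thesis
    by (rule Ck_on_cong[OF S, rotated]) (rule alt_form_cong[OF a]; simp)
qed

locale su3_region =
  fixes S :: "(real^6) set" and \<kappa> \<Omega> :: "real^6 \<Rightarrow> (real^6) form"
  assumes open_S: "open S"
    and ex_adapted: "\<And>y. y \<in> S \<Longrightarrow> \<exists>e. adapted (\<kappa> y) (\<Omega> y) e"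
    and Ck_kappa: "\<And>k v. Ck_on k S (\<lambda>y. \<kappa> y v)"
    and Ck_Omega: "\<And>k v. Ck_on k S (\<lambda>y. \<Omega> y v)"
begin

abbreviation "met y \<equiv> su3_metric (\<kappa> y) (\<Omega> y)"
abbreviation "Jfield y \<equiv> su3_J (\<kappa> y) (\<Omega> y)"

lemma frame_at: "y \<in> S \<Longrightarrow> SU3_frame (\<kappa> y) (\<Omega> y) (su3_coframe (\<kappa> y) (\<Omega> y)) (su3_frame (\<kappa> y) (\<Omega> y))"
  unfolding SU3_frame_def su3_frame_def su3_coframe_def
  by (rule adapted_frame_dual) (rule someI_ex[OF ex_adapted])

lemma metric_at: "y \<in> S \<Longrightarrow> met y = SU3_frame.g (su3_coframe (\<kappa> y) (\<Omega> y))"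
  using SU3_frame.su3_metric_eq[OF frame_at] by (simp add: fun_eq_iff)

lemma J_at: "y \<in> S \<Longrightarrow> Jfield y = SU3_frame.J (su3_coframe (\<kappa> y) (\<Omega> y)) (su3_frame (\<kappa> y) (\<Omega> y))"
  using SU3_frame.su3_J_eq[OF frame_at] by (simp add: fun_eq_iff)

lemma linear_metric: "y \<in> S \<Longrightarrow> linear (met y u)"
  unfolding metric_at by (rule SU3_frame.linear_g[OF frame_at])

lemma metric_sym: "y \<in> S \<Longrightarrow> met y u w = met y w u"
  unfolding metric_at by (rule SU3_frame.g_sym[OF frame_at])

lemma metric_pos: "y \<in> S \<Longrightarrow> u \<noteq> 0 \<Longrightarrow> met y u u > 0"
  unfolding metric_at by (rule SU3_frame.g_pos[OF frame_at])

lemma linear_metric_left: "y \<in> S \<Longrightarrow> linear (\<lambda>u. met y u w)"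
  using linear_metric[of y w] metric_sym[of y _ w] by (simp add: fun_eq_iff)

text \<open>By \<open>metric_form\<close>, evaluated on a fixed basis, the metric is a quotient with the volume in the denominator.
  The basis is a frame at some point; the volume form does not vanish on it anywhere.\<close>

lemma Ck_metric_const: "Ck_on k S (\<lambda>y. met y u w)"
proof (cases "S = {}")
  case True
  then show ?thesis by (intro Ck_on_cong[OF open_S _ Ck_on_const[of k S 0]]) simp
next
  case False
  then obtain x0 where x0: "x0 \<in> S" by auto
  let ?F = "su3_frame (\<kappa> x0) (\<Omega> x0)"
  let ?v = "(!) [?F 1, ?F 2, ?F 3, ?F 4, ?F 5, ?F 6]"
  have nz: "su3_volume (\<kappa> y) ?v \<noteq> 0" if "y \<in> S" for y
    by (rule SU3_frame.volume_nonzero[OF frame_at[OF that] SU3_frame.span_frame[OF frame_at[OF x0]]])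
  have eq: "wedge 2 4 (contract u (\<Omega> y)) (wedge 2 2 (contract w (\<Omega> y)) (\<kappa> y)) ?v / (2 * su3_volume (\<kappa> y) ?v) = met y u w"
    if "y \<in> S" for y
    using nz[OF that] SU3_frame.metric_form[OF frame_at[OF that], of u w ?v] by (simp add: metric_at[OF that])
  have c: "Ck_on k S (\<lambda>y. contract u (\<Omega> y) v)" for u v unfolding contract_def by (rule Ck_Omega)
  show ?thesis
  proof (rule Ck_on_cong[OF open_S eq])
    show "Ck_on k S (\<lambda>y. wedge 2 4 (contract u (\<Omega> y)) (wedge 2 2 (contract w (\<Omega> y)) (\<kappa> y)) ?v / (2 * su3_volume (\<kappa> y) ?v))"
    proof (rule Ck_on_divide[OF open_S])
      show "2 * su3_volume (\<kappa> y) ?v \<noteq> 0" if "y \<in> S" for y using nz[OF that] by simp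
      show "Ck_on k S (\<lambda>y. wedge 2 4 (contract u (\<Omega> y)) (wedge 2 2 (contract w (\<Omega> y)) (\<kappa> y)) ?v)"
        by (intro Ck_on_wedge[OF open_S] c Ck_kappa)
      show "Ck_on k S (\<lambda>y. 2 * su3_volume (\<kappa> y) ?v)"
        unfolding su3_volume_def divide_inverse
        by (intro Ck_on_mult[OF open_S] Ck_on_const Ck_on_wedge[OF open_S] Ck_kappa)
    qed
  qed
qed

lemma Ck_metric:
  assumes T: "open T" "T \<subseteq> S" and X: "\<And>l. Ck_on k T (\<lambda>y. X y $ l)" and Z: "\<And>l. Ck_on k T (\<lambda>y. Z y $ l)"
  shows "Ck_on k T (\<lambda>y. met y (X y) (Z y))"
proof (rule Ck_on_cong[OF T(1)])
  show "(\<Sum>i\<in>UNIV. \<Sum>j\<in>UNIV. X y $ i * (Z y $ j * met y (axis i 1) (axis j 1))) = met y (X y) (Z y)" if "y \<in> T" for y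
  proof -
    have y: "y \<in> S" using that T by blast
    have "met y (X y) (Z y) = (\<Sum>i\<in>UNIV. X y $ i * met y (axis i 1) (Z y))"
      by (rule linear_vec_expand[OF linear_metric_left[OF y]])
    moreover have "met y u (Z y) = (\<Sum>j\<in>UNIV. Z y $ j * met y u (axis j 1))" for u
      by (rule linear_vec_expand[OF linear_metric[OF y]])
    ultimately show ?thesis by (simp only: sum_distrib_left)
  qed
  show "Ck_on k T (\<lambda>y. \<Sum>i\<in>UNIV. \<Sum>j\<in>UNIV. X y $ i * (Z y $ j * met y (axis i 1) (axis j 1)))"
    by (intro Ck_on_sum[OF T(1)] Ck_on_mult[OF T(1)] X Z Ck_on_subset[OF Ck_metric_const T(2)])
qed

text \<open>The vector that is metrically dual to a one-form solves a linear system with the Gram matrix of the metric.\<close>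

lemma Ck_sharp:
  assumes T: "open T" "T \<subseteq> S" and b: "\<And>w. Ck_on k T (\<lambda>y. b y w)"
    and z: "\<And>y w. y \<in> T \<Longrightarrow> met y (z y) w = b y w"
  shows "Ck_on k T (\<lambda>y. z y $ l)"
proof (rule Ck_on_linear_system[OF T(1)])
  let ?M = "\<lambda>y. \<chi> i j. met y (axis i 1) (axis j 1)"
  have Mv: "(?M y *v u) $ i = met y u (axis i 1)" if "y \<in> T" for y u i
  proof -
    have y: "y \<in> S" using that T by blast
    have "met y (axis i 1) u = (\<Sum>j\<in>UNIV. u $ j * met y (axis i 1) (axis j 1))"
      by (rule linear_vec_expand[OF linear_metric[OF y]])
    then show ?thesis by (simp add: matrix_vector_mult_def metric_sym[OF y, of u] mult.commute)
  qed
  show "Ck_on k T (\<lambda>y. ?M y $ i $ j)" for i j by (simp add: Ck_on_subset[OF Ck_metric_const T(2)])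
  show "Ck_on k T (\<lambda>y. (\<chi> i. b y (axis i 1)) $ i)" for i by (simp add: b)
  show "?M y *v z y = (\<chi> i. b y (axis i 1))" if "y \<in> T" for y
    using Mv[OF that, of "z y"] z[OF that] by (simp add: vec_eq_iff)
  show "det (?M y) \<noteq> 0" if "y \<in> T" for y
  proof -
    have y: "y \<in> S" using that T by blast
    have "u = 0" if u: "?M y *v u = 0" for u
    proof (rule ccontr)
      assume "u \<noteq> 0"
      have "met y u u = (\<Sum>i\<in>UNIV. u $ i * met y u (axis i 1))"
        by (rule linear_vec_expand[OF linear_metric[OF y]])
      also have "\<dots> = 0" using u Mv[OF \<open>y \<in> T\<close>, of u] by simp
      finally show False using metric_pos[OF y \<open>u \<noteq> 0\<close>] by simp
    qed
    then have "invertible (?M y)"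
      using matrix_left_invertible_ker[of "?M y"] invertible_left_inverse[of "?M y"] by blast
    then show ?thesis using invertible_det_nz by blast
  qed
qed

lemma Ck_kappa_apply:
  assumes T: "open T" "T \<subseteq> S" and X: "\<And>l. Ck_on k T (\<lambda>y. X y $ l)" and Z: "\<And>l. Ck_on k T (\<lambda>y. Z y $ l)"
  shows "Ck_on k T (\<lambda>y. \<kappa> y ((!) [X y, Z y]))"
proof (rule Ck_on_apply_alt_form[OF T(1), of 2 \<kappa> k "\<lambda>i y. [X y, Z y] ! i"])
  show "alt_form 2 (\<kappa> y)" if "y \<in> T" for y
    using SU3_frame.alt_kappa[OF frame_at] that T by blast
  show "Ck_on k T (\<lambda>y. \<kappa> y v)" for v by (rule Ck_on_subset[OF Ck_kappa T(2)])
  show "Ck_on k T (\<lambda>y. [X y, Z y] ! i $ l)" if "i < 2" for i l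
    using that X Z by (auto simp: numeral_2_eq_2 less_Suc_eq)
qed

lemma Ck_Omega_apply:
  assumes T: "open T" "T \<subseteq> S" and X: "\<And>l. Ck_on k T (\<lambda>y. X y $ l)" and Z: "\<And>l. Ck_on k T (\<lambda>y. Z y $ l)"
    and W: "\<And>l. Ck_on k T (\<lambda>y. W y $ l)"
  shows "Ck_on k T (\<lambda>y. \<Omega> y ((!) [X y, Z y, W y]))"
proof (rule Ck_on_apply_alt_form[OF T(1), of 3 \<Omega> k "\<lambda>i y. [X y, Z y, W y] ! i"])
  show "alt_form 3 (\<Omega> y)" if "y \<in> T" for y
    using SU3_frame.alt_Omega[OF frame_at] that T by blast
  show "Ck_on k T (\<lambda>y. \<Omega> y v)" for v by (rule Ck_on_subset[OF Ck_Omega T(2)])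
  show "Ck_on k T (\<lambda>y. [X y, Z y, W y] ! i $ l)" if "i < 3" for i l
    using that X Z W by (auto simp: numeral_3_eq_3 less_Suc_eq)
qed

lemma Ck_J:
  assumes T: "open T" "T \<subseteq> S" and X: "\<And>l. Ck_on k T (\<lambda>y. X y $ l)"
  shows "Ck_on k T (\<lambda>y. Jfield y (X y) $ l)"
proof (rule Ck_sharp[OF T])
  show "met y (Jfield y (X y)) w = \<kappa> y ((!) [X y, w])" if "y \<in> T" for y w
  proof -
    have y: "y \<in> S" using that T by blast
    show ?thesis unfolding metric_at[OF y] J_at[OF y] by (rule SU3_frame.g_J[OF frame_at[OF y]])
  qed
  show "Ck_on k T (\<lambda>y. \<kappa> y ((!) [X y, w]))" for w
    by (intro Ck_kappa_apply[OF T] X Ck_on_const)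
qed

text \<open>Hermitian Gram-Schmidt, applied to the first and third vector of an adapted frame at \<open>x0\<close>, gives an
  adapted frame that depends smoothly on the point and equals the given one at \<open>x0\<close>.\<close>

lemma smooth_frame:
  assumes x0: "x0 \<in> S"
  obtains U E where "open U" "x0 \<in> U" "U \<subseteq> S"
    "\<And>y. y \<in> U \<Longrightarrow> adapted_frame (\<kappa> y) (\<Omega> y) (\<lambda>i. met y (E y i)) (E y)"
    "\<And>k i l. i \<in> {1..6} \<Longrightarrow> Ck_on k U (\<lambda>y. E y i $ l)"
    "\<And>i. i \<in> {1..6} \<Longrightarrow> E x0 i = su3_frame (\<kappa> x0) (\<Omega> x0) i"
proof -
  define F where "F y = su3_frame (\<kappa> y) (\<Omega> y)" for y
  define u1 where "u1 = F x0 1"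
  define u3 where "u3 = F x0 3"
  \<comment> \<open>\<open>W\<close> is \<open>u3\<close> without its components along \<open>X\<close> and \<open>J X\<close>. It is \<open>u3\<close> itself at \<open>x0\<close>, hence nonzero nearby.\<close>
  define X where "X y = (1 / sqrt (met y u1 u1)) *\<^sub>R u1" for y
  define V where "V y = Jfield y (X y)" for y
  define W where "W y = u3 - met y u3 (X y) *\<^sub>R X y - met y u3 (V y) *\<^sub>R V y" for y
  define Z where "Z y = (1 / sqrt (met y (W y) (W y))) *\<^sub>R W y" for y
  define Y where "Y y = (\<Sum>k=1..6. \<Omega> y ((!) [X y, Z y, F y k]) *\<^sub>R F y k)" for y
  define E where "E y i = [0, X y, V y, Z y, Jfield y (Z y), Y y, Jfield y (Y y)] ! i" for y i
  define U where "U = {y \<in> S. met y (W y) (W y) > 0}"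
  have SS: "S \<subseteq> S" by simp
  interpret p0: SU3_frame "\<kappa> x0" "\<Omega> x0" "su3_coframe (\<kappa> x0) (\<Omega> x0)" "F x0"
    unfolding F_def by (rule frame_at[OF x0])
  have u1: "met x0 u1 u1 = 1" "u1 \<noteq> 0"
  proof -
    show "met x0 u1 u1 = 1" by (simp add: metric_at[OF x0] u1_def p0.g_explicit del: One_nat_def)
    then show "u1 \<noteq> 0" using linear_0[OF linear_metric[OF x0, of u1]] by auto
  qed
  have CX: "Ck_on k S (\<lambda>y. X y $ l)" for k l
    unfolding X_def vector_scaleR_component real_scaleR_def
    by (intro Ck_on_mult[OF open_S] Ck_on_divide[OF open_S] Ck_on_const Ck_on_sqrt[OF open_S] Ck_metric_const)
      (use metric_pos[OF _ u1(2)] in force)+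
  have CV: "Ck_on k S (\<lambda>y. V y $ l)" for k l
    unfolding V_def by (rule Ck_J[OF open_S SS CX])
  have CW: "Ck_on k S (\<lambda>y. W y $ l)" for k l
    unfolding W_def vector_scaleR_component real_scaleR_def vector_minus_component
    by (intro Ck_on_diff[OF open_S] Ck_on_mult[OF open_S] Ck_on_const Ck_metric[OF open_S SS] CX CV)
  have CWW: "Ck_on k S (\<lambda>y. met y (W y) (W y))" for k
    by (intro Ck_metric[OF open_S SS] CW)
  have oU: "open U"
  proof -
    have "open (S \<inter> (\<lambda>y. met y (W y) (W y)) -` {0<..})"
      using CWW[of 0] by (intro continuous_open_preimage open_S) auto
    moreover have "S \<inter> (\<lambda>y. met y (W y) (W y)) -` {0<..} = U" by (auto simp: U_def)
    ultimately show ?thesis by simp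
  qed
  have US: "U \<subseteq> S" by (auto simp: U_def)
  have CZ: "Ck_on k U (\<lambda>y. Z y $ l)" for k l
    unfolding Z_def vector_scaleR_component real_scaleR_def
    by (intro Ck_on_mult[OF oU] Ck_on_divide[OF oU] Ck_on_const Ck_on_sqrt[OF oU] Ck_on_subset[OF CWW US]
      Ck_on_subset[OF CW US]) (auto simp: U_def)
  have CXU: "Ck_on k U (\<lambda>y. X y $ l)" and CVU: "Ck_on k U (\<lambda>y. V y $ l)" for k l
    by (rule Ck_on_subset[OF CX US], rule Ck_on_subset[OF CV US])
  have CY: "Ck_on k U (\<lambda>y. Y y $ l)" for k l
  proof (rule Ck_sharp[OF oU US])
    show "met y (Y y) w = \<Omega> y ((!) [X y, Z y, w])" if "y \<in> U" for y w
    proof -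
      have y: "y \<in> S" using that US by blast
      show ?thesis unfolding metric_at[OF y] Y_def F_def by (rule SU3_frame.g_cross[OF frame_at[OF y]])
    qed
    show "Ck_on k U (\<lambda>y. \<Omega> y ((!) [X y, Z y, w]))" for w
      by (intro Ck_Omega_apply[OF oU US] CXU CZ Ck_on_const)
  qed
  show ?thesis
  proof (rule that[OF oU _ US])
    have "V x0 = F x0 2" and X0: "X x0 = u1"
      unfolding V_def X_def u1(1) by (simp_all add: u1_def J_at[OF x0] F_def[symmetric] p0.J_def del: One_nat_def)
    then have W0: "W x0 = u3"
      by (simp add: W_def metric_at[OF x0] u1_def u3_def p0.g_explicit del: One_nat_def)
    have u3: "met x0 u3 u3 = 1" by (simp add: metric_at[OF x0] u3_def p0.g_explicit del: One_nat_def)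
    show "x0 \<in> U" by (simp add: U_def x0 W0 u3)
    have Z0: "Z x0 = u3" by (simp add: Z_def W0 u3)
    have Y0: "Y x0 = F x0 5"
      unfolding Y_def X0 Z0 sum_1_6 u1_def u3_def by (simp add: p0.Omega_explicit del: One_nat_def)
    have "\<forall>i\<in>{1..6}. E x0 i = F x0 i"
      unfolding ball_1_6 E_def X0 Z0 Y0 \<open>V x0 = F x0 2\<close>
      by (simp add: u1_def u3_def J_at[OF x0] F_def[symmetric] p0.J_def p0.dual)
    then show "E x0 i = su3_frame (\<kappa> x0) (\<Omega> x0) i" if "i \<in> {1..6}" for i using that by (simp add: F_def)
  next
    fix k i l assume i: "i \<in> {1..6::nat}"
    have "\<forall>i\<in>{1..6}. Ck_on k U (\<lambda>y. E y i $ l)"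
      unfolding ball_1_6 E_def using CXU CVU CZ CY Ck_J[OF oU US CZ] Ck_J[OF oU US CY] by simp
    then show "Ck_on k U (\<lambda>y. E y i $ l)" using i by blast
  next
    fix y assume yU: "y \<in> U"
    then have y: "y \<in> S" using US by blast
    interpret p: SU3_frame "\<kappa> y" "\<Omega> y" "su3_coframe (\<kappa> y) (\<Omega> y)" "F y"
      unfolding F_def by (rule frame_at[OF y])
    have pg: "met y = p.g" by (rule metric_at[OF y])
    have pJ: "Jfield y = p.J" unfolding F_def by (rule J_at[OF y])
    have XX: "p.g (X y) (X y) = 1"
    proof -
      have pos: "p.g u1 u1 > 0" using metric_pos[OF y u1(2)] pg by simp
      have "p.g (X y) (X y) = (1 / sqrt (p.g u1 u1)) * ((1 / sqrt (p.g u1 u1)) * p.g u1 u1)"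
        unfolding X_def pg by (simp add: linear_cmul[OF p.linear_g] p.g_sym[of "_ *\<^sub>R _"])
      then show ?thesis using pos by (simp add: field_simps)
    qed
    have VV: "p.g (V y) (V y) = 1" and XV: "p.g (V y) (X y) = 0" "p.g (X y) (V y) = 0"
      unfolding V_def pJ using XX p.g_J_skew[of "X y" "X y"] p.g_sym[of "X y" "p.J (X y)"] by (simp_all add: p.g_JJ)
    have gW: "p.g v (W y) = p.g v u3 - p.g u3 (X y) * p.g v (X y) - p.g u3 (V y) * p.g v (V y)" for v
      unfolding W_def pg by (simp add: linear_diff[OF p.linear_g] linear_cmul[OF p.linear_g])
    have WX: "p.g (X y) (W y) = 0" "p.g (V y) (W y) = 0"
      unfolding gW using XX VV XV p.g_sym[of u3] by simp_all
    have gZ: "p.g v (Z y) = (1 / sqrt (p.g (W y) (W y))) * p.g v (W y)" for v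
      unfolding Z_def pg by (simp add: linear_cmul[OF p.linear_g])
    have pos: "p.g (W y) (W y) > 0" using yU pg by (simp add: U_def)
    have ZZ: "p.g (Z y) (Z y) = 1"
    proof -
      have "p.g (Z y) (Z y) = (1 / sqrt (p.g (W y) (W y))) * ((1 / sqrt (p.g (W y) (W y))) * p.g (W y) (W y))"
        by (simp only: gZ[of "Z y"] p.g_sym[of "Z y" "W y"] gZ[of "W y"])
      then show ?thesis using pos by (simp add: field_simps)
    qed
    have "adapted_frame (\<kappa> y) (\<Omega> y) (\<lambda>i. p.g (p.pair_frame (X y) (Z y) i)) (p.pair_frame (X y) (Z y))"
      by (rule p.pair_frame_adapted[OF XX ZZ]) (simp_all add: gZ WX(1) WX(2)[unfolded V_def pJ])
    moreover have "p.pair_frame (X y) (Z y) = E y"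
      by (simp add: fun_eq_iff E_def p.pair_frame_def Let_def Y_def V_def pJ)
    ultimately show "adapted_frame (\<kappa> y) (\<Omega> y) (\<lambda>i. met y (E y i)) (E y)" by (simp add: pg)
  qed
qed

end

section \<open>The method of moving frames\<close>

abbreviation dd :: "('a::real_normed_vector \<Rightarrow> real) \<Rightarrow> 'a \<Rightarrow> 'a \<Rightarrow> real" where
  "dd f x u \<equiv> frechet_derivative f (at x) u"

lemma smooth_on_const: "smooth_on U (\<lambda>x. c)"
  unfolding smooth_on_def by (simp add: Ck_on_const)

lemma smooth_on_add:
  fixes f :: "'a::real_normed_vector \<Rightarrow> real"
  shows "open U \<Longrightarrow> smooth_on U f \<Longrightarrow> smooth_on U g \<Longrightarrow> smooth_on U (\<lambda>x. f x + g x)"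
  unfolding smooth_on_def by (simp add: Ck_on_add)

lemma smooth_on_diff:
  fixes f :: "'a::real_normed_vector \<Rightarrow> real"
  shows "open U \<Longrightarrow> smooth_on U f \<Longrightarrow> smooth_on U g \<Longrightarrow> smooth_on U (\<lambda>x. f x - g x)"
  unfolding smooth_on_def by (simp add: Ck_on_diff)

lemma smooth_on_mult:
  fixes f :: "'a::real_normed_vector \<Rightarrow> real"
  shows "open U \<Longrightarrow> smooth_on U f \<Longrightarrow> smooth_on U g \<Longrightarrow> smooth_on U (\<lambda>x. f x * g x)"
  unfolding smooth_on_def by (simp add: Ck_on_mult)

lemma smooth_on_sum:
  fixes f :: "'i \<Rightarrow> 'a::real_normed_vector \<Rightarrow> real"
  shows "open U \<Longrightarrow> (\<And>i. i \<in> I \<Longrightarrow> smooth_on U (f i)) \<Longrightarrow> smooth_on U (\<lambda>x. \<Sum>i\<in>I. f i x)"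
  unfolding smooth_on_def by (simp add: Ck_on_sum)

lemma smooth_on_cong: "open U \<Longrightarrow> (\<And>x. x \<in> U \<Longrightarrow> f x = g x) \<Longrightarrow> smooth_on U f \<Longrightarrow> smooth_on U g"
  unfolding smooth_on_def by (metis Ck_on_cong)

lemma smooth_on_dd: "smooth_on U f \<Longrightarrow> smooth_on U (\<lambda>x. dd f x u)"
  unfolding smooth_on_def by (metis Ck_on_deriv)

lemma smooth_on_differentiable: "smooth_on U f \<Longrightarrow> x \<in> U \<Longrightarrow> f differentiable (at x)"
  unfolding smooth_on_def by (metis Ck_on_differentiable)

lemma smooth_on_subset: "smooth_on U f \<Longrightarrow> V \<subseteq> U \<Longrightarrow> smooth_on V f"
  unfolding smooth_on_def by (metis Ck_on_subset)

lemma dd_commute: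
  fixes f :: "'a::real_normed_vector \<Rightarrow> real"
  shows "open U \<Longrightarrow> x \<in> U \<Longrightarrow> smooth_on U f \<Longrightarrow> dd (\<lambda>y. dd f y u) x v = dd (\<lambda>y. dd f y v) x u"
  unfolding smooth_on_def by (rule mixed_derivatives_commute) auto

lemma dd_add:
  "f differentiable (at x) \<Longrightarrow> g differentiable (at x) \<Longrightarrow> dd (\<lambda>x. f x + g x) x u = dd f x u + dd g x u"
  by (rule frechet_derivative_eqI) (intro has_derivative_add has_frechet_derivative)

lemma dd_diff:
  "f differentiable (at x) \<Longrightarrow> g differentiable (at x) \<Longrightarrow> dd (\<lambda>x. f x - g x) x u = dd f x u - dd g x u"
  by (rule frechet_derivative_eqI) (intro has_derivative_diff has_frechet_derivative)

lemma dd_uminus: "f differentiable (at x) \<Longrightarrow> dd (\<lambda>x. - f x) x u = - dd f x u"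
  by (rule frechet_derivative_eqI) (intro has_derivative_minus has_frechet_derivative)

lemma dd_mult:
  "f differentiable (at x) \<Longrightarrow> g differentiable (at x) \<Longrightarrow> dd (\<lambda>x. f x * g x) x u = f x * dd g x u + dd f x u * g x"
  by (rule frechet_derivative_eqI) (intro has_derivative_mult has_frechet_derivative)

lemma dd_cmult: "f differentiable (at x) \<Longrightarrow> dd (\<lambda>x. c * f x) x u = c * dd f x u"
  using dd_mult[of "\<lambda>x. c" x f u] by simp

lemma dd_sum:
  "(\<And>i. i \<in> I \<Longrightarrow> f i differentiable (at x)) \<Longrightarrow> dd (\<lambda>x. \<Sum>i\<in>I. f i x) x u = (\<Sum>i\<in>I. dd (f i) x u)"
  by (rule frechet_derivative_eqI) (intro has_derivative_sum has_frechet_derivative)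

lemma dd_cong:
  assumes "open U" "x \<in> U" "\<And>y. y \<in> U \<Longrightarrow> f y = g y" "smooth_on U f"
  shows "dd f x u = dd g x u"
  using frechet_derivative_transform_within_open[OF smooth_on_differentiable[OF assms(4,2)] assms(1,2,3)] by simp

lemma linear_dd: "smooth_on U f \<Longrightarrow> x \<in> U \<Longrightarrow> linear (dd f x)"
  by (rule linear_frechet_derivative[OF smooth_on_differentiable])

lemma linear_dd_param:
  fixes f :: "'a::real_normed_vector \<Rightarrow> 'b::real_vector \<Rightarrow> real"
  assumes U: "open U" "x \<in> U" and sm: "\<And>v. smooth_on U (\<lambda>y. f y v)" and lin: "\<And>y. y \<in> U \<Longrightarrow> linear (f y)"
  shows "linear (\<lambda>v. dd (\<lambda>y. f y v) x u)"
proof (rule linearI)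
  note diff = smooth_on_differentiable[OF sm U(2)]
  fix v w c
  show "dd (\<lambda>y. f y (v + w)) x u = dd (\<lambda>y. f y v) x u + dd (\<lambda>y. f y w) x u"
    using dd_cong[OF U _ sm, of "v + w" "\<lambda>y. f y v + f y w"] by (simp add: linear_add[OF lin] dd_add[OF diff diff])
  show "dd (\<lambda>y. f y (c *\<^sub>R v)) x u = c *\<^sub>R dd (\<lambda>y. f y v) x u"
    using dd_cong[OF U _ sm, of "c *\<^sub>R v" "\<lambda>y. c * f y v"] by (simp add: linear_cmul[OF lin] dd_cmult[OF diff])
qed

lemma smooth_on_apply:
  fixes f :: "'a::real_normed_vector \<Rightarrow> real^'n \<Rightarrow> real"
  assumes U: "open U" and sm: "\<And>v. smooth_on U (\<lambda>y. f y v)" and lin: "\<And>y. y \<in> U \<Longrightarrow> linear (f y)"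
    and X: "\<And>l. smooth_on U (\<lambda>y. X y $ l)"
  shows "smooth_on U (\<lambda>y. f y (X y))"
  by (rule smooth_on_cong[OF U, of "\<lambda>y. \<Sum>i\<in>UNIV. X y $ i * f y (axis i 1)"])
    (simp add: linear_vec_expand[OF lin], intro smooth_on_sum[OF U] smooth_on_mult[OF U] sm X)

text \<open>The product rule for the pairing of a one-form with a vector field.\<close>

lemma dd_apply:
  fixes f :: "'a::real_normed_vector \<Rightarrow> real^'n \<Rightarrow> real"
  assumes U: "open U" "x \<in> U" and sm: "\<And>v. smooth_on U (\<lambda>y. f y v)" and lin: "\<And>y. y \<in> U \<Longrightarrow> linear (f y)"
    and X: "\<And>l. smooth_on U (\<lambda>y. X y $ l)"
  shows "dd (\<lambda>y. f y (X y)) x u = dd (\<lambda>y. f y (X x)) x u + f x (\<chi> l. dd (\<lambda>y. X y $ l) x u)"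
proof -
  note diff = smooth_on_differentiable[OF sm U(2)] smooth_on_differentiable[OF X U(2)]
  have "dd (\<lambda>y. \<Sum>i\<in>UNIV. X y $ i * f y (axis i 1)) x u = dd (\<lambda>y. f y (X y)) x u"
    by (rule dd_cong[OF U]) (simp add: linear_vec_expand[OF lin],
      intro smooth_on_sum[OF U(1)] smooth_on_mult[OF U(1)] sm X)
  moreover have "dd (\<lambda>y. \<Sum>i\<in>UNIV. X y $ i * f y (axis i 1)) x u =
      (\<Sum>i\<in>UNIV. X x $ i * dd (\<lambda>y. f y (axis i 1)) x u + dd (\<lambda>y. X y $ i) x u * f x (axis i 1))"
    by (subst dd_sum, intro differentiable_mult diff, simp add: dd_mult diff)
  moreover have "dd (\<lambda>y. f y (X x)) x u = (\<Sum>i\<in>UNIV. X x $ i * dd (\<lambda>y. f y (axis i 1)) x u)"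
    by (rule linear_vec_expand[OF linear_dd_param[OF U sm lin]])
  moreover have "f x (\<chi> l. dd (\<lambda>y. X y $ l) x u) = (\<Sum>i\<in>UNIV. dd (\<lambda>y. X y $ i) x u * f x (axis i 1))"
    by (subst linear_vec_expand[OF lin[OF U(2)]]) simp
  ultimately show ?thesis by (simp add: sum.distrib)
qed

text \<open>An orthonormal frame field \<open>E\<close> with dual coframe \<open>e\<close> on an open set. All vector arguments below are constant
  vectors of the coordinate space, so that \<open>\<nabla>\<^sub>u v\<close> is given by the Christoffel symbols alone.\<close>

locale moving_frame =
  fixes U :: "(real^6) set" and e :: "real^6 \<Rightarrow> nat \<Rightarrow> real^6 \<Rightarrow> real" and E :: "real^6 \<Rightarrow> nat \<Rightarrow> real^6"
    and g :: "real^6 \<Rightarrow> real^6 \<Rightarrow> real^6 \<Rightarrow> real"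
  assumes open_U: "open U"
    and lin: "\<And>y a. y \<in> U \<Longrightarrow> a \<in> {1..6} \<Longrightarrow> linear (e y a)"
    and dual: "\<And>y a b. y \<in> U \<Longrightarrow> a \<in> {1..6} \<Longrightarrow> b \<in> {1..6} \<Longrightarrow> e y a (E y b) = (if a = b then 1 else 0)"
    and expand: "\<And>y u. y \<in> U \<Longrightarrow> u = (\<Sum>a=1..6. e y a u *\<^sub>R E y a)"
    and smooth_e: "\<And>a u. a \<in> {1..6} \<Longrightarrow> smooth_on U (\<lambda>y. e y a u)"
    and smooth_E: "\<And>a l. a \<in> {1..6} \<Longrightarrow> smooth_on U (\<lambda>y. E y a $ l)"
    and g: "\<And>y u w. y \<in> U \<Longrightarrow> g y u w = (\<Sum>a=1..6. e y a u * e y a w)"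
    and g_sym: "\<And>y u w. g y u w = g y w u"
begin

lemma linear_g: "y \<in> U \<Longrightarrow> linear (g y u)"
  using g[of y u] lin[of y] by (intro linearI) (simp_all add: linear_add[OF lin] linear_cmul[OF lin] algebra_simps sum.distrib sum_distrib_left)

lemma smooth_g: "smooth_on U (\<lambda>y. g y u w)"
  by (rule smooth_on_cong[OF open_U, of "\<lambda>y. \<Sum>a=1..6. e y a u * e y a w"])
    (simp add: g, intro smooth_on_sum[OF open_U] smooth_on_mult[OF open_U] smooth_e)

text \<open>\<open>chr y u v w\<close> is \<open>g(\<nabla>\<^sub>u v, w)\<close>, by the Koszul formula, and \<open>\<gamma> y a u v\<close> is \<open>e\<^sup>a(\<nabla>\<^sub>u v)\<close>.\<close>

definition Dg where "Dg y u v w = dd (\<lambda>z. g z v w) y u"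

definition chr where "chr y u v w = (Dg y u v w + Dg y v u w - Dg y w u v) / 2"

definition De where "De y a u v = dd (\<lambda>z. e z a v) y u"

definition \<gamma> where "\<gamma> y a u v = chr y u v (E y a)"

definition \<Gamma> where "\<Gamma> y u v = (\<Sum>a=1..6. \<gamma> y a u v *\<^sub>R E y a)"

text \<open>The connection forms: \<open>\<nabla>\<^sub>u e\<^sup>a = - \<omega> y u a b e\<^sup>b\<close> for the Levi-Civita connection.\<close>

definition \<omega> where "\<omega> y u a b = \<gamma> y a u (E y b) - De y a u (E y b)"

lemma Dg_linear: assumes "y \<in> U"
  shows "linear (\<lambda>u. Dg y u v w)" "linear (\<lambda>v. Dg y u v w)" "linear (\<lambda>w. Dg y u v w)"
proof -
  show "linear (\<lambda>u. Dg y u v w)" unfolding Dg_def by (rule linear_dd[OF smooth_g assms])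
  show 3: "linear (\<lambda>w. Dg y u v w)" for v
    unfolding Dg_def by (rule linear_dd_param[OF open_U assms smooth_g linear_g])
  have "Dg y u v w = Dg y u w v" for u v w unfolding Dg_def by (simp only: g_sym[of _ v w])
  then show "linear (\<lambda>v. Dg y u v w)" using 3[of w] by simp
qed

lemma Dg_sym: "Dg y u v w = Dg y u w v"
  unfolding Dg_def by (simp only: g_sym[of _ v w])

lemma linear_combine:
  assumes "linear f" "linear h" "linear (k :: 'x::real_vector \<Rightarrow> real)"
  shows "linear (\<lambda>u. (f u + h u - k u) / 2)"
  using linear_cmult_real[OF linear_compose_sub[OF linear_compose_add[OF assms(1,2)] assms(3)], of "1/2"] by simp

lemma chr_linear: assumes y: "y \<in> U"
  shows "linear (\<lambda>u. chr y u v w)" "linear (\<lambda>v. chr y u v w)" "linear (chr y u v)"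
  unfolding chr_def by (intro linear_combine Dg_linear[OF y])+

lemma chr_sym: "chr y u v w = chr y v u w"
  unfolding chr_def Dg_sym[of y w u v] by simp

lemma chr_compat: "chr y u v w + chr y u w v = Dg y u v w"
  unfolding chr_def using Dg_sym[of y u v w] by (simp add: field_simps)

lemma \<gamma>_linear: assumes y: "y \<in> U"
  shows "linear (\<lambda>u. \<gamma> y a u v)" "linear (\<gamma> y a u)"
  unfolding \<gamma>_def by (rule chr_linear[OF y])+

lemma \<gamma>_sym: "\<gamma> y a u v = \<gamma> y a v u"
  unfolding \<gamma>_def by (rule chr_sym)

lemma De_linear: assumes y: "y \<in> U" and a: "a \<in> {1..6}"
  shows "linear (\<lambda>u. De y a u v)" "linear (De y a u)"
  unfolding De_def
  by (rule linear_dd[OF smooth_e[OF a] y], rule linear_dd_param[OF open_U y smooth_e[OF a] lin[OF _ a]])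

lemma smooth_chr: "smooth_on U (\<lambda>y. chr y u v w)"
proof -
  have "smooth_on U (\<lambda>y. (1/2) * (Dg y u v w + Dg y v u w - Dg y w u v))"
    unfolding Dg_def by (intro smooth_on_mult smooth_on_const smooth_on_add smooth_on_diff open_U smooth_on_dd smooth_g)
  then show ?thesis by (simp add: chr_def)
qed

lemma smooth_\<gamma>: "a \<in> {1..6} \<Longrightarrow> smooth_on U (\<lambda>y. \<gamma> y a u v)"
  unfolding \<gamma>_def by (rule smooth_on_apply[OF open_U smooth_chr chr_linear(3) smooth_E])

lemma smooth_De: "a \<in> {1..6} \<Longrightarrow> smooth_on U (\<lambda>y. De y a u v)"
  unfolding De_def by (intro smooth_on_dd smooth_e)

lemma smooth_\<omega>: "a \<in> {1..6} \<Longrightarrow> b \<in> {1..6} \<Longrightarrow> smooth_on U (\<lambda>y. \<omega> y u a b)"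
  unfolding \<omega>_def
  by (intro smooth_on_diff[OF open_U]
      smooth_on_apply[OF open_U smooth_\<gamma> \<gamma>_linear(2) smooth_E] smooth_on_apply[OF open_U smooth_De De_linear(2) smooth_E])

lemma \<omega>_linear: "y \<in> U \<Longrightarrow> a \<in> {1..6} \<Longrightarrow> linear (\<lambda>u. \<omega> y u a b)"
  unfolding \<omega>_def by (intro linear_compose_sub \<gamma>_linear De_linear)

text \<open>Cartan's first structure equation. Since the Levi-Civita connection has no torsion, \<open>\<gamma>\<close> is symmetric and drops out
  of \<open>de\<^sup>a = - \<omega>\<^sub>a\<^sub>b \<and> e\<^sup>b\<close>.\<close>

lemma structure_equation:
  assumes y: "y \<in> U" and a: "a \<in> {1..6}"
  shows "De y a u v = \<gamma> y a u v - (\<Sum>b=1..6. \<omega> y u a b * e y b v)"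
proof -
  have lin': "linear (\<lambda>v. \<gamma> y a u v - De y a u v)"
    by (intro linear_compose_sub \<gamma>_linear De_linear y a)
  have "\<gamma> y a u v - De y a u v = (\<lambda>v. \<gamma> y a u v - De y a u v) (\<Sum>b=1..6. e y b v *\<^sub>R E y b)"
    using expand[OF y, of v] by simp
  also have "\<dots> = (\<Sum>b=1..6. e y b v * \<omega> y u a b)"
    unfolding linear_sum[OF lin'] by (simp add: linear_cmul[OF lin'] \<omega>_def)
  finally show ?thesis by (simp add: mult.commute)
qed

text \<open>The frame is orthonormal and the connection is metric.\<close>

lemma \<omega>_antisym:
  assumes y: "y \<in> U" and a: "a \<in> {1..6}" and b: "b \<in> {1..6}"
  shows "\<omega> y u a b = - \<omega> y u b a"
proof -
  note diff = smooth_on_differentiable[OF smooth_e y]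
  have Dgv: "Dg y u v w = (\<Sum>c=1..6. e y c v * De y c u w + De y c u v * e y c w)" for v w
  proof -
    have "Dg y u v w = dd (\<lambda>z. \<Sum>a=1..6. e z a v * e z a w) y u"
      unfolding Dg_def by (rule dd_cong[OF open_U y _ smooth_g]) (rule g)
    also have "\<dots> = (\<Sum>c=1..6. e y c v * De y c u w + De y c u v * e y c w)"
      by (subst dd_sum, intro differentiable_mult diff, simp, simp, simp add: dd_mult diff De_def)
    finally show ?thesis .
  qed
  have "Dg y u (E y a) (E y b) = De y a u (E y b) + De y b u (E y a)"
  proof -
    have "Dg y u (E y a) (E y b) = (\<Sum>c=1..6. (if c = a then De y c u (E y b) else 0) + (if c = b then De y c u (E y a) else 0))"
      unfolding Dgv by (rule sum.cong) (auto simp: dual[OF y _ a] dual[OF y _ b])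
    then show ?thesis using a b by (simp add: sum.distrib)
  qed
  moreover have "\<gamma> y a u (E y b) + \<gamma> y b u (E y a) = Dg y u (E y b) (E y a)"
    unfolding \<gamma>_def by (rule chr_compat)
  ultimately show ?thesis unfolding \<omega>_def using Dg_sym[of y u "E y a" "E y b"] by simp
qed

lemma e_\<Gamma>:
  assumes y: "y \<in> U" and a: "a \<in> {1..6}"
  shows "e y a (\<Gamma> y u v) = \<gamma> y a u v"
proof -
  have "e y a (\<Gamma> y u v) = (\<Sum>b=1..6. \<gamma> y b u v * e y a (E y b))"
    unfolding \<Gamma>_def by (simp add: linear_sum[OF lin[OF y a]] linear_cmul[OF lin[OF y a]])
  also have "\<dots> = (\<Sum>b=1..6. if b = a then \<gamma> y b u v else 0)"
    by (rule sum.cong) (auto simp: dual[OF y a])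
  finally show ?thesis using a by simp
qed

lemma smooth_\<Gamma>: "smooth_on U (\<lambda>y. \<Gamma> y u v $ l)"
  unfolding \<Gamma>_def by (simp del: One_nat_def, intro smooth_on_sum smooth_on_mult open_U smooth_\<gamma> smooth_E)

lemma inverse_metric:
  assumes y: "y \<in> U"
  shows "inverse_metric g y = (\<chi> k l. \<Sum>a=1..6. E y a $ k * E y a $ l)"
proof -
  let ?M = "metric_matrix g y" and ?B = "\<chi> k l. \<Sum>a=1..6. E y a $ k * E y a $ l"
  have "(?M ** ?B) $ i $ l = (mat 1 :: real^6^6) $ i $ l" for i l
  proof -
    have "(?M ** ?B) $ i $ l = (\<Sum>j\<in>UNIV. g y (axis i 1) (axis j 1) * (\<Sum>a=1..6. E y a $ j * E y a $ l))"
      by (simp add: matrix_matrix_mult_def metric_matrix_def)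
    also have "\<dots> = (\<Sum>a=1..6. (\<Sum>j\<in>UNIV. E y a $ j * g y (axis i 1) (axis j 1)) * E y a $ l)"
      unfolding sum_distrib_left sum_distrib_right by (subst sum.swap) (simp add: mult_ac)
    also have "\<dots> = (\<Sum>a=1..6. g y (axis i 1) (E y a) * E y a $ l)"
      by (simp only: linear_vec_expand[OF linear_g[OF y], symmetric])
    also have "\<dots> = (\<Sum>a=1..6. e y a (axis i 1) * E y a $ l)"
    proof (rule sum.cong[OF refl])
      fix a assume a: "a \<in> {1..6::nat}"
      have "g y (axis i 1) (E y a) = (\<Sum>c=1..6. if c = a then e y c (axis i 1) else 0)"
        unfolding g[OF y] by (rule sum.cong) (auto simp: dual[OF y _ a])
      then show "g y (axis i 1) (E y a) * E y a $ l = e y a (axis i 1) * E y a $ l" using a by simp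
    qed
    also have "\<dots> = (\<Sum>a=1..6. e y a (axis i 1) *\<^sub>R E y a) $ l" by simp
    also have "\<dots> = axis i 1 $ l" by (simp only: expand[OF y, of "axis i 1", symmetric])
    also have "\<dots> = (mat 1 :: real^6^6) $ i $ l" by (simp add: mat_def axis_def)
    finally show ?thesis .
  qed
  then have MB: "?M ** ?B = mat 1" by (simp add: vec_eq_iff)
  then have BM: "?B ** ?M = mat 1" using matrix_left_right_inverse by blast
  have "\<exists>A'. ?M ** A' = mat 1 \<and> A' ** ?M = mat 1" using MB BM by blast
  then have "?M ** matrix_inv ?M = mat 1 \<and> matrix_inv ?M ** ?M = mat 1"
    unfolding matrix_inv_def by (rule someI_ex)
  then have inv: "matrix_inv ?M ** ?M = mat 1" ..
  have "matrix_inv ?M = matrix_inv ?M ** (?M ** ?B)" unfolding MB by (simp only: matrix_mul_rid)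
  also have "\<dots> = ?B" unfolding matrix_mul_assoc inv by (simp only: matrix_mul_lid)
  finally have "matrix_inv ?M = ?B" .
  then show ?thesis by (simp add: inverse_metric_def)
qed

lemma christoffel:
  assumes y: "y \<in> U"
  shows "christoffel g k i j y = \<Gamma> y (axis i 1) (axis j 1) $ k"
proof -
  let ?C = "chr y (axis i 1) (axis j 1)"
  have "partial i (\<lambda>z. metric_matrix g z $ j $ l) y + partial j (\<lambda>z. metric_matrix g z $ i $ l) y
       - partial l (\<lambda>z. metric_matrix g z $ i $ j) y = 2 * ?C (axis l 1)" for l
    unfolding partial_def metric_matrix_def chr_def Dg_def by simp
  then have "christoffel g k i j y = (\<Sum>l\<in>UNIV. (\<Sum>a=1..6. E y a $ k * E y a $ l) * (2 * ?C (axis l 1))) / 2"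
    unfolding christoffel_def inverse_metric[OF y] by simp
  also have "\<dots> = (\<Sum>l\<in>UNIV. (\<Sum>a=1..6. E y a $ k * E y a $ l) * ?C (axis l 1))"
    by (simp add: sum_divide_distrib)
  also have "\<dots> = (\<Sum>a=1..6. (\<Sum>l\<in>UNIV. E y a $ l * ?C (axis l 1)) * E y a $ k)"
    unfolding sum_distrib_right by (subst sum.swap) (simp add: mult_ac)
  also have "\<dots> = (\<Sum>a=1..6. ?C (E y a) * E y a $ k)"
    by (simp only: linear_vec_expand[OF chr_linear(3)[OF y], symmetric])
  also have "\<dots> = \<Gamma> y (axis i 1) (axis j 1) $ k" by (simp add: \<Gamma>_def \<gamma>_def)
  finally show ?thesis .
qed

lemma \<Gamma>_linear:
  assumes y: "y \<in> U" shows "linear (\<lambda>v. \<Gamma> y u v $ l)"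
proof -
  have "linear (\<lambda>v. \<Sum>a=1..6. E y a $ l * \<gamma> y a u v)"
    by (intro linear_compose_sum ballI linear_cmult_real \<gamma>_linear(2)[OF y])
  then show ?thesis by (simp add: \<Gamma>_def mult.commute)
qed

text \<open>The curvature operator \<open>R(u, v) z\<close> on constant vectors, in terms of the Christoffel symbols \<open>\<Gamma>\<close> and their
  derivatives.\<close>

definition D\<Gamma> where "D\<Gamma> x u v z = (\<chi> l. dd (\<lambda>y. \<Gamma> y v z $ l) x u)"

definition R where "R x u v z = D\<Gamma> x u v z - D\<Gamma> x v u z + \<Gamma> x u (\<Gamma> x v z) - \<Gamma> x v (\<Gamma> x u z)"

lemma riemann:
  assumes x: "x \<in> U"
  shows "riemann g l k i j x = R x (axis i 1) (axis j 1) (axis k 1) $ l"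
proof -
  have p: "partial i (christoffel g l j k) x = D\<Gamma> x (axis i 1) (axis j 1) (axis k 1) $ l" for i j
    unfolding partial_def D\<Gamma>_def vec_lambda_beta
    by (rule sym, rule dd_cong[OF open_U x _ smooth_\<Gamma>]) (simp add: christoffel)
  have q: "(\<Sum>m\<in>UNIV. christoffel g l i m x * christoffel g m j k x)
      = \<Gamma> x (axis i 1) (\<Gamma> x (axis j 1) (axis k 1)) $ l" for i j
    by (subst linear_vec_expand[OF \<Gamma>_linear[OF x]]) (simp add: christoffel[OF x] mult.commute)
  show ?thesis
    unfolding riemann_def p R_def by (simp add: sum_subtractf q)
qed

text \<open>The curvature forms \<open>d\<omega> + \<omega> \<and> \<omega>\<close>.\<close>

definition F where
  "F x a b u v = dd (\<lambda>y. \<omega> y v a b) x u - dd (\<lambda>y. \<omega> y u a b) x v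
     + (\<Sum>c=1..6. \<omega> x u a c * \<omega> x v c b - \<omega> x v a c * \<omega> x u c b)"

text \<open>Differentiating \<open>e\<^sup>a(\<Gamma>(v, z)) = \<gamma>\<^sup>a(v, z)\<close> trades the quadratic terms in \<open>\<Gamma>\<close> for products of \<open>\<omega>\<close> and \<open>\<gamma>\<close>. As \<open>\<gamma>\<close> is
  symmetric, the Bianchi identity can be read off from this form.\<close>

lemma e_R_\<gamma>:
  assumes x: "x \<in> U" and a: "a \<in> {1..6}"
  shows "e x a (R x u v z) = dd (\<lambda>y. \<gamma> y a v z) x u - dd (\<lambda>y. \<gamma> y a u z) x v
    + ((\<Sum>b=1..6. \<omega> x u a b * \<gamma> x b v z) - (\<Sum>b=1..6. \<omega> x v a b * \<gamma> x b u z))"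
proof -
  have 1: "e x a (D\<Gamma> x u v z) + e x a (\<Gamma> x u (\<Gamma> x v z)) =
      dd (\<lambda>y. \<gamma> y a v z) x u + (\<Sum>b=1..6. \<omega> x u a b * \<gamma> x b v z)" for u v
  proof -
    have "dd (\<lambda>y. \<gamma> y a v z) x u = dd (\<lambda>y. e y a (\<Gamma> y v z)) x u"
      by (rule dd_cong[OF open_U x _ smooth_\<gamma>[OF a]]) (rule e_\<Gamma>[OF _ a, symmetric])
    also have "\<dots> = De x a u (\<Gamma> x v z) + e x a (D\<Gamma> x u v z)"
      unfolding De_def D\<Gamma>_def by (rule dd_apply[OF open_U x smooth_e[OF a] lin[OF _ a] smooth_\<Gamma>])
    also have "De x a u (\<Gamma> x v z) = \<gamma> x a u (\<Gamma> x v z) - (\<Sum>b=1..6. \<omega> x u a b * \<gamma> x b v z)"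
      unfolding structure_equation[OF x a] by (simp add: e_\<Gamma>[OF x])
    finally show ?thesis by (simp add: e_\<Gamma>[OF x a])
  qed
  show ?thesis
    unfolding R_def using 1[of u v] 1[of v u]
    by (simp add: linear_add[OF lin[OF x a]] linear_diff[OF lin[OF x a]])
qed

lemma dd_\<gamma>:
  assumes x: "x \<in> U" and a: "a \<in> {1..6}"
  shows "dd (\<lambda>y. \<gamma> y a v z) x u = dd (\<lambda>y. De y a v z) x u
    + (\<Sum>b=1..6. \<omega> x v a b * De x b u z + dd (\<lambda>y. \<omega> y v a b) x u * e x b z)"
proof -
  note diff = smooth_on_differentiable[OF smooth_e x] smooth_on_differentiable[OF smooth_\<omega> x]
    smooth_on_differentiable[OF smooth_De x]
  have "dd (\<lambda>y. \<gamma> y a v z) x u = dd (\<lambda>y. De y a v z + (\<Sum>b=1..6. \<omega> y v a b * e y b z)) x u"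
    by (rule dd_cong[OF open_U x _ smooth_\<gamma>[OF a]]) (simp add: structure_equation[OF _ a] del: One_nat_def)
  also have "\<dots> = dd (\<lambda>y. De y a v z) x u + dd (\<lambda>y. \<Sum>b=1..6. \<omega> y v a b * e y b z) x u"
    by (rule dd_add[OF smooth_on_differentiable[OF smooth_De[OF a] x] smooth_on_differentiable[OF _ x]])
      (intro smooth_on_sum smooth_on_mult open_U smooth_\<omega> smooth_e a)
  also have "dd (\<lambda>y. \<Sum>b=1..6. \<omega> y v a b * e y b z) x u = (\<Sum>b=1..6. dd (\<lambda>y. \<omega> y v a b * e y b z) x u)"
    by (rule dd_sum) (intro differentiable_mult diff a)
  also have "\<dots> = (\<Sum>b=1..6. \<omega> x v a b * De x b u z + dd (\<lambda>y. \<omega> y v a b) x u * e x b z)"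
    by (rule sum.cong[OF refl]) (unfold De_def, intro dd_mult diff a, assumption+)
  finally show ?thesis .
qed

text \<open>Cartan's second structure equation. After the structure equation has been substituted for \<open>\<gamma>\<close>, the second
  derivatives of the coframe cancel by the symmetry of mixed derivatives.\<close>

lemma e_R:
  assumes x: "x \<in> U" and a: "a \<in> {1..6}"
  shows "e x a (R x u v z) = (\<Sum>b=1..6. F x a b u v * e x b z)"
proof -
  have sw: "(\<Sum>b=1..6. p b * (\<Sum>c=1..6. q b c * e x c z)) = (\<Sum>b=1..6. (\<Sum>c=1..6. p c * q c b) * e x b z)"
    for p :: "nat \<Rightarrow> real" and q
    unfolding sum_distrib_left sum_distrib_right by (subst sum.swap) (simp add: mult.assoc)
  have comm: "dd (\<lambda>y. De y a v z) x u = dd (\<lambda>y. De y a u z) x v"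
    unfolding De_def by (rule dd_commute[OF open_U x smooth_e[OF a]])
  have \<gamma>: "(\<Sum>b=1..6. p b * \<gamma> x b v z) = (\<Sum>b=1..6. p b * De x b v z)
      + (\<Sum>b=1..6. (\<Sum>c=1..6. p c * \<omega> x v c b) * e x b z)" for p v
    unfolding sw[symmetric] sum.distrib[symmetric]
    by (rule sum.cong[OF refl]) (simp add: structure_equation[OF x] algebra_simps del: One_nat_def)
  show ?thesis
    unfolding e_R_\<gamma>[OF x a] dd_\<gamma>[OF x a] \<gamma> comm F_def
    by (simp add: sum.distrib sum_subtractf algebra_simps del: One_nat_def)
qed

lemma F_frame:
  assumes x: "x \<in> U" and a: "a \<in> {1..6}" and b: "b \<in> {1..6}"
  shows "F x a b u v = e x a (R x u v (E x b))"
proof -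
  have "(\<Sum>c=1..6. F x a c u v * e x c (E x b)) = (\<Sum>c=1..6. if c = b then F x a c u v else 0)"
    by (rule sum.cong) (auto simp: dual[OF x _ b])
  then show ?thesis unfolding e_R[OF x a] using b by simp
qed

lemma F_antisym:
  assumes x: "x \<in> U" and a: "a \<in> {1..6}" and b: "b \<in> {1..6}"
  shows "F x a b u v = - F x b a u v"
proof -
  have D: "dd (\<lambda>y. \<omega> y v a b) x u = - dd (\<lambda>y. \<omega> y v b a) x u" for u v
  proof -
    have "dd (\<lambda>y. \<omega> y v a b) x u = dd (\<lambda>y. - \<omega> y v b a) x u"
      by (rule dd_cong[OF open_U x _ smooth_\<omega>[OF a b]]) (rule \<omega>_antisym[OF _ a b])
    also have "\<dots> = - dd (\<lambda>y. \<omega> y v b a) x u"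
      by (rule dd_uminus[OF smooth_on_differentiable[OF smooth_\<omega>[OF b a] x]])
    finally show ?thesis .
  qed
  have Q: "(\<Sum>c=1..6. \<omega> x u a c * \<omega> x v c b - \<omega> x v a c * \<omega> x u c b)
      = - (\<Sum>c=1..6. \<omega> x u b c * \<omega> x v c a - \<omega> x v b c * \<omega> x u c a)"
    unfolding sum_negf[symmetric]
  proof (rule sum.cong[OF refl])
    fix c assume c: "c \<in> {1..6::nat}"
    show "\<omega> x u a c * \<omega> x v c b - \<omega> x v a c * \<omega> x u c b = - (\<omega> x u b c * \<omega> x v c a - \<omega> x v b c * \<omega> x u c a)"
      unfolding \<omega>_antisym[OF x a c] \<omega>_antisym[OF x c b] by simp
  qed
  show ?thesis unfolding F_def D[of v u] D[of u v] Q by simp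
qed

lemma F_swap: "F x a b u v = - F x a b v u"
  unfolding F_def by (simp add: sum_subtractf)

lemma bianchi:
  assumes x: "x \<in> U" and a: "a \<in> {1..6}" and ijk: "i \<in> {1..6}" "j \<in> {1..6}" "k \<in> {1..6}"
  shows "F x a k (E x i) (E x j) + F x a i (E x j) (E x k) + F x a j (E x k) (E x i) = 0"
proof -
  have "e x a (R x u v z) + e x a (R x v z u) + e x a (R x z u v) = 0" for u v z
    unfolding e_R_\<gamma>[OF x a] \<gamma>_sym[of _ _ u v] \<gamma>_sym[of _ _ v z] \<gamma>_sym[of _ _ z u] by simp
  then show ?thesis unfolding F_frame[OF x a ijk(1)] F_frame[OF x a ijk(2)] F_frame[OF x a ijk(3)] .
qed

lemma linear_F:
  assumes x: "x \<in> U" and a: "a \<in> {1..6}" and b: "b \<in> {1..6}"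
  shows "linear (F x a b u)" "linear (\<lambda>u. F x a b u v)"
proof -
  show 1: "linear (F x a b u)" for u
    unfolding F_def
  proof (intro linear_compose_add linear_compose_sub linear_compose_sum ballI)
    show "linear (\<lambda>v. dd (\<lambda>y. \<omega> y v a b) x u)"
      by (rule linear_dd_param[OF open_U x smooth_\<omega>[OF a b]]) (rule \<omega>_linear[OF _ a])
    show "linear (\<lambda>v. dd (\<lambda>y. \<omega> y u a b) x v)" by (rule linear_dd[OF smooth_\<omega>[OF a b] x])
    fix c assume c: "c \<in> {1..6::nat}"
    show "linear (\<lambda>v. \<omega> x u a c * \<omega> x v c b)" by (intro linear_cmult_real \<omega>_linear x c)
    show "linear (\<lambda>v. \<omega> x v a c * \<omega> x u c b)"
      using linear_cmult_real[OF \<omega>_linear[OF x a, of c], of "\<omega> x u c b"] by (simp add: mult.commute)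
  qed
  have "linear (\<lambda>u. (-1) * F x a b v u)" by (rule linear_cmult_real[OF 1])
  then show "linear (\<lambda>u. F x a b u v)" using F_swap[of x a b _ v] by simp
qed

text \<open>Both contractions turn into sums over the frame, because the inverse metric is \<open>\<Sum>\<^sub>a E\<^sub>a \<otimes> E\<^sub>a\<close>.\<close>

lemma scalar_curvature_frame:
  assumes x: "x \<in> U"
  shows "scalar_curvature g x = (\<Sum>a=1..6. \<Sum>b=1..6. F x a b (E x a) (E x b))"
proof -
  have comp: "w $ i = (\<Sum>a=1..6. e x a w * E x a $ i)" for w i
    using arg_cong[OF expand[OF x, of w], of "\<lambda>v. v $ i"] by simp
  have riem: "riemann g i k i j x = (\<Sum>a=1..6. e x a (R x (axis i 1) (axis j 1) (axis k 1)) * E x a $ i)" for i j k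
    unfolding riemann[OF x] by (rule comp)
  have "scalar_curvature g x = (\<Sum>j\<in>UNIV. \<Sum>k\<in>UNIV. \<Sum>i\<in>UNIV. \<Sum>a=1..6. \<Sum>b=1..6.
      E x b $ j * E x b $ k * (E x a $ i * e x a (R x (axis i 1) (axis j 1) (axis k 1))))"
    unfolding scalar_curvature_def ricci_def inverse_metric[OF x] riem
    by (simp add: sum_distrib_left sum_distrib_right mult_ac del: One_nat_def)
  also have "\<dots> = (\<Sum>a=1..6. \<Sum>b=1..6. \<Sum>i\<in>UNIV. \<Sum>j\<in>UNIV. \<Sum>k\<in>UNIV.
      E x b $ j * E x b $ k * (E x a $ i * e x a (R x (axis i 1) (axis j 1) (axis k 1))))"
  proof -
    let ?f = "\<lambda>a b i j k. E x b $ j * E x b $ k * (E x a $ i * e x a (R x (axis i 1) (axis j 1) (axis k 1)))"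
    have "(\<Sum>j\<in>UNIV. \<Sum>k\<in>UNIV. \<Sum>i\<in>UNIV. \<Sum>a=1..6. \<Sum>b=1..6. ?f a b i j k)
        = (\<Sum>j\<in>UNIV. \<Sum>k\<in>UNIV. \<Sum>a=1..6. \<Sum>i\<in>UNIV. \<Sum>b=1..6. ?f a b i j k)"
      by (intro sum.cong[OF refl] sum.swap)
    also have "\<dots> = (\<Sum>j\<in>UNIV. \<Sum>a=1..6. \<Sum>k\<in>UNIV. \<Sum>i\<in>UNIV. \<Sum>b=1..6. ?f a b i j k)"
      by (intro sum.cong[OF refl] sum.swap)
    also have "\<dots> = (\<Sum>a=1..6. \<Sum>j\<in>UNIV. \<Sum>k\<in>UNIV. \<Sum>i\<in>UNIV. \<Sum>b=1..6. ?f a b i j k)"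
      by (intro sum.cong[OF refl] sum.swap)
    also have "\<dots> = (\<Sum>a=1..6. \<Sum>j\<in>UNIV. \<Sum>k\<in>UNIV. \<Sum>b=1..6. \<Sum>i\<in>UNIV. ?f a b i j k)"
      by (intro sum.cong[OF refl] sum.swap)
    also have "\<dots> = (\<Sum>a=1..6. \<Sum>j\<in>UNIV. \<Sum>b=1..6. \<Sum>k\<in>UNIV. \<Sum>i\<in>UNIV. ?f a b i j k)"
      by (intro sum.cong[OF refl] sum.swap)
    also have "\<dots> = (\<Sum>a=1..6. \<Sum>b=1..6. \<Sum>j\<in>UNIV. \<Sum>k\<in>UNIV. \<Sum>i\<in>UNIV. ?f a b i j k)"
      by (intro sum.cong[OF refl] sum.swap)
    also have "\<dots> = (\<Sum>a=1..6. \<Sum>b=1..6. \<Sum>j\<in>UNIV. \<Sum>i\<in>UNIV. \<Sum>k\<in>UNIV. ?f a b i j k)"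
      by (intro sum.cong[OF refl] sum.swap)
    also have "\<dots> = (\<Sum>a=1..6. \<Sum>b=1..6. \<Sum>i\<in>UNIV. \<Sum>j\<in>UNIV. \<Sum>k\<in>UNIV. ?f a b i j k)"
      by (intro sum.cong[OF refl] sum.swap)
    finally show ?thesis .
  qed
  also have "\<dots> = (\<Sum>a=1..6. \<Sum>b=1..6. F x a b (E x a) (E x b))"
  proof (intro sum.cong refl)
    fix a b assume a: "a \<in> {1..6::nat}" and b: "b \<in> {1..6::nat}"
    have lz: "linear (\<lambda>z. e x a (R x u v z))" for u v
      unfolding e_R[OF x a] by (intro linear_compose_sum ballI linear_cmult_real lin[OF x])
    have "(\<Sum>k\<in>UNIV. E x b $ j * E x b $ k * (E x a $ i * e x a (R x u v (axis k 1))))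
        = E x a $ i * (E x b $ j * F x a b u v)" for i j u v
      unfolding F_frame[OF x a b] linear_vec_expand[OF lz, of u v "E x b"]
      by (simp add: sum_distrib_left mult_ac)
    then have "(\<Sum>i\<in>UNIV. \<Sum>j\<in>UNIV. \<Sum>k\<in>UNIV. E x b $ j * E x b $ k * (E x a $ i * e x a (R x (axis i 1) (axis j 1) (axis k 1))))
      = (\<Sum>i\<in>UNIV. E x a $ i * (\<Sum>j\<in>UNIV. E x b $ j * F x a b (axis i 1) (axis j 1)))"
      by (simp add: sum_distrib_left)
    also have "\<dots> = F x a b (E x a) (E x b)"
      by (simp only: linear_vec_expand[OF linear_F(1)[OF x a b], symmetric]
        linear_vec_expand[OF linear_F(2)[OF x a b], symmetric])
    finally show "(\<Sum>i\<in>UNIV. \<Sum>j\<in>UNIV. \<Sum>k\<in>UNIV. E x b $ j * E x b $ k * (E x a $ i * e x a (R x (axis i 1) (axis j 1) (axis k 1))))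
      = F x a b (E x a) (E x b)" .
  qed
  finally show ?thesis .
qed

end

section \<open>The algebra of intrinsic torsion\<close>

text \<open>The value of a pair of two-forms on the bivector tensor \<open>\<kappa> \<otimes> \<kappa> + \<Sum>\<^sub>k \<iota>\<^sub>k\<Omega> \<otimes> \<iota>\<^sub>k\<Omega>\<close>, where
  \<open>\<iota>\<^sub>1\<Omega> = e\<^sup>3\<^sup>5 - e\<^sup>4\<^sup>6\<close>, \<open>\<iota>\<^sub>2\<Omega> = - e\<^sup>3\<^sup>6 - e\<^sup>4\<^sup>5\<close>, \<open>\<iota>\<^sub>3\<Omega> = - e\<^sup>1\<^sup>5 + e\<^sup>2\<^sup>6\<close>, \<open>\<iota>\<^sub>4\<Omega> = e\<^sup>1\<^sup>6 + e\<^sup>2\<^sup>5\<close>,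
  \<open>\<iota>\<^sub>5\<Omega> = e\<^sup>1\<^sup>3 - e\<^sup>2\<^sup>4\<close>, \<open>\<iota>\<^sub>6\<Omega> = - e\<^sup>1\<^sup>4 - e\<^sup>2\<^sup>3\<close>. Together with \<open>\<kappa>\<close> these span the complement of \<open>su(3)\<close>.\<close>

definition su3_perp_trace :: "(nat \<Rightarrow> nat \<Rightarrow> nat \<Rightarrow> nat \<Rightarrow> real) \<Rightarrow> real" where
  "su3_perp_trace X =
    X 1 2 1 2 + X 1 2 3 4 + X 1 2 5 6 + X 3 4 1 2 + X 3 4 3 4 + X 3 4 5 6 + X 5 6 1 2 + X 5 6 3 4 + X 5 6 5 6
    + X 3 5 3 5 - X 3 5 4 6 - X 4 6 3 5 + X 4 6 4 6 + X 3 6 3 6 + X 3 6 4 5 + X 4 5 3 6 + X 4 5 4 5 + X 1 5 1 5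
    - X 1 5 2 6 - X 2 6 1 5 + X 2 6 2 6 + X 1 6 1 6 + X 1 6 2 5 + X 2 5 1 6 + X 2 5 2 5 + X 1 3 1 3 - X 1 3 2 4
    - X 2 4 1 3 + X 2 4 2 4 + X 1 4 1 4 + X 1 4 2 3 + X 2 3 1 4 + X 2 3 2 3"

text \<open>The vector \<open>V\<^sub>j = \<Sum>\<^sub>i \<kappa>\<^sub>j\<^sub>i m\<^sub>i + \<Sum>\<^sub>k\<^sub>i \<Omega>\<^sub>k\<^sub>j\<^sub>i t\<^sub>k\<^sub>i\<close>, for components \<open>m\<^sub>i\<close> of \<open>\<omega>(\<kappa>)\<close> and \<open>t\<^sub>k\<^sub>i\<close> of \<open>\<omega>(\<iota>\<^sub>k\<Omega>)\<close> along
  the \<open>i\<close>-th frame vector. The entry at index 0 is a filler.\<close>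

definition torsion_vec :: "(nat \<Rightarrow> real) \<Rightarrow> (nat \<Rightarrow> nat \<Rightarrow> real) \<Rightarrow> nat \<Rightarrow> real" where
  "torsion_vec m t j = [0, m 2 + t 5 3 - t 6 4 - t 3 5 + t 4 6,
    - m 1 - t 6 3 - t 5 4 + t 4 5 + t 3 6, m 4 - t 5 1 + t 6 2 + t 1 5 - t 2 6,
    - m 3 + t 6 1 + t 5 2 - t 2 5 - t 1 6, m 6 + t 3 1 - t 4 2 - t 1 3 + t 2 4,
    - m 5 - t 4 1 - t 3 2 + t 2 3 + t 1 4] ! j"

lemma torsion_vec_simps:
  "torsion_vec m t 1 = m 2 + t 5 3 - t 6 4 - t 3 5 + t 4 6"
  "torsion_vec m t 2 = - m 1 - t 6 3 - t 5 4 + t 4 5 + t 3 6"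
  "torsion_vec m t 3 = m 4 - t 5 1 + t 6 2 + t 1 5 - t 2 6"
  "torsion_vec m t 4 = - m 3 + t 6 1 + t 5 2 - t 2 5 - t 1 6"
  "torsion_vec m t 5 = m 6 + t 3 1 - t 4 2 - t 1 3 + t 2 4"
  "torsion_vec m t 6 = - m 5 - t 4 1 - t 3 2 + t 2 3 + t 1 4"
  by (simp_all add: torsion_vec_def)

text \<open>The quadratic form in the intrinsic torsion that is left over in \<open>su3_perp_trace_quadratic\<close>.\<close>

definition torsion_quad :: "(nat \<Rightarrow> real) \<Rightarrow> (nat \<Rightarrow> nat \<Rightarrow> real) \<Rightarrow> real" where
  "torsion_quad m t =
    - m 1 * t 3 6 - m 1 * t 4 5 + m 1 * t 5 4 + m 1 * t 6 3 - m 2 * t 3 5 + m 2 * t 4 6 + m 2 * t 5 3 - m 2 * t 6 4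
    + m 3 * t 1 6 + m 3 * t 2 5 - m 3 * t 5 2 - m 3 * t 6 1 + m 4 * t 1 5 - m 4 * t 2 6 - m 4 * t 5 1 + m 4 * t 6 2
    - m 5 * t 1 4 - m 5 * t 2 3 + m 5 * t 3 2 + m 5 * t 4 1 - m 6 * t 1 3 + m 6 * t 2 4 + m 6 * t 3 1 - m 6 * t 4 2
    + t 1 1 * t 2 2 + t 1 1 * t 3 3 + t 1 1 * t 4 4 + t 1 1 * t 5 5 + t 1 1 * t 6 6 - t 1 2 * t 2 1 + t 1 2 * t 3 4
    - t 1 2 * t 4 3 + t 1 2 * t 5 6 - t 1 2 * t 6 5 - t 1 3 * t 2 4 - t 1 3 * t 3 1 + t 1 3 * t 4 2 + t 1 4 * t 2 3
    - t 1 4 * t 3 2 - t 1 4 * t 4 1 - t 1 5 * t 2 6 - t 1 5 * t 5 1 + t 1 5 * t 6 2 + t 1 6 * t 2 5 - t 1 6 * t 5 2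
    - t 1 6 * t 6 1 - t 2 1 * t 3 4 + t 2 1 * t 4 3 - t 2 1 * t 5 6 + t 2 1 * t 6 5 + t 2 2 * t 3 3 + t 2 2 * t 4 4
    + t 2 2 * t 5 5 + t 2 2 * t 6 6 - t 2 3 * t 3 2 - t 2 3 * t 4 1 + t 2 4 * t 3 1 - t 2 4 * t 4 2 - t 2 5 * t 5 2
    - t 2 5 * t 6 1 + t 2 6 * t 5 1 - t 2 6 * t 6 2 - t 3 1 * t 4 2 + t 3 2 * t 4 1 + t 3 3 * t 4 4 + t 3 3 * t 5 5
    + t 3 3 * t 6 6 - t 3 4 * t 4 3 + t 3 4 * t 5 6 - t 3 4 * t 6 5 - t 3 5 * t 4 6 - t 3 5 * t 5 3 + t 3 5 * t 6 4
    + t 3 6 * t 4 5 - t 3 6 * t 5 4 - t 3 6 * t 6 3 - t 4 3 * t 5 6 + t 4 3 * t 6 5 + t 4 4 * t 5 5 + t 4 4 * t 6 6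
    - t 4 5 * t 5 4 - t 4 5 * t 6 3 + t 4 6 * t 5 3 - t 4 6 * t 6 4 - t 5 1 * t 6 2 + t 5 2 * t 6 1 - t 5 3 * t 6 4
    + t 5 4 * t 6 3 + t 5 5 * t 6 6 - t 5 6 * t 6 5"

text \<open>The quadratic terms of the curvature, where the last sum comes from the brackets of the frame vectors. The
  complement of \<open>su(3)\<close> is invariant under \<open>SU(3)\<close>; for this reason the \<open>su(3)\<close> part of the connection occurs only
  in the traces \<open>\<Sum>\<^sub>i w\<^sub>i\<^sub>j\<^sub>i\<close>, which complete the derivatives of \<open>V\<close> to a divergence.\<close>

lemma su3_perp_trace_quadratic:
  fixes w :: "nat \<Rightarrow> nat \<Rightarrow> nat \<Rightarrow> real"
  assumes anti: "\<And>i a b. i \<in> {1..6} \<Longrightarrow> a \<in> {1..6} \<Longrightarrow> b \<in> {1..6} \<Longrightarrow> w i a b = - w i b a"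
    and t: "\<And>i. m i = w i 1 2 + w i 3 4 + w i 5 6"
    "\<And>i. t 1 i = w i 3 5 - w i 4 6"
    "\<And>i. t 2 i = - w i 3 6 - w i 4 5"
    "\<And>i. t 3 i = - w i 1 5 + w i 2 6"
    "\<And>i. t 4 i = w i 1 6 + w i 2 5"
    "\<And>i. t 5 i = w i 1 3 - w i 2 4"
    "\<And>i. t 6 i = - w i 1 4 - w i 2 3"
  shows "su3_perp_trace (\<lambda>a b i j. (\<Sum>c=1..6. w i a c * w j c b - w j a c * w i c b) - (\<Sum>c=1..6. w c a b * (w i c j - w j c i)))
     = torsion_quad m t - (\<Sum>j=1..6. torsion_vec m t j * (\<Sum>i=1..6. w i j i))"
proof -
  have z: "w i a a = 0" if "i \<in> {1..6}" "a \<in> {1..6}" for i a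
    using anti[OF that(1,2,2)] by simp
  have s: "w i 2 1 = - w i 1 2" "w i 3 1 = - w i 1 3" "w i 4 1 = - w i 1 4" "w i 5 1 = - w i 1 5" "w i 6 1 = - w i 1 6"
    "w i 3 2 = - w i 2 3" "w i 4 2 = - w i 2 4" "w i 5 2 = - w i 2 5" "w i 6 2 = - w i 2 6" "w i 4 3 = - w i 3 4"
    "w i 5 3 = - w i 3 5" "w i 6 3 = - w i 3 6" "w i 5 4 = - w i 4 5" "w i 6 4 = - w i 4 6" "w i 6 5 = - w i 5 6"
    if "i \<in> {1..6}" for i
    by (rule anti; use that in simp)+
  have r: "1 \<in> {1..6::nat}" "2 \<in> {1..6::nat}" "3 \<in> {1..6::nat}" "4 \<in> {1..6::nat}" "5 \<in> {1..6::nat}" "6 \<in> {1..6::nat}"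
    by simp_all
  show ?thesis
    unfolding su3_perp_trace_def torsion_vec_simps torsion_quad_def sum_1_6 t
    unfolding s[OF r(1)] s[OF r(2)] s[OF r(3)] s[OF r(4)] s[OF r(5)] s[OF r(6)]
      z[OF r(1) r(1)] z[OF r(1) r(2)] z[OF r(1) r(3)] z[OF r(1) r(4)] z[OF r(1) r(5)] z[OF r(1) r(6)]
      z[OF r(2) r(1)] z[OF r(2) r(2)] z[OF r(2) r(3)] z[OF r(2) r(4)] z[OF r(2) r(5)] z[OF r(2) r(6)]
      z[OF r(3) r(1)] z[OF r(3) r(2)] z[OF r(3) r(3)] z[OF r(3) r(4)] z[OF r(3) r(5)] z[OF r(3) r(6)]
      z[OF r(4) r(1)] z[OF r(4) r(2)] z[OF r(4) r(3)] z[OF r(4) r(4)] z[OF r(4) r(5)] z[OF r(4) r(6)]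
      z[OF r(5) r(1)] z[OF r(5) r(2)] z[OF r(5) r(3)] z[OF r(5) r(4)] z[OF r(5) r(5)] z[OF r(5) r(6)]
      z[OF r(6) r(1)] z[OF r(6) r(2)] z[OF r(6) r(3)] z[OF r(6) r(4)] z[OF r(6) r(5)] z[OF r(6) r(6)]
    by algebra
qed

text \<open>One has \<open>\<Sum>\<^sub>k \<Omega>\<^sub>k\<^sub>a\<^sub>b \<Omega>\<^sub>k\<^sub>i\<^sub>j = \<delta>\<^sub>a\<^sub>i \<delta>\<^sub>b\<^sub>j - \<delta>\<^sub>a\<^sub>j \<delta>\<^sub>b\<^sub>i - \<kappa>\<^sub>a\<^sub>i \<kappa>\<^sub>b\<^sub>j + \<kappa>\<^sub>a\<^sub>j \<kappa>\<^sub>b\<^sub>i\<close>. Together with \<open>\<kappa>\<^sub>a\<^sub>b \<kappa>\<^sub>i\<^sub>j\<close> the terms in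
  \<open>\<kappa>\<close> become totally antisymmetric and do not contribute, by the Bianchi identity.\<close>

lemma scalar_eq_su3_perp_trace:
  fixes F :: "nat \<Rightarrow> nat \<Rightarrow> nat \<Rightarrow> nat \<Rightarrow> real"
  assumes a1: "\<And>a b i j. a \<in> {1..6} \<Longrightarrow> b \<in> {1..6} \<Longrightarrow> F a b i j = - F b a i j"
    and a2: "\<And>a b i j. F a b i j = - F a b j i"
    and B: "\<And>a i j k. a \<in> {1..6} \<Longrightarrow> i \<in> {1..6} \<Longrightarrow> j \<in> {1..6} \<Longrightarrow> k \<in> {1..6} \<Longrightarrow>
      F a k i j + F a i j k + F a j k i = 0"
  shows "(\<Sum>a=1..6. \<Sum>b=1..6. F a b a b) = 2 * su3_perp_trace F"
proof -
  have d: "F a b a b = F b a b a" if "a \<in> {1..6}" "b \<in> {1..6}" for a b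
    using a1[OF that, of a b] a2[of b a a b] by simp
  have z: "F a a a a = 0" for a
    using a2[of a a a a] by simp
  have r: "1 \<in> {1..6::nat}" "2 \<in> {1..6::nat}" "3 \<in> {1..6::nat}" "4 \<in> {1..6::nat}" "5 \<in> {1..6::nat}" "6 \<in> {1..6::nat}"
    by simp_all
  \<comment> \<open>The total antisymmetrization, which enters for the three nonzero components of \<open>\<kappa> \<and> \<kappa>\<close>.\<close>
  have q: "- F a c b d - F b d a c + F a d b c + F b c a d + F a b c d + F c d a b = 0"
    if "a \<in> {1..6}" "b \<in> {1..6}" "c \<in> {1..6}" "d \<in> {1..6}" for a b c d
    using B[OF that(1) that(2-4)] B[OF that(2) that(1,3,4)] B[OF that(3) that(1,2,4)] B[OF that(4) that(1-3)]
      a1[OF that(1,2), of c d] a1[OF that(1,3), of b d] a1[OF that(1,4), of b c]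
      a1[OF that(2,3), of a d] a1[OF that(2,4), of a c] a1[OF that(3,4), of a b]
      a2[of a b c d] a2[of a c b d] a2[of a d b c] a2[of b c a d] a2[of b d a c] a2[of c d a b]
      a2[of b a c d] a2[of c a b d] a2[of d a b c] a2[of c b a d] a2[of d b a c] a2[of d c a b]
    by linarith
  show ?thesis
    unfolding sum_1_6 su3_perp_trace_def z
      d[OF r(1) r(2)] d[OF r(1) r(3)] d[OF r(1) r(4)] d[OF r(1) r(5)] d[OF r(1) r(6)]
      d[OF r(2) r(3)] d[OF r(2) r(4)] d[OF r(2) r(5)] d[OF r(2) r(6)] d[OF r(3) r(4)]
      d[OF r(3) r(5)] d[OF r(3) r(6)] d[OF r(4) r(5)] d[OF r(4) r(6)] d[OF r(5) r(6)]
    using q[OF r(1) r(2) r(3) r(4)] q[OF r(1) r(2) r(5) r(6)] q[OF r(3) r(4) r(5) r(6)]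
    by algebra
qed

text \<open>On the exterior derivative of \<open>\<omega>\<close> the trace is a divergence: one of the two slots of each bivector contracts
  \<open>\<omega>\<close> to \<open>m\<close> or \<open>t\<close>, and the other one pairs the derivative with the form index.\<close>

lemma su3_perp_trace_derivative:
  fixes D :: "nat \<Rightarrow> nat \<Rightarrow> nat \<Rightarrow> nat \<Rightarrow> real"
  shows "su3_perp_trace (\<lambda>a b i j. D i j a b - D j i a b) =
    (\<Sum>j=1..6. torsion_vec (\<lambda>i. D j i 1 2 + D j i 3 4 + D j i 5 6)
      (\<lambda>k i. [0, D j i 3 5 - D j i 4 6, - D j i 3 6 - D j i 4 5, - D j i 1 5 + D j i 2 6, D j i 1 6 + D j i 2 5, D j i 1 3 - D j i 2 4, - D j i 1 4 - D j i 2 3] ! k) j)"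
  unfolding sum_1_6 torsion_vec_simps su3_perp_trace_def by simp

lemma su3_perp_trace_add: "su3_perp_trace (\<lambda>a b i j. X a b i j + Y a b i j) = su3_perp_trace X + su3_perp_trace Y"
  unfolding su3_perp_trace_def by simp

text \<open>The components in an adapted frame of the equations that define the torsion forms: \<open>p\<close>, \<open>n\<close>, \<open>P\<close>, \<open>S\<close>, \<open>N\<close> are
  those of \<open>\<pi>\<^sub>1\<close>, \<open>\<nu>\<^sub>1\<close>, \<open>\<pi>\<^sub>2\<close>, \<open>\<sigma>\<^sub>2\<close>, \<open>\<nu>\<^sub>3\<close>. The first 20 equations stem from \<open>d\<kappa>\<close>, and 15 each from \<open>d\<Omega>\<close> and
  \<open>dJ\<Omega>\<close>; the others express the type of \<open>\<pi>\<^sub>2\<close>, \<open>\<sigma>\<^sub>2\<close> and \<open>\<nu>\<^sub>3\<close>.\<close>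

locale torsion_equations =
  fixes t :: "nat \<Rightarrow> nat \<Rightarrow> real" and m p n :: "nat \<Rightarrow> real" and P S :: "nat \<Rightarrow> nat \<Rightarrow> real"
    and N :: "nat \<Rightarrow> nat \<Rightarrow> nat \<Rightarrow> real" and \<pi>0 \<sigma>0 :: real
  assumes equations: "t 5 1 - t 6 2 = N 1 2 3 + n 3"
    "- t 5 2 - t 6 1 = N 1 2 4 + n 4"
    "- t 3 1 + t 4 2 = N 1 2 5 + n 5"
    "t 3 2 + t 4 1 = N 1 2 6 + n 6"
    "- t 5 3 + t 6 4 = N 1 3 4 + n 1"
    "t 2 1 + t 4 3 + t 6 5 = N 1 3 5 - 3/2 * \<sigma>0"
    "t 1 1 + t 3 3 + t 6 6 = N 1 3 6 + 3/2 * \<pi>0"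
    "t 1 1 + t 4 4 + t 5 5 = N 1 4 5 + 3/2 * \<pi>0"
    "- t 2 1 + t 3 4 + t 5 6 = N 1 4 6 + 3/2 * \<sigma>0"
    "t 3 5 - t 4 6 = N 1 5 6 + n 1"
    "t 5 4 + t 6 3 = N 2 3 4 + n 2"
    "t 2 2 + t 3 3 + t 5 5 = N 2 3 5 + 3/2 * \<pi>0"
    "t 1 2 - t 4 3 + t 5 6 = N 2 3 6 + 3/2 * \<sigma>0"
    "t 1 2 + t 3 4 - t 6 5 = N 2 4 5 + 3/2 * \<sigma>0"
    "- t 2 2 - t 4 4 - t 6 6 = N 2 4 6 - 3/2 * \<pi>0"
    "- t 3 6 - t 4 5 = N 2 5 6 + n 2"
    "t 1 3 - t 2 4 = N 3 4 5 + n 5"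
    "- t 1 4 - t 2 3 = N 3 4 6 + n 6"
    "- t 1 5 + t 2 6 = N 3 5 6 + n 3"
    "t 1 6 + t 2 5 = N 4 5 6 + n 4"
    "t 1 1 + t 2 2 + t 3 3 + t 4 4 = - P 1 2 - P 3 4 + 2 * \<pi>0"
    "- m 1 + t 4 5 - t 6 3 = - P 3 5 - p 2"
    "m 2 + t 4 6 + t 5 3 = - P 3 6 - p 1"
    "m 2 - t 3 5 - t 6 4 = - P 4 5 - p 1"
    "m 1 - t 3 6 + t 5 4 = - P 4 6 + p 2"
    "t 1 1 + t 2 2 + t 5 5 + t 6 6 = - P 1 2 - P 5 6 + 2 * \<pi>0"
    "m 3 + t 2 5 - t 6 1 = - P 1 5 + p 4"
    "- m 4 + t 2 6 + t 5 1 = - P 1 6 + p 3"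
    "- m 5 + t 2 3 - t 4 1 = - P 1 3 - p 6"
    "m 6 + t 2 4 + t 3 1 = - P 1 4 - p 5"
    "- m 4 - t 1 5 - t 6 2 = - P 2 5 + p 3"
    "- m 3 - t 1 6 + t 5 2 = - P 2 6 - p 4"
    "m 6 - t 1 3 - t 4 2 = - P 2 3 - p 5"
    "m 5 - t 1 4 + t 3 2 = - P 2 4 + p 6"
    "t 3 3 + t 4 4 + t 5 5 + t 6 6 = - P 3 4 - P 5 6 + 2 * \<pi>0"
    "t 1 2 - t 2 1 + t 3 4 - t 4 3 = - S 1 2 - S 3 4 + 2 * \<sigma>0"
    "- m 2 + t 3 5 - t 5 3 = - S 3 5 + p 1"
    "- m 1 + t 3 6 - t 6 3 = - S 3 6 - p 2"
    "- m 1 + t 4 5 - t 5 4 = - S 4 5 - p 2"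
    "m 2 + t 4 6 - t 6 4 = - S 4 6 - p 1"
    "t 1 2 - t 2 1 + t 5 6 - t 6 5 = - S 1 2 - S 5 6 + 2 * \<sigma>0"
    "m 4 + t 1 5 - t 5 1 = - S 1 5 - p 3"
    "m 3 + t 1 6 - t 6 1 = - S 1 6 + p 4"
    "- m 6 + t 1 3 - t 3 1 = - S 1 3 + p 5"
    "- m 5 + t 1 4 - t 4 1 = - S 1 4 - p 6"
    "m 3 + t 2 5 - t 5 2 = - S 2 5 + p 4"
    "- m 4 + t 2 6 - t 6 2 = - S 2 6 + p 3"
    "- m 5 + t 2 3 - t 3 2 = - S 2 3 - p 6"
    "m 6 + t 2 4 - t 4 2 = - S 2 4 - p 5"
    "t 3 4 - t 4 3 + t 5 6 - t 6 5 = - S 3 4 - S 5 6 + 2 * \<sigma>0"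
    "P 1 3 = P 2 4"
    "P 1 4 = - P 2 3"
    "P 1 5 = P 2 6"
    "P 1 6 = - P 2 5"
    "P 3 5 = P 4 6"
    "P 3 6 = - P 4 5"
    "P 1 2 + P 3 4 + P 5 6 = 0"
    "S 1 3 = S 2 4"
    "S 1 4 = - S 2 3"
    "S 1 5 = S 2 6"
    "S 1 6 = - S 2 5"
    "S 3 5 = S 4 6"
    "S 3 6 = - S 4 5"
    "S 1 2 + S 3 4 + S 5 6 = 0"
    "N 1 2 5 + N 3 4 5 = 0"
    "N 1 2 6 + N 3 4 6 = 0"
    "N 1 2 3 + N 3 5 6 = 0"
    "N 1 2 4 + N 4 5 6 = 0"
    "N 1 3 4 + N 1 5 6 = 0"
    "N 2 3 4 + N 2 5 6 = 0"
    "- N 1 3 6 - N 1 4 5 - N 2 3 5 + N 2 4 6 = 0"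
    "N 1 3 5 - N 1 4 6 - N 2 3 6 - N 2 4 5 = 0"
begin

lemma dependent:
  "P 5 6 = - P 1 2 - P 3 4"
  "P 2 4 = P 1 3"
  "P 2 3 = - P 1 4"
  "P 2 6 = P 1 5"
  "P 2 5 = - P 1 6"
  "P 4 6 = P 3 5"
  "P 4 5 = - P 3 6"
  "S 5 6 = - S 1 2 - S 3 4"
  "S 2 4 = S 1 3"
  "S 2 3 = - S 1 4"
  "S 2 6 = S 1 5"
  "S 2 5 = - S 1 6"
  "S 4 6 = S 3 5"
  "S 4 5 = - S 3 6"
  "N 2 4 6 = N 1 3 6 + N 1 4 5 + N 2 3 5"
  "N 1 3 5 = N 1 4 6 + N 2 3 6 + N 2 4 5"
  "N 2 5 6 = - N 2 3 4"
  "N 1 5 6 = - N 1 3 4"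
  "N 4 5 6 = - N 1 2 4"
  "N 3 5 6 = - N 1 2 3"
  "N 3 4 5 = - N 1 2 5"
  "N 3 4 6 = - N 1 2 6"
  using equations by linarith+

text \<open>The intrinsic torsion has 42 components and is determined by the torsion forms: the linear system is
  overdetermined but has full rank.\<close>

lemma solved:
  "t 1 1 = 1/2 * N 1 3 6 + 1/2 * N 1 4 5 - 1/2 * P 1 2 + 1/2 * \<pi>0"
  "t 1 2 = 1/2 * N 2 3 6 + 1/2 * N 2 4 5 - 1/2 * S 1 2 + 1/2 * \<sigma>0"
  "t 1 3 = - 1/2 * N 1 2 5 - 1/2 * P 1 4 - 1/2 * S 1 3 + 1/2 * n 5"
  "t 1 4 = 1/2 * N 1 2 6 + 1/2 * P 1 3 - 1/2 * S 1 4 - 1/2 * n 6"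
  "t 1 5 = 1/2 * N 1 2 3 - 1/2 * P 1 6 - 1/2 * S 1 5 - 1/2 * n 3"
  "t 1 6 = - 1/2 * N 1 2 4 + 1/2 * P 1 5 - 1/2 * S 1 6 + 1/2 * n 4"
  "t 2 1 = 1/2 * N 2 3 6 + 1/2 * N 2 4 5 + 1/2 * S 1 2 - 1/2 * \<sigma>0"
  "t 2 2 = - 1/2 * N 1 3 6 - 1/2 * N 1 4 5 - 1/2 * P 1 2 + 1/2 * \<pi>0"
  "t 2 3 = 1/2 * N 1 2 6 - 1/2 * P 1 3 + 1/2 * S 1 4 - 1/2 * n 6"
  "t 2 4 = 1/2 * N 1 2 5 - 1/2 * P 1 4 - 1/2 * S 1 3 - 1/2 * n 5"
  "t 2 5 = - 1/2 * N 1 2 4 - 1/2 * P 1 5 + 1/2 * S 1 6 + 1/2 * n 4"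
  "t 2 6 = - 1/2 * N 1 2 3 - 1/2 * P 1 6 - 1/2 * S 1 5 + 1/2 * n 3"
  "t 3 1 = - 1/2 * N 1 2 5 - 1/2 * P 1 4 + 1/2 * S 1 3 - 1/2 * n 5"
  "t 3 2 = 1/2 * N 1 2 6 - 1/2 * P 1 3 - 1/2 * S 1 4 + 1/2 * n 6"
  "t 3 3 = 1/2 * N 1 3 6 + 1/2 * N 2 3 5 - 1/2 * P 3 4 + 1/2 * \<pi>0"
  "t 3 4 = 1/2 * N 1 4 6 + 1/2 * N 2 4 5 - 1/2 * S 3 4 + 1/2 * \<sigma>0"
  "t 3 5 = - 1/2 * N 1 3 4 - 1/2 * P 3 6 - 1/2 * S 3 5 + 1/2 * n 1"
  "t 3 6 = 1/2 * N 2 3 4 + 1/2 * P 3 5 - 1/2 * S 3 6 - 1/2 * n 2"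
  "t 4 1 = 1/2 * N 1 2 6 + 1/2 * P 1 3 + 1/2 * S 1 4 + 1/2 * n 6"
  "t 4 2 = 1/2 * N 1 2 5 - 1/2 * P 1 4 + 1/2 * S 1 3 + 1/2 * n 5"
  "t 4 3 = 1/2 * N 1 4 6 + 1/2 * N 2 4 5 + 1/2 * S 3 4 - 1/2 * \<sigma>0"
  "t 4 4 = - 1/2 * N 1 3 6 - 1/2 * N 2 3 5 - 1/2 * P 3 4 + 1/2 * \<pi>0"
  "t 4 5 = 1/2 * N 2 3 4 - 1/2 * P 3 5 + 1/2 * S 3 6 - 1/2 * n 2"
  "t 4 6 = 1/2 * N 1 3 4 - 1/2 * P 3 6 - 1/2 * S 3 5 - 1/2 * n 1"
  "t 5 1 = 1/2 * N 1 2 3 - 1/2 * P 1 6 + 1/2 * S 1 5 + 1/2 * n 3"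
  "t 5 2 = - 1/2 * N 1 2 4 - 1/2 * P 1 5 - 1/2 * S 1 6 - 1/2 * n 4"
  "t 5 3 = - 1/2 * N 1 3 4 - 1/2 * P 3 6 + 1/2 * S 3 5 - 1/2 * n 1"
  "t 5 4 = 1/2 * N 2 3 4 - 1/2 * P 3 5 - 1/2 * S 3 6 + 1/2 * n 2"
  "t 5 5 = 1/2 * N 1 4 5 + 1/2 * N 2 3 5 + 1/2 * P 1 2 + 1/2 * P 3 4 + 1/2 * \<pi>0"
  "t 5 6 = 1/2 * N 1 4 6 + 1/2 * N 2 3 6 + 1/2 * S 1 2 + 1/2 * S 3 4 + 1/2 * \<sigma>0"
  "t 6 1 = - 1/2 * N 1 2 4 + 1/2 * P 1 5 + 1/2 * S 1 6 - 1/2 * n 4"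
  "t 6 2 = - 1/2 * N 1 2 3 - 1/2 * P 1 6 + 1/2 * S 1 5 - 1/2 * n 3"
  "t 6 3 = 1/2 * N 2 3 4 + 1/2 * P 3 5 + 1/2 * S 3 6 + 1/2 * n 2"
  "t 6 4 = 1/2 * N 1 3 4 - 1/2 * P 3 6 + 1/2 * S 3 5 + 1/2 * n 1"
  "t 6 5 = 1/2 * N 1 4 6 + 1/2 * N 2 3 6 - 1/2 * S 1 2 - 1/2 * S 3 4 - 1/2 * \<sigma>0"
  "t 6 6 = - 1/2 * N 1 4 5 - 1/2 * N 2 3 5 + 1/2 * P 1 2 + 1/2 * P 3 4 + 1/2 * \<pi>0"
  "m 1 = - n 2 + p 2"
  "m 2 = n 1 - p 1"
  "m 3 = - n 4 + p 4"
  "m 4 = n 3 - p 3"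
  "m 5 = - n 6 + p 6"
  "m 6 = n 5 - p 5"
  using equations by linarith+

text \<open>By Schur's lemma \<open>V\<close> can only involve the one-forms among the torsion forms.\<close>

lemma torsion_vec_eq: "j \<in> {1..6} \<Longrightarrow> torsion_vec m t j = - (p j + n j)"
proof -
  have "\<forall>j\<in>{1..6}. torsion_vec m t j = - (p j + n j)"
    unfolding ball_1_6 torsion_vec_simps solved by simp
  then show "j \<in> {1..6} \<Longrightarrow> torsion_vec m t j = - (p j + n j)" by blast
qed

lemma torsion_quad_eq:
  "2 * torsion_quad m t = 15/2 * \<pi>0\<^sup>2 + 15/2 * \<sigma>0\<^sup>2
    - ((n 1)\<^sup>2 + (n 2)\<^sup>2 + (n 3)\<^sup>2 + (n 4)\<^sup>2 + (n 5)\<^sup>2 + (n 6)\<^sup>2)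
    - 1/2 * ((S 1 2)\<^sup>2 + (S 1 3)\<^sup>2 + (S 1 4)\<^sup>2 + (S 1 5)\<^sup>2 + (S 1 6)\<^sup>2 + (S 2 3)\<^sup>2
    + (S 2 4)\<^sup>2 + (S 2 5)\<^sup>2 + (S 2 6)\<^sup>2 + (S 3 4)\<^sup>2 + (S 3 5)\<^sup>2 + (S 3 6)\<^sup>2
    + (S 4 5)\<^sup>2 + (S 4 6)\<^sup>2 + (S 5 6)\<^sup>2)
    - 1/2 * ((P 1 2)\<^sup>2 + (P 1 3)\<^sup>2 + (P 1 4)\<^sup>2 + (P 1 5)\<^sup>2 + (P 1 6)\<^sup>2 + (P 2 3)\<^sup>2
    + (P 2 4)\<^sup>2 + (P 2 5)\<^sup>2 + (P 2 6)\<^sup>2 + (P 3 4)\<^sup>2 + (P 3 5)\<^sup>2 + (P 3 6)\<^sup>2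
    + (P 4 5)\<^sup>2 + (P 4 6)\<^sup>2 + (P 5 6)\<^sup>2)
    - 1/2 * ((N 1 2 3)\<^sup>2 + (N 1 2 4)\<^sup>2 + (N 1 2 5)\<^sup>2 + (N 1 2 6)\<^sup>2 + (N 1 3 4)\<^sup>2 + (N 1 3 5)\<^sup>2
    + (N 1 3 6)\<^sup>2 + (N 1 4 5)\<^sup>2 + (N 1 4 6)\<^sup>2 + (N 1 5 6)\<^sup>2 + (N 2 3 4)\<^sup>2 + (N 2 3 5)\<^sup>2
    + (N 2 3 6)\<^sup>2 + (N 2 4 5)\<^sup>2 + (N 2 4 6)\<^sup>2 + (N 2 5 6)\<^sup>2 + (N 3 4 5)\<^sup>2 + (N 3 4 6)\<^sup>2
    + (N 3 5 6)\<^sup>2 + (N 4 5 6)\<^sup>2)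
    + 4 * (p 1 * n 1 + p 2 * n 2 + p 3 * n 3 + p 4 * n 4 + p 5 * n 5 + p 6 * n 6)"
  unfolding torsion_quad_def solved dependent by algebra

end

section \<open>The structure equations of an adapted frame\<close>

lemma ext_deriv_list:
  assumes "length l = Suc r"
  shows "ext_deriv r \<omega> x ((!) l) = (\<Sum>i\<le>r. (-1) ^ i * dd (\<lambda>y. \<omega> y ((!) (take i l @ drop (Suc i) l))) x (l ! i))"
proof -
  have "(\<lambda>j. if j < i then l ! j else l ! Suc j) = (!) (take i l @ drop (Suc i) l)" if "i \<le> r" for i
    using that assms by (auto simp: fun_eq_iff nth_append)
  then show ?thesis unfolding ext_deriv_def by simp
qed

lemma ext_deriv_2:
  "ext_deriv 2 \<omega> x ((!) [a, b, c]) = dd (\<lambda>y. \<omega> y ((!) [b, c])) x a - dd (\<lambda>y. \<omega> y ((!) [a, c])) x b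
    + dd (\<lambda>y. \<omega> y ((!) [a, b])) x c"
  by (subst ext_deriv_list) (simp_all add: numeral_2_eq_2)

lemma ext_deriv_3:
  "ext_deriv 3 \<omega> x ((!) [a, b, c, d]) = dd (\<lambda>y. \<omega> y ((!) [b, c, d])) x a - dd (\<lambda>y. \<omega> y ((!) [a, c, d])) x b
    + dd (\<lambda>y. \<omega> y ((!) [a, b, d])) x c - dd (\<lambda>y. \<omega> y ((!) [a, b, c])) x d"
  by (subst ext_deriv_list) (simp_all add: numeral_3_eq_3)

text \<open>The values of \<open>a \<and> b \<and> c\<close> for three covectors.\<close>

definition covol3 :: "('v \<Rightarrow> real) \<Rightarrow> ('v \<Rightarrow> real) \<Rightarrow> ('v \<Rightarrow> real) \<Rightarrow> 'v \<Rightarrow> 'v \<Rightarrow> 'v \<Rightarrow> real" where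
  "covol3 a b c u v w = a u * (b v * c w - b w * c v) - a v * (b u * c w - b w * c u) + a w * (b u * c v - b v * c u)"

lemma cowedge_3_covol3:
  "linear (e i) \<Longrightarrow> linear (e j) \<Longrightarrow> linear (e k) \<Longrightarrow> cowedge e [i, j, k] ((!) [u, v, w]) = covol3 (e i) (e j) (e k) u v w"
  unfolding covol3_def by (subst cowedge_3) simp_all

context SU3_frame
begin

lemma kappa_list: "\<kappa> ((!) [u, v]) = (e 1 u * e 2 v - e 1 v * e 2 u) + (e 3 u * e 4 v - e 3 v * e 4 u) + (e 5 u * e 6 v - e 5 v * e 6 u)"
  by (simp add: kappa del: One_nat_def)

lemma Omega_list: "\<Omega> ((!) [u, v, w]) = covol3 (e 1) (e 3) (e 5) u v w - covol3 (e 1) (e 4) (e 6) u v w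
    - covol3 (e 2) (e 4) (e 5) u v w - covol3 (e 2) (e 3) (e 6) u v w"
  unfolding Omega by (simp add: cowedge_3_covol3 lin del: cowedge.simps One_nat_def)

lemma JOmega_list: "form_J \<kappa> \<Omega> \<Omega> ((!) [u, v, w]) = covol3 (e 1) (e 3) (e 6) u v w + covol3 (e 1) (e 4) (e 5) u v w
    + covol3 (e 2) (e 3) (e 5) u v w - covol3 (e 2) (e 4) (e 6) u v w"
  unfolding form_J_def su3_J_eq covol3_def by (simp add: Omega_explicit del: One_nat_def) algebra

lemma J_frame: "J (E 1) = E 2" "J (E 2) = - E 1" "J (E 3) = E 4" "J (E 4) = - E 3" "J (E 5) = E 6" "J (E 6) = - E 5"
  by (simp_all add: J_def del: One_nat_def)

lemma form_J_1: "alt_form 1 \<alpha> \<Longrightarrow> form_J \<kappa> \<Omega> \<alpha> ((!) [u]) = \<alpha> ((!) [J u])"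
  unfolding form_J_def su3_J_eq by (subst alt_form_args(2)) simp_all

lemma form_J_2: "alt_form 2 \<alpha> \<Longrightarrow> form_J \<kappa> \<Omega> \<alpha> ((!) [u, v]) = \<alpha> ((!) [J u, J v])"
  unfolding form_J_def su3_J_eq by (subst alt_form_args(3)) simp_all

lemma alt_form_J_1:
  assumes "alt_form 1 \<alpha>" shows "alt_form 1 (form_J \<kappa> \<Omega> \<alpha>)"
proof -
  have eq: "form_J \<kappa> \<Omega> \<alpha> = (\<lambda>v. \<alpha> ((!) [J (v 0)]))"
    unfolding form_J_def su3_J_eq by (rule ext, subst alt_form_args(2)[OF assms]) simp
  have l: "linear (\<lambda>u. \<alpha> ((!) [u]))"
  proof -
    have "((!) [0::real^6])(0 := u) = (!) [u]" for u :: "real^6"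
      by (auto simp: fun_eq_iff nth_Cons split: nat.split)
    then show ?thesis using alt_form_linear[OF assms, of 0 "(!) [0]"] by simp
  qed
  have "linear J"
    unfolding J_def by (rule linearI) (simp_all add: e_add e_scaleR algebra_simps del: One_nat_def)
  then have "linear (\<lambda>u. \<alpha> ((!) [J u]))" using linear_compose[OF _ l, of J] by (simp add: o_def)
  then show ?thesis unfolding eq by (rule alt_form_1I)
qed

end

lemma alt_form_1_minus: "alt_form 1 \<alpha> \<Longrightarrow> \<alpha> ((!) [- u]) = - \<alpha> ((!) [u])"
proof -
  assume a: "alt_form 1 \<alpha>"
  have "((!) [u])(0 := x) = (!) [x]" for x by (auto simp: fun_eq_iff nth_Cons split: nat.split)
  then show ?thesis using linear_neg[OF alt_form_linear[OF a, of 0 "(!) [u]"], of u] by simp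
qed

lemma alt_form_2_minus:
  assumes a: "alt_form 2 \<alpha>"
  shows "\<alpha> ((!) [- u, v]) = - \<alpha> ((!) [u, v])" "\<alpha> ((!) [u, - v]) = - \<alpha> ((!) [u, v])"
proof -
  have "((!) [u, v])(0 := x) = (!) [x, v]" "((!) [u, v])(Suc 0 := x) = (!) [u, x]" for x
    by (auto simp: fun_eq_iff nth_Cons split: nat.split)
  then show "\<alpha> ((!) [- u, v]) = - \<alpha> ((!) [u, v])" "\<alpha> ((!) [u, - v]) = - \<alpha> ((!) [u, v])"
    using linear_neg[OF alt_form_linear[OF a, of 0 "(!) [u, v]"], of u]
      linear_neg[OF alt_form_linear[OF a, of 1 "(!) [u, v]"], of v] by simp_all
qed

text \<open>A smooth adapted frame over an open part \<open>U\<close> of a coordinate domain. It is orthonormal, which makes the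
  apparatus of moving frames available.\<close>

locale su3_chart = su3_region S \<kappa> \<Omega> for S \<kappa> \<Omega> +
  fixes U :: "(real^6) set" and E :: "real^6 \<Rightarrow> nat \<Rightarrow> real^6"
  assumes U: "open U" "U \<subseteq> S"
    and adapted_E: "\<And>y. y \<in> U \<Longrightarrow> adapted_frame (\<kappa> y) (\<Omega> y) (\<lambda>i. met y (E y i)) (E y)"
    and Ck_E: "\<And>k i l. i \<in> {1..6} \<Longrightarrow> Ck_on k U (\<lambda>y. E y i $ l)"
begin

abbreviation "e y i \<equiv> met y (E y i)"

lemma SU3: "y \<in> U \<Longrightarrow> SU3_frame (\<kappa> y) (\<Omega> y) (e y) (E y)"
  by (simp add: SU3_frame_def adapted_E)

lemma moving_frame: "moving_frame U e E met"
  unfolding moving_frame_def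
proof (intro conjI allI impI)
  show "open U" by (rule U(1))
  show "linear (e y a)" if "y \<in> U" "a \<in> {1..6}" for y a
    by (rule SU3_frame.lin[OF SU3[OF that(1)] that(2)])
  show "e y a (E y b) = (if a = b then 1 else 0)" if "y \<in> U" "a \<in> {1..6}" "b \<in> {1..6}" for y a b
    by (rule SU3_frame.dual[OF SU3[OF that(1)] that(2,3)])
  show "u = (\<Sum>a=1..6. e y a u *\<^sub>R E y a)" if "y \<in> U" for y u
    by (rule SU3_frame.expand[OF SU3[OF that]])
  show "met y u w = (\<Sum>a=1..6. e y a u * e y a w)" if "y \<in> U" for y u w
    by (rule trans[OF SU3_frame.su3_metric_eq[OF SU3[OF that]] SU3_frame.g_def[OF SU3[OF that]]])
  show "smooth_on U (\<lambda>y. e y a u)" if "a \<in> {1..6}" for a u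
    unfolding smooth_on_def using Ck_metric[OF U Ck_E[OF that] Ck_on_const] by blast
  show "smooth_on U (\<lambda>y. E y a $ l)" if "a \<in> {1..6}" for a l
    unfolding smooth_on_def by (intro allI Ck_E[OF that])
  show "met y u w = met y w u" for y u w unfolding su3_metric_def by (simp add: mult.commute)
qed

sublocale moving_frame U e E met by (rule moving_frame)

text \<open>The components \<open>\<omega>(\<kappa>)\<close> and \<open>\<omega>(\<iota>\<^sub>k\<Omega>)\<close> of the connection along the frame vectors, with a filler for \<open>k = 0\<close>.\<close>

definition mu where "mu y i = \<omega> y (E y i) 1 2 + \<omega> y (E y i) 3 4 + \<omega> y (E y i) 5 6"

definition tors where "tors y k i = [0, \<omega> y (E y i) 3 5 - \<omega> y (E y i) 4 6, - \<omega> y (E y i) 3 6 - \<omega> y (E y i) 4 5, - \<omega> y (E y i) 1 5 + \<omega> y (E y i) 2 6, \<omega> y (E y i) 1 6 + \<omega> y (E y i) 2 5, \<omega> y (E y i) 1 3 - \<omega> y (E y i) 2 4, - \<omega> y (E y i) 1 4 - \<omega> y (E y i) 2 3] ! k"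

abbreviation "JOmega y \<equiv> form_J (\<kappa> y) (\<Omega> y) (\<Omega> y)"

lemma differentiable_e: "y \<in> U \<Longrightarrow> a \<in> {1..6} \<Longrightarrow> (\<lambda>z. e z a v) differentiable (at y)"
  by (rule smooth_on_differentiable[OF smooth_e])

lemma dd_covol2:
  assumes y: "y \<in> U" and ab: "a \<in> {1..6}" "b \<in> {1..6}"
  shows "dd (\<lambda>z. e z a v * e z b w - e z a w * e z b v) y u =
    (De y a u v * e y b w + e y a v * De y b u w) - (De y a u w * e y b v + e y a w * De y b u v)"
proof -
  note d = differentiable_e[OF y ab(1)] differentiable_e[OF y ab(2)]
  show ?thesis
    unfolding De_def
    by (simp add: dd_diff dd_mult differentiable_mult d)
qed

lemma dd_covol3:
  assumes y: "y \<in> U" and abc: "a \<in> {1..6}" "b \<in> {1..6}" "c \<in> {1..6}"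
  shows "dd (\<lambda>z. covol3 (e z a) (e z b) (e z c) v w x) y u =
    covol3 (De y a u) (e y b) (e y c) v w x + covol3 (e y a) (De y b u) (e y c) v w x
    + covol3 (e y a) (e y b) (De y c u) v w x"
proof -
  note d = differentiable_e[OF y abc(1)] differentiable_e[OF y abc(2)] differentiable_e[OF y abc(3)]
  show ?thesis
    unfolding De_def covol3_def
    by (simp add: dd_add dd_diff dd_mult differentiable_mult differentiable_add differentiable_diff d algebra_simps)
qed

lemma differentiable_covol2:
  "y \<in> U \<Longrightarrow> a \<in> {1..6} \<Longrightarrow> b \<in> {1..6} \<Longrightarrow> (\<lambda>z. e z a v * e z b w - e z a w * e z b v) differentiable (at y)"
  by (intro differentiable_diff differentiable_mult differentiable_e)

lemma differentiable_covol3: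
  "y \<in> U \<Longrightarrow> a \<in> {1..6} \<Longrightarrow> b \<in> {1..6} \<Longrightarrow> c \<in> {1..6} \<Longrightarrow> (\<lambda>z. covol3 (e z a) (e z b) (e z c) v w x) differentiable (at y)"
  unfolding covol3_def by (intro differentiable_diff differentiable_add differentiable_mult differentiable_e)

lemma dd_local:
  fixes f :: "real^6 \<Rightarrow> real"
  assumes "y \<in> U" "\<And>z. z \<in> U \<Longrightarrow> f z = h z" "h differentiable (at y)"
  shows "dd f y u = dd h y u"
  using frechet_derivative_transform_within_open[OF assms(3) U(1) assms(1), of f] assms(2) by simp

lemma dd_kappa:
  assumes y: "y \<in> U"
  shows "dd (\<lambda>z. \<kappa> z ((!) [v, w])) y u =
    (De y 1 u v * e y 2 w + e y 1 v * De y 2 u w) - (De y 1 u w * e y 2 v + e y 1 w * De y 2 u v)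
    + ((De y 3 u v * e y 4 w + e y 3 v * De y 4 u w) - (De y 3 u w * e y 4 v + e y 3 w * De y 4 u v))
    + ((De y 5 u v * e y 6 w + e y 5 v * De y 6 u w) - (De y 5 u w * e y 6 v + e y 5 w * De y 6 u v))"
proof -
  note c = differentiable_covol2[OF y, of 1 2 v w] differentiable_covol2[OF y, of 3 4 v w] differentiable_covol2[OF y, of 5 6 v w]
  have "dd (\<lambda>z. \<kappa> z ((!) [v, w])) y u = dd (\<lambda>z. (e z 1 v * e z 2 w - e z 1 w * e z 2 v)
      + (e z 3 v * e z 4 w - e z 3 w * e z 4 v) + (e z 5 v * e z 6 w - e z 5 w * e z 6 v)) y u"
    by (rule dd_local[OF y], simp add: SU3_frame.kappa_list[OF SU3] del: One_nat_def)
      (intro differentiable_add c; simp)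
  then show ?thesis
    using dd_add[OF differentiable_add[OF c(1,2)] c(3)] dd_add[OF c(1,2)]
      dd_covol2[OF y, of 1 2 v w u] dd_covol2[OF y, of 3 4 v w u] dd_covol2[OF y, of 5 6 v w u] by simp
qed

text \<open>\<open>\<Omega>\<close> and \<open>J\<Omega>\<close> are both combinations of four decomposable forms with constant coefficients.\<close>

lemma dd_four_covol3:
  fixes u :: "real^6"
  assumes y: "y \<in> U" and I: "a \<in> {1..6}" "b \<in> {1..6}" "c \<in> {1..6}" "a' \<in> {1..6}" "b' \<in> {1..6}" "c' \<in> {1..6}"
      "a2 \<in> {1..6}" "b2 \<in> {1..6}" "c2 \<in> {1..6}" "a3 \<in> {1..6}" "b3 \<in> {1..6}" "c3 \<in> {1..6}"
    and f: "\<And>z. z \<in> U \<Longrightarrow> f z = r * covol3 (e z a) (e z b) (e z c) v w x + r' * covol3 (e z a') (e z b') (e z c') v w x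
      + r2 * covol3 (e z a2) (e z b2) (e z c2) v w x + r3 * covol3 (e z a3) (e z b3) (e z c3) v w x"
  defines "T \<equiv> \<lambda>a b c. covol3 (De y a u) (e y b) (e y c) v w x + covol3 (e y a) (De y b u) (e y c) v w x
    + covol3 (e y a) (e y b) (De y c u) v w x"
  shows "dd f y u = r * T a b c + r' * T a' b' c' + r2 * T a2 b2 c2 + r3 * T a3 b3 c3"
proof -
  note d = differentiable_covol3[OF y I(1-3), of v w x] differentiable_covol3[OF y I(4-6), of v w x]
    differentiable_covol3[OF y I(7-9), of v w x] differentiable_covol3[OF y I(10-12), of v w x]
  have "dd f y u = dd (\<lambda>z. r * covol3 (e z a) (e z b) (e z c) v w x + r' * covol3 (e z a') (e z b') (e z c') v w x
      + r2 * covol3 (e z a2) (e z b2) (e z c2) v w x + r3 * covol3 (e z a3) (e z b3) (e z c3) v w x) y u"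
    by (rule dd_local[OF y f], assumption) (intro differentiable_add differentiable_mult differentiable_const d)
  also have "\<dots> = r * T a b c + r' * T a' b' c' + r2 * T a2 b2 c2 + r3 * T a3 b3 c3"
    unfolding T_def dd_covol3[OF y I(1-3), symmetric] dd_covol3[OF y I(4-6), symmetric]
      dd_covol3[OF y I(7-9), symmetric] dd_covol3[OF y I(10-12), symmetric]
    by (rule frechet_derivative_eqI) (intro has_derivative_add has_derivative_mult_right has_frechet_derivative d)
  finally show ?thesis .
qed

text \<open>On the frame itself the derivatives of the coframe are Christoffel symbols, which are symmetric and
  cancel in exterior derivatives, minus connection coefficients.\<close>

definition sym where "sym y a i j = \<gamma> y a (E y i) (E y j)"

lemma De_frame: "De y a (E y i) (E y j) = sym y a i j - \<omega> y (E y i) a j"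
  by (simp add: sym_def \<omega>_def)

lemma sym_swap:
  "sym y a 2 1 = sym y a 1 2" "sym y a 3 1 = sym y a 1 3" "sym y a 4 1 = sym y a 1 4" "sym y a 5 1 = sym y a 1 5"
  "sym y a 6 1 = sym y a 1 6" "sym y a 3 2 = sym y a 2 3" "sym y a 4 2 = sym y a 2 4" "sym y a 5 2 = sym y a 2 5"
  "sym y a 6 2 = sym y a 2 6" "sym y a 4 3 = sym y a 3 4" "sym y a 5 3 = sym y a 3 5" "sym y a 6 3 = sym y a 3 6"
  "sym y a 5 4 = sym y a 4 5" "sym y a 6 4 = sym y a 4 6" "sym y a 6 5 = sym y a 5 6"
  unfolding sym_def by (rule \<gamma>_sym)+

lemma \<omega>_swap:
  assumes y: "y \<in> U"
  shows "\<omega> y u 2 1 = - \<omega> y u 1 2" "\<omega> y u 3 1 = - \<omega> y u 1 3" "\<omega> y u 4 1 = - \<omega> y u 1 4" "\<omega> y u 5 1 = - \<omega> y u 1 5"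
  "\<omega> y u 6 1 = - \<omega> y u 1 6" "\<omega> y u 3 2 = - \<omega> y u 2 3" "\<omega> y u 4 2 = - \<omega> y u 2 4" "\<omega> y u 5 2 = - \<omega> y u 2 5"
  "\<omega> y u 6 2 = - \<omega> y u 2 6" "\<omega> y u 4 3 = - \<omega> y u 3 4" "\<omega> y u 5 3 = - \<omega> y u 3 5" "\<omega> y u 6 3 = - \<omega> y u 3 6"
  "\<omega> y u 5 4 = - \<omega> y u 4 5" "\<omega> y u 6 4 = - \<omega> y u 4 6" "\<omega> y u 6 5 = - \<omega> y u 5 6"
  by (rule \<omega>_antisym[OF y]; simp)+

lemma \<omega>_diag: "y \<in> U \<Longrightarrow> a \<in> {1..6} \<Longrightarrow> \<omega> y u a a = 0"
  using \<omega>_antisym[of y a a u] by simp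

lemma \<omega>_diag_simps:
  "y \<in> U \<Longrightarrow> \<omega> y u 1 1 = 0" "y \<in> U \<Longrightarrow> \<omega> y u 2 2 = 0" "y \<in> U \<Longrightarrow> \<omega> y u 3 3 = 0"
  "y \<in> U \<Longrightarrow> \<omega> y u 4 4 = 0" "y \<in> U \<Longrightarrow> \<omega> y u 5 5 = 0" "y \<in> U \<Longrightarrow> \<omega> y u 6 6 = 0"
  by (simp_all add: \<omega>_diag)

lemma tors_simps:
  "tors y 1 i = \<omega> y (E y i) 3 5 - \<omega> y (E y i) 4 6"
  "tors y 2 i = - \<omega> y (E y i) 3 6 - \<omega> y (E y i) 4 5"
  "tors y 3 i = - \<omega> y (E y i) 1 5 + \<omega> y (E y i) 2 6"
  "tors y 4 i = \<omega> y (E y i) 1 6 + \<omega> y (E y i) 2 5"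
  "tors y 5 i = \<omega> y (E y i) 1 3 - \<omega> y (E y i) 2 4"
  "tors y 6 i = - \<omega> y (E y i) 1 4 - \<omega> y (E y i) 2 3"
  by (simp_all add: tors_def)

text \<open>Since \<open>SU(3)\<close> fixes \<open>\<kappa>\<close>, \<open>\<Omega>\<close> and \<open>J\<Omega>\<close>, their exterior derivatives depend only on the part of the connection
  that is orthogonal to \<open>su(3)\<close>, and linearly so.\<close>

lemma ext_deriv_kappa:
  assumes y: "y \<in> U"
  shows "ext_deriv 2 \<kappa> y ((!) [E y 1, E y 2, E y 3]) = tors y 5 1 - tors y 6 2"
    "ext_deriv 2 \<kappa> y ((!) [E y 1, E y 2, E y 4]) = - tors y 5 2 - tors y 6 1"
    "ext_deriv 2 \<kappa> y ((!) [E y 1, E y 2, E y 5]) = - tors y 3 1 + tors y 4 2"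
    "ext_deriv 2 \<kappa> y ((!) [E y 1, E y 2, E y 6]) = tors y 3 2 + tors y 4 1"
    "ext_deriv 2 \<kappa> y ((!) [E y 1, E y 3, E y 4]) = - tors y 5 3 + tors y 6 4"
    "ext_deriv 2 \<kappa> y ((!) [E y 1, E y 3, E y 5]) = tors y 2 1 + tors y 4 3 + tors y 6 5"
    "ext_deriv 2 \<kappa> y ((!) [E y 1, E y 3, E y 6]) = tors y 1 1 + tors y 3 3 + tors y 6 6"
    "ext_deriv 2 \<kappa> y ((!) [E y 1, E y 4, E y 5]) = tors y 1 1 + tors y 4 4 + tors y 5 5"
    "ext_deriv 2 \<kappa> y ((!) [E y 1, E y 4, E y 6]) = - tors y 2 1 + tors y 3 4 + tors y 5 6"
    "ext_deriv 2 \<kappa> y ((!) [E y 1, E y 5, E y 6]) = tors y 3 5 - tors y 4 6"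
    "ext_deriv 2 \<kappa> y ((!) [E y 2, E y 3, E y 4]) = tors y 5 4 + tors y 6 3"
    "ext_deriv 2 \<kappa> y ((!) [E y 2, E y 3, E y 5]) = tors y 2 2 + tors y 3 3 + tors y 5 5"
    "ext_deriv 2 \<kappa> y ((!) [E y 2, E y 3, E y 6]) = tors y 1 2 - tors y 4 3 + tors y 5 6"
    "ext_deriv 2 \<kappa> y ((!) [E y 2, E y 4, E y 5]) = tors y 1 2 + tors y 3 4 - tors y 6 5"
    "ext_deriv 2 \<kappa> y ((!) [E y 2, E y 4, E y 6]) = - tors y 2 2 - tors y 4 4 - tors y 6 6"
    "ext_deriv 2 \<kappa> y ((!) [E y 2, E y 5, E y 6]) = - tors y 3 6 - tors y 4 5"
    "ext_deriv 2 \<kappa> y ((!) [E y 3, E y 4, E y 5]) = tors y 1 3 - tors y 2 4"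
    "ext_deriv 2 \<kappa> y ((!) [E y 3, E y 4, E y 6]) = - tors y 1 4 - tors y 2 3"
    "ext_deriv 2 \<kappa> y ((!) [E y 3, E y 5, E y 6]) = - tors y 1 5 + tors y 2 6"
    "ext_deriv 2 \<kappa> y ((!) [E y 4, E y 5, E y 6]) = tors y 1 6 + tors y 2 5"
  unfolding ext_deriv_2 dd_kappa[OF y] SU3_frame.dual_explicit[OF SU3[OF y]] De_frame sym_swap \<omega>_swap[OF y] \<omega>_diag_simps[OF y] tors_simps mu_def
  by simp_all

lemma dd_Omega:
  assumes y: "y \<in> U"
  shows "dd (\<lambda>z. \<Omega> z ((!) [v, w, x])) y u =
      (covol3 (De y 1 u) (e y 3) (e y 5) v w x + covol3 (e y 1) (De y 3 u) (e y 5) v w x + covol3 (e y 1) (e y 3) (De y 5 u) v w x)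
      - (covol3 (De y 1 u) (e y 4) (e y 6) v w x + covol3 (e y 1) (De y 4 u) (e y 6) v w x + covol3 (e y 1) (e y 4) (De y 6 u) v w x)
      - (covol3 (De y 2 u) (e y 4) (e y 5) v w x + covol3 (e y 2) (De y 4 u) (e y 5) v w x + covol3 (e y 2) (e y 4) (De y 5 u) v w x)
      - (covol3 (De y 2 u) (e y 3) (e y 6) v w x + covol3 (e y 2) (De y 3 u) (e y 6) v w x + covol3 (e y 2) (e y 3) (De y 6 u) v w x)"
  by (subst dd_four_covol3[of _ 1 3 5 1 4 6 2 4 5 2 3 6 "\<lambda>z. \<Omega> z ((!) [v, w, x])" 1 v w x "-1" "-1" "-1", OF y]) (simp_all add: SU3_frame.Omega_list[OF SU3] del: One_nat_def)

lemma ext_deriv_Omega: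
  assumes y: "y \<in> U"
  shows "ext_deriv 3 \<Omega> y ((!) [E y 1, E y 2, E y 3, E y 4]) = tors y 1 1 + tors y 2 2 + tors y 3 3 + tors y 4 4"
    "ext_deriv 3 \<Omega> y ((!) [E y 1, E y 2, E y 3, E y 5]) = - mu y 1 + tors y 4 5 - tors y 6 3"
    "ext_deriv 3 \<Omega> y ((!) [E y 1, E y 2, E y 3, E y 6]) = mu y 2 + tors y 4 6 + tors y 5 3"
    "ext_deriv 3 \<Omega> y ((!) [E y 1, E y 2, E y 4, E y 5]) = mu y 2 - tors y 3 5 - tors y 6 4"
    "ext_deriv 3 \<Omega> y ((!) [E y 1, E y 2, E y 4, E y 6]) = mu y 1 - tors y 3 6 + tors y 5 4"
    "ext_deriv 3 \<Omega> y ((!) [E y 1, E y 2, E y 5, E y 6]) = tors y 1 1 + tors y 2 2 + tors y 5 5 + tors y 6 6"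
    "ext_deriv 3 \<Omega> y ((!) [E y 1, E y 3, E y 4, E y 5]) = mu y 3 + tors y 2 5 - tors y 6 1"
    "ext_deriv 3 \<Omega> y ((!) [E y 1, E y 3, E y 4, E y 6]) = - mu y 4 + tors y 2 6 + tors y 5 1"
    "ext_deriv 3 \<Omega> y ((!) [E y 1, E y 3, E y 5, E y 6]) = - mu y 5 + tors y 2 3 - tors y 4 1"
    "ext_deriv 3 \<Omega> y ((!) [E y 1, E y 4, E y 5, E y 6]) = mu y 6 + tors y 2 4 + tors y 3 1"
    "ext_deriv 3 \<Omega> y ((!) [E y 2, E y 3, E y 4, E y 5]) = - mu y 4 - tors y 1 5 - tors y 6 2"
    "ext_deriv 3 \<Omega> y ((!) [E y 2, E y 3, E y 4, E y 6]) = - mu y 3 - tors y 1 6 + tors y 5 2"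
    "ext_deriv 3 \<Omega> y ((!) [E y 2, E y 3, E y 5, E y 6]) = mu y 6 - tors y 1 3 - tors y 4 2"
    "ext_deriv 3 \<Omega> y ((!) [E y 2, E y 4, E y 5, E y 6]) = mu y 5 - tors y 1 4 + tors y 3 2"
    "ext_deriv 3 \<Omega> y ((!) [E y 3, E y 4, E y 5, E y 6]) = tors y 3 3 + tors y 4 4 + tors y 5 5 + tors y 6 6"
  unfolding ext_deriv_3 dd_Omega[OF y] covol3_def SU3_frame.dual_explicit[OF SU3[OF y]] De_frame sym_swap \<omega>_swap[OF y] \<omega>_diag_simps[OF y] tors_simps mu_def
  by simp_all

lemma dd_JOmega:
  assumes y: "y \<in> U"
  shows "dd (\<lambda>z. JOmega z ((!) [v, w, x])) y u =
      (covol3 (De y 1 u) (e y 3) (e y 6) v w x + covol3 (e y 1) (De y 3 u) (e y 6) v w x + covol3 (e y 1) (e y 3) (De y 6 u) v w x)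
      + (covol3 (De y 1 u) (e y 4) (e y 5) v w x + covol3 (e y 1) (De y 4 u) (e y 5) v w x + covol3 (e y 1) (e y 4) (De y 5 u) v w x)
      + (covol3 (De y 2 u) (e y 3) (e y 5) v w x + covol3 (e y 2) (De y 3 u) (e y 5) v w x + covol3 (e y 2) (e y 3) (De y 5 u) v w x)
      - (covol3 (De y 2 u) (e y 4) (e y 6) v w x + covol3 (e y 2) (De y 4 u) (e y 6) v w x + covol3 (e y 2) (e y 4) (De y 6 u) v w x)"
  by (subst dd_four_covol3[of _ 1 3 6 1 4 5 2 3 5 2 4 6 "\<lambda>z. JOmega z ((!) [v, w, x])" 1 v w x 1 1 "-1", OF y]) (simp_all add: SU3_frame.JOmega_list[OF SU3] del: One_nat_def)

lemma ext_deriv_JOmega: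
  assumes y: "y \<in> U"
  shows "ext_deriv 3 JOmega y ((!) [E y 1, E y 2, E y 3, E y 4]) = tors y 1 2 - tors y 2 1 + tors y 3 4 - tors y 4 3"
    "ext_deriv 3 JOmega y ((!) [E y 1, E y 2, E y 3, E y 5]) = - mu y 2 + tors y 3 5 - tors y 5 3"
    "ext_deriv 3 JOmega y ((!) [E y 1, E y 2, E y 3, E y 6]) = - mu y 1 + tors y 3 6 - tors y 6 3"
    "ext_deriv 3 JOmega y ((!) [E y 1, E y 2, E y 4, E y 5]) = - mu y 1 + tors y 4 5 - tors y 5 4"
    "ext_deriv 3 JOmega y ((!) [E y 1, E y 2, E y 4, E y 6]) = mu y 2 + tors y 4 6 - tors y 6 4"
    "ext_deriv 3 JOmega y ((!) [E y 1, E y 2, E y 5, E y 6]) = tors y 1 2 - tors y 2 1 + tors y 5 6 - tors y 6 5"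
    "ext_deriv 3 JOmega y ((!) [E y 1, E y 3, E y 4, E y 5]) = mu y 4 + tors y 1 5 - tors y 5 1"
    "ext_deriv 3 JOmega y ((!) [E y 1, E y 3, E y 4, E y 6]) = mu y 3 + tors y 1 6 - tors y 6 1"
    "ext_deriv 3 JOmega y ((!) [E y 1, E y 3, E y 5, E y 6]) = - mu y 6 + tors y 1 3 - tors y 3 1"
    "ext_deriv 3 JOmega y ((!) [E y 1, E y 4, E y 5, E y 6]) = - mu y 5 + tors y 1 4 - tors y 4 1"
    "ext_deriv 3 JOmega y ((!) [E y 2, E y 3, E y 4, E y 5]) = mu y 3 + tors y 2 5 - tors y 5 2"
    "ext_deriv 3 JOmega y ((!) [E y 2, E y 3, E y 4, E y 6]) = - mu y 4 + tors y 2 6 - tors y 6 2"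
    "ext_deriv 3 JOmega y ((!) [E y 2, E y 3, E y 5, E y 6]) = - mu y 5 + tors y 2 3 - tors y 3 2"
    "ext_deriv 3 JOmega y ((!) [E y 2, E y 4, E y 5, E y 6]) = mu y 6 + tors y 2 4 - tors y 4 2"
    "ext_deriv 3 JOmega y ((!) [E y 3, E y 4, E y 5, E y 6]) = tors y 3 4 - tors y 4 3 + tors y 5 6 - tors y 6 5"
  unfolding ext_deriv_3 dd_JOmega[OF y] covol3_def SU3_frame.dual_explicit[OF SU3[OF y]] De_frame sym_swap \<omega>_swap[OF y] \<omega>_diag_simps[OF y] tors_simps mu_def
  by simp_all

end

section \<open>The torsion forms in an adapted frame\<close>

lemma (in SU3_frame) alt_form_J_Omega: "alt_form 3 (form_J \<kappa> \<Omega> \<Omega>)"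
proof -
  have lin_J: "linear J"
    unfolding J_def by (rule linearI) (simp_all add: e_add e_scaleR algebra_simps del: One_nat_def)
  have upd: "(\<lambda>i. J ((v(j := u)) i)) = (\<lambda>i. J (v i))(j := J u)" for v :: "nat \<Rightarrow> real^6" and j u
    by (auto simp: fun_eq_iff)
  show ?thesis
    unfolding alt_form_def form_J_def su3_J_eq upd
  proof (intro conjI allI impI; (elim conjE)?)
    fix v w :: "nat \<Rightarrow> real^6" assume "\<forall>i<3. v i = w i"
    then show "\<Omega> (\<lambda>i. J (v i)) = \<Omega> (\<lambda>i. J (w i))" by (intro alt_form_cong[OF alt_Omega]) simp
  next
    fix v :: "nat \<Rightarrow> real^6" and i :: nat assume "i < 3"
    from linear_compose[OF lin_J alt_form_linear[OF alt_Omega this, of "\<lambda>i. J (v i)"]]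
    show "linear (\<lambda>u. \<Omega> ((\<lambda>i. J (v i))(i := J u)))" by (simp add: o_def)
  next
    fix v :: "nat \<Rightarrow> real^6" and i j :: nat assume "i < 3" "j < 3" "i \<noteq> j" "v i = v j"
    then show "\<Omega> (\<lambda>i. J (v i)) = 0" by (intro alt_form_eq_args[OF alt_Omega, of i j]) simp_all
  qed
qed

context su3_chart
begin

text \<open>Up to a rearrangement, every equation of the locale is the value on frame vectors of one of the equations
  between forms; \<open>\<kappa>\<close>, \<open>\<Omega>\<close> and \<open>J\<Omega>\<close> only take the values 0, 1 and -1 there.\<close>

lemma torsion_equations_at:
  fixes p0 s0 :: real
  assumes y: "y \<in> U"
    and p1: "alt_form 1 \<pi>1" and n1: "alt_form 1 \<nu>1" and a2: "alt_form 2 \<pi>2" and s2: "alt_form 2 \<sigma>2" and n3: "alt_form 3 \<nu>3"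
    and dK: "\<And>v. ext_deriv 2 \<kappa> y v = - 3/2 * s0 * \<Omega> y v + 3/2 * p0 * JOmega y v + wedge 1 2 \<nu>1 (\<kappa> y) v + \<nu>3 v"
    and dO: "\<And>v. ext_deriv 3 \<Omega> y v = p0 * wedge 2 2 (\<kappa> y) (\<kappa> y) v + wedge 1 3 \<pi>1 (\<Omega> y) v - wedge 2 2 \<pi>2 (\<kappa> y) v"
    and dJ: "\<And>v. ext_deriv 3 JOmega y v = s0 * wedge 2 2 (\<kappa> y) (\<kappa> y) v
        + wedge 1 3 (form_J (\<kappa> y) (\<Omega> y) \<pi>1) (\<Omega> y) v - wedge 2 2 \<sigma>2 (\<kappa> y) v"
    and a2J: "form_J (\<kappa> y) (\<Omega> y) \<pi>2 = \<pi>2" and a2K: "wedge 2 4 \<pi>2 (wedge 2 2 (\<kappa> y) (\<kappa> y)) = (\<lambda>_. 0)"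
    and s2J: "form_J (\<kappa> y) (\<Omega> y) \<sigma>2 = \<sigma>2" and s2K: "wedge 2 4 \<sigma>2 (wedge 2 2 (\<kappa> y) (\<kappa> y)) = (\<lambda>_. 0)"
    and n3K: "wedge 3 2 \<nu>3 (\<kappa> y) = (\<lambda>_. 0)" and n3O: "wedge 3 3 \<nu>3 (\<Omega> y) = (\<lambda>_. 0)"
    and n3J: "wedge 3 3 \<nu>3 (JOmega y) = (\<lambda>_. 0)"
  shows "torsion_equations (tors y) (mu y) (\<lambda>i. \<pi>1 ((!) [E y i])) (\<lambda>i. \<nu>1 ((!) [E y i]))
    (\<lambda>i j. \<pi>2 ((!) [E y i, E y j])) (\<lambda>i j. \<sigma>2 ((!) [E y i, E y j])) (\<lambda>i j k. \<nu>3 ((!) [E y i, E y j, E y k])) p0 s0"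
proof -
  interpret SU3_frame "\<kappa> y" "\<Omega> y" "e y" "E y" by (rule SU3[OF y])
  have aJ: "alt_form 3 (JOmega y)" by (rule alt_form_J_Omega)
  note ev = kappa_list Omega_list JOmega_list covol3_def dual_explicit J_frame alt_form_1_minus[OF p1]
  note dK3 = dK[of "(!) [u, v, w]" for u v w, unfolded wedge_1_2[OF n1 alt_kappa]]
  note dO4 = dO[of "(!) [u, v, w, x]" for u v w x, unfolded wedge_2_2[OF alt_kappa alt_kappa] wedge_1_3[OF p1 alt_Omega] wedge_2_2[OF a2 alt_kappa]]
  note dJ4 = dJ[of "(!) [u, v, w, x]" for u v w x, unfolded wedge_2_2[OF alt_kappa alt_kappa] wedge_1_3[OF alt_form_J_1[OF p1] alt_Omega]
    wedge_2_2[OF s2 alt_kappa] form_J_1[OF p1]]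
  have pi2J: "\<pi>2 ((!) [J u, J v]) = \<pi>2 ((!) [u, v])" for u v
    using form_J_2[OF a2, of u v] unfolding a2J by simp
  have sig2J: "\<sigma>2 ((!) [J u, J v]) = \<sigma>2 ((!) [u, v])" for u v
    using form_J_2[OF s2, of u v] unfolding s2J by simp
  have pi2_tr: "\<pi>2 ((!) [E y 1, E y 2]) + \<pi>2 ((!) [E y 3, E y 4]) + \<pi>2 ((!) [E y 5, E y 6]) = 0"
    using fun_cong[OF a2K, of "(!) [E y 1, E y 2, E y 3, E y 4, E y 5, E y 6]"]
    unfolding wedge_2_4[OF a2 wedge_kappa_kappa] wedge_2_2[OF alt_kappa alt_kappa] ev by simp
  have sig2_tr: "\<sigma>2 ((!) [E y 1, E y 2]) + \<sigma>2 ((!) [E y 3, E y 4]) + \<sigma>2 ((!) [E y 5, E y 6]) = 0"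
    using fun_cong[OF s2K, of "(!) [E y 1, E y 2, E y 3, E y 4, E y 5, E y 6]"]
    unfolding wedge_2_4[OF s2 wedge_kappa_kappa] wedge_2_2[OF alt_kappa alt_kappa] ev by simp
  note nuK = fun_cong[OF n3K, of "(!) [a, b, c, d, f]" for a b c d f, unfolded wedge_3_2[OF n3 alt_kappa]]
  note nuO = fun_cong[OF n3O, of "(!) [E y 1, E y 2, E y 3, E y 4, E y 5, E y 6]", unfolded wedge_3_3[OF n3 alt_Omega]]
  note nuJ = fun_cong[OF n3J, of "(!) [E y 1, E y 2, E y 3, E y 4, E y 5, E y 6]", unfolded wedge_3_3[OF n3 aJ]]
  note K = ext_deriv_kappa[OF y, unfolded dK3 ev, simplified] and O = ext_deriv_Omega[OF y, unfolded dO4 ev, simplified]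
    and J' = ext_deriv_JOmega[OF y, unfolded dJ4 ev, simplified]
  note m2 = alt_form_2_minus[OF a2] alt_form_2_minus[OF s2]
  note inv = pi2J[of "E y 1" "E y 3", unfolded J_frame m2, simplified] pi2J[of "E y 1" "E y 4", unfolded J_frame m2, simplified]
    pi2J[of "E y 1" "E y 5", unfolded J_frame m2, simplified] pi2J[of "E y 1" "E y 6", unfolded J_frame m2, simplified]
    pi2J[of "E y 3" "E y 5", unfolded J_frame m2, simplified] pi2J[of "E y 3" "E y 6", unfolded J_frame m2, simplified]
    sig2J[of "E y 1" "E y 3", unfolded J_frame m2, simplified] sig2J[of "E y 1" "E y 4", unfolded J_frame m2, simplified]
    sig2J[of "E y 1" "E y 5", unfolded J_frame m2, simplified] sig2J[of "E y 1" "E y 6", unfolded J_frame m2, simplified]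
    sig2J[of "E y 3" "E y 5", unfolded J_frame m2, simplified] sig2J[of "E y 3" "E y 6", unfolded J_frame m2, simplified] pi2_tr[simplified] sig2_tr[simplified]
  note nu = nuK[of "E y 1" "E y 2" "E y 3" "E y 4" "E y 5", unfolded ev, simplified] nuK[of "E y 1" "E y 2" "E y 3" "E y 4" "E y 6", unfolded ev, simplified]
    nuK[of "E y 1" "E y 2" "E y 3" "E y 5" "E y 6", unfolded ev, simplified] nuK[of "E y 1" "E y 2" "E y 4" "E y 5" "E y 6", unfolded ev, simplified]
    nuK[of "E y 1" "E y 3" "E y 4" "E y 5" "E y 6", unfolded ev, simplified] nuK[of "E y 2" "E y 3" "E y 4" "E y 5" "E y 6", unfolded ev, simplified]
    nuO[unfolded ev, simplified] nuJ[unfolded ev, simplified]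
  \<comment> \<open>Simplification has written the index 1 as \<open>Suc 0\<close> in the facts, so the goals are put into the same form.\<close>
  show ?thesis
    unfolding torsion_equations_def One_nat_def
    by (intro conjI) (((use K in linarith)+)[20], ((use O in linarith)+)[15], ((use J' in linarith)+)[15], (use inv nu in linarith)+)
qed

end

section \<open>Exterior products near the top degree\<close>

lemma wedge_diff_right:
  "wedge r s \<alpha> (\<lambda>v. \<beta> v - \<beta>' v) v = wedge r s \<alpha> \<beta> v - wedge r s \<alpha> \<beta>' v"
  unfolding wedge_def by (simp add: algebra_simps sum_subtractf diff_divide_distrib)

lemma alt_form_args_many:
  "alt_form 5 \<alpha> \<Longrightarrow> \<alpha> v = \<alpha> ((!) [v 0, v 1, v 2, v 3, v 4])"
  "alt_form 6 \<alpha> \<Longrightarrow> \<alpha> v = \<alpha> ((!) [v 0, v 1, v 2, v 3, v 4, v 5])"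
  by (erule alt_form_cong, auto simp: less_Suc_eq eval_nat_numeral)+

lemma wedge_1_5:
  assumes "alt_form 1 \<alpha>" "alt_form 5 \<beta>"
  shows "wedge 1 5 \<alpha> \<beta> ((!) [u, a, b, c, d, f]) =
    \<alpha> ((!) [u]) * \<beta> ((!) [a, b, c, d, f]) - \<alpha> ((!) [a]) * \<beta> ((!) [u, b, c, d, f])
    + \<alpha> ((!) [b]) * \<beta> ((!) [u, a, c, d, f]) - \<alpha> ((!) [c]) * \<beta> ((!) [u, a, b, d, f])
    + \<alpha> ((!) [d]) * \<beta> ((!) [u, a, b, c, f]) - \<alpha> ((!) [f]) * \<beta> ((!) [u, a, b, c, d])"
  using wedge_eq_shuffle[OF assms, of "[u, a, b, c, d, f]"] by (simp add: eval_nat_numeral)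

text \<open>Exterior multiplication by all covectors detects a form of degree one below the top: its arguments
  do not span, so there is a covector that annihilates them.\<close>

lemma five_form_eqI:
  fixes \<gamma> \<gamma>' :: "(real^6) form"
  assumes \<gamma>: "alt_form 5 \<gamma>" "alt_form 5 \<gamma>'"
    and eq: "\<And>\<alpha> v. alt_form 1 \<alpha> \<Longrightarrow> wedge 1 5 \<alpha> \<gamma> v = wedge 1 5 \<alpha> \<gamma>' v"
  shows "\<gamma> = \<gamma>'"
proof
  fix v :: "nat \<Rightarrow> real^6"
  define \<delta> where "\<delta> = (\<lambda>v. \<gamma> v - \<gamma>' v)"
  have \<delta>: "alt_form 5 \<delta>" unfolding \<delta>_def by (intro alt_form_diff \<gamma>)
  let ?B = "{v 0, v 1, v 2, v 3, v 4}"
  have "card ?B \<le> 5" by (intro order_trans[OF card_insert_le_m1]) (auto intro: card_insert_le_m1)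
  then have "dim ?B < DIM(real^6)" using dim_le_card'[of ?B] by simp
  then obtain u where u: "u \<noteq> 0" "\<And>x. x \<in> span ?B \<Longrightarrow> orthogonal u x"
    using orthogonal_to_subspace_exists[of ?B] by blast
  let ?\<alpha> = "\<lambda>v. u \<bullet> v (0::nat)"
  have \<alpha>: "alt_form 1 ?\<alpha>" by (rule alt_form_1I) (rule bounded_linear.linear[OF bounded_linear_inner_right])
  have z: "u \<bullet> x = 0" if "x \<in> ?B" for x using u(2)[OF span_base[OF that]] by (simp add: orthogonal_def)
  have "wedge 1 5 ?\<alpha> \<delta> ((!) [u, v 0, v 1, v 2, v 3, v 4]) = 0"
    unfolding \<delta>_def wedge_diff_right using eq[OF \<alpha>] by simp
  then have "(u \<bullet> u) * \<delta> ((!) [v 0, v 1, v 2, v 3, v 4]) = 0"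
    unfolding wedge_1_5[OF \<alpha> \<delta>] by (simp add: z)
  then have "\<delta> ((!) [v 0, v 1, v 2, v 3, v 4]) = 0" using u(1) by simp
  then show "\<gamma> v = \<gamma>' v" using alt_form_args_many(1)[OF \<delta>, of v] by (simp add: \<delta>_def)
qed

text \<open>Contracting \<open>\<alpha> \<and> \<omega> = 0\<close>, a form of degree above the dimension.\<close>

lemma wedge_contract_top:
  fixes \<omega> :: "(real^6) form"
  assumes \<alpha>: "alt_form 1 \<alpha>" and \<omega>: "alt_form 6 \<omega>"
  shows "wedge 1 5 \<alpha> (contract X \<omega>) v = \<alpha> ((!) [X]) * \<omega> v"
proof -
  let ?v = "case_nat X v"
  have "alt_form 7 (wedge 1 6 \<alpha> \<omega>)" using alt_form_wedge[OF \<alpha> \<omega>] by simp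
  then have "wedge 1 6 \<alpha> \<omega> ?v = 0" by (rule alt_form_above_dimension) simp
  moreover have "wedge 1 6 \<alpha> \<omega> ?v = wedge 0 6 (contract X \<alpha>) \<omega> v - wedge 1 5 \<alpha> (contract X \<omega>) v"
    using wedge_contract[OF \<alpha> \<omega>, of 6 ?v] by simp
  moreover have "wedge 0 6 (contract X \<alpha>) \<omega> v = \<alpha> ((!) [X]) * \<omega> v"
  proof -
    have c: "alt_form 0 (contract X \<alpha>)" using alt_form_contract[of 0 \<alpha> X] \<alpha> by simp
    have "alt_form 6 (wedge 0 6 (contract X \<alpha>) \<omega>)" using alt_form_wedge[OF c \<omega>] by simp
    then show ?thesis
      using wedge_eq_shuffle[OF c \<omega>, of "[v 0, v 1, v 2, v 3, v 4, v 5]"]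
        alt_form_args_many(2)[of "wedge 0 6 (contract X \<alpha>) \<omega>" v] alt_form_args_many(2)[OF \<omega>, of v]
      by (simp add: contract_nth)
  qed
  ultimately show ?thesis by simp
qed

lemma wedge_6_0:
  assumes \<alpha>: "alt_form 6 \<alpha>" and \<gamma>: "alt_form 0 \<gamma>"
  shows "wedge 6 0 \<alpha> \<gamma> v = \<alpha> v * \<gamma> ((!) [])"
proof -
  have "alt_form 6 (wedge 6 0 \<alpha> \<gamma>)" using alt_form_wedge[OF \<alpha> \<gamma>] by simp
  then show ?thesis
    using wedge_eq_shuffle[OF \<alpha> \<gamma>, of "[v 0, v 1, v 2, v 3, v 4, v 5]"]
      alt_form_args_many(2)[of "wedge 6 0 \<alpha> \<gamma>" v] alt_form_args_many(2)[OF \<alpha>, of v]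
    by (simp add: eval_nat_numeral)
qed

section \<open>Inner products and Hodge duals in an adapted frame\<close>

lemma set_subseqs_1_6: "set ` set (subseqs [1,2,3,4,5,6]) = Pow {1..6::nat}"
proof -
  have "set [1,2,3,4,5,6::nat] = {1..6}" by auto
  then show ?thesis using subseqs_powset[of "[1,2,3,4,5,6::nat]"] by (simp only:)
qed

lemma subsets_1_6:
  "{I. I \<subseteq> {1..6::nat} \<and> card I = r} = set ` set (filter (\<lambda>l. length l = r) (subseqs [1,2,3,4,5,6]))"
proof -
  let ?l = "[1,2,3,4,5,6::nat]"
  have d: "distinct ?l" by simp
  have card: "card (set l) = length l" if "l \<in> set (subseqs ?l)" for l
    using subseqs_distinctD[OF that d] by (rule distinct_card)
  have "{I. I \<subseteq> {1..6::nat} \<and> card I = r} = {I \<in> set ` set (subseqs ?l). card I = r}"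
    unfolding set_subseqs_1_6 by (simp only: Pow_iff)
  also have "\<dots> = set ` {l \<in> set (subseqs ?l). length l = r}"
    using card by (auto simp del: subseqs.simps)
  finally show ?thesis by (simp only: set_filter)
qed

lemma sum_subsets_1_6:
  fixes f :: "nat set \<Rightarrow> real"
  shows "(\<Sum>I | I \<subseteq> {1..6} \<and> card I = r. f I) = (\<Sum>l\<leftarrow>filter (\<lambda>l. length l = r) (subseqs [1,2,3,4,5,6]). f (set l))"
proof -
  let ?L = "filter (\<lambda>l. length l = r) (subseqs [1,2,3,4,5,6::nat])"
  have "distinct (map set (subseqs [1,2,3,4,5,6::nat]))" by (rule distinct_set_subseqs, unfold distinct.simps) simp
  then have d: "distinct (map set ?L)" by (rule distinct_map_filter)
  have "(\<Sum>I | I \<subseteq> {1..6} \<and> card I = r. f I) = sum f (set (map set ?L))" by (simp only: subsets_1_6 set_map)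
  also have "\<dots> = (\<Sum>l\<leftarrow>?L. f (set l))"
    unfolding sum.distinct_set_conv_list[OF d] by (simp only: map_map comp_def)
  finally show ?thesis .
qed

lemma sorted_list_of_set_subseqs:
  assumes "l \<in> set (subseqs [1,2,3,4,5,6::nat])"
  shows "sorted_list_of_set (set l) = l"
proof -
  have "\<forall>l\<in>set (subseqs [1,2,3,4,5,6::nat]). sorted l" by simp
  moreover have "distinct l" by (rule subseqs_distinctD[OF assms]) simp
  ultimately show ?thesis using assms by (intro sorted_list_of_set.idem_if_sorted_distinct) auto
qed

text \<open>The index sets are enumerated by the sublists of \<open>[1, \<dots>, 6]\<close>, so that the sum can be evaluated.\<close>

lemma form_inner_list:
  assumes F: "\<And>i. i \<in> {1..6} \<Longrightarrow> su3_frame \<kappa> \<Omega> i = F i" and a: "alt_form r \<alpha>" "alt_form r \<beta>"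
  shows "form_inner \<kappa> \<Omega> r \<alpha> \<beta> =
    (\<Sum>l\<leftarrow>filter (\<lambda>l. length l = r) (subseqs [1,2,3,4,5,6]). \<alpha> ((!) (map F l)) * \<beta> ((!) (map F l)))"
  unfolding form_inner_def sum_subsets_1_6
proof (intro arg_cong[of _ _ sum_list] map_cong refl)
  fix l assume "l \<in> set (filter (\<lambda>l. length l = r) (subseqs [1,2,3,4,5,6::nat]))"
  then have l: "l \<in> set (subseqs [1,2,3,4,5,6::nat])" "length l = r" by (simp_all only: set_filter mem_Collect_eq)
  have "set l \<in> Pow {1..6}" unfolding set_subseqs_1_6[symmetric] by (rule imageI[OF l(1)])
  then have "su3_frame \<kappa> \<Omega> (l ! k) = map F l ! k" if "k < r" for k
    using F[of "l ! k"] that l(2) by (auto dest!: nth_mem)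
  then have eq: "\<gamma> (\<lambda>k. su3_frame \<kappa> \<Omega> (l ! k)) = \<gamma> ((!) (map F l))" if "alt_form r \<gamma>" for \<gamma>
    by (intro alt_form_cong[OF that])
  show "\<alpha> (\<lambda>k. su3_frame \<kappa> \<Omega> (sorted_list_of_set (set l) ! k)) * \<beta> (\<lambda>k. su3_frame \<kappa> \<Omega> (sorted_list_of_set (set l) ! k))
      = \<alpha> ((!) (map F l)) * \<beta> ((!) (map F l))"
    by (simp only: sorted_list_of_set_subseqs[OF l(1)] eq[OF a(1)] eq[OF a(2)])
qed

lemma form_inner_1:
  assumes F: "\<And>i. i \<in> {1..6} \<Longrightarrow> su3_frame \<kappa> \<Omega> i = F i" and a: "alt_form 1 \<alpha>" "alt_form 1 \<beta>"
  shows "form_inner \<kappa> \<Omega> 1 \<alpha> \<beta> = (\<Sum>i=1..6. \<alpha> ((!) [F i]) * \<beta> ((!) [F i]))"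
  unfolding sum_1_6 by (subst form_inner_list[where F = F, OF _ a]) (simp_all add: F Let_def)

lemma form_inner_2:
  assumes F: "\<And>i. i \<in> {1..6} \<Longrightarrow> su3_frame \<kappa> \<Omega> i = F i" and a: "alt_form 2 \<alpha>"
  shows "form_inner \<kappa> \<Omega> 2 \<alpha> \<alpha> = (\<alpha> ((!) [F 1, F 2]))\<^sup>2 + (\<alpha> ((!) [F 1, F 3]))\<^sup>2 + (\<alpha> ((!) [F 1, F 4]))\<^sup>2
    + (\<alpha> ((!) [F 1, F 5]))\<^sup>2 + (\<alpha> ((!) [F 1, F 6]))\<^sup>2 + (\<alpha> ((!) [F 2, F 3]))\<^sup>2
    + (\<alpha> ((!) [F 2, F 4]))\<^sup>2 + (\<alpha> ((!) [F 2, F 5]))\<^sup>2 + (\<alpha> ((!) [F 2, F 6]))\<^sup>2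
    + (\<alpha> ((!) [F 3, F 4]))\<^sup>2 + (\<alpha> ((!) [F 3, F 5]))\<^sup>2 + (\<alpha> ((!) [F 3, F 6]))\<^sup>2
    + (\<alpha> ((!) [F 4, F 5]))\<^sup>2 + (\<alpha> ((!) [F 4, F 6]))\<^sup>2 + (\<alpha> ((!) [F 5, F 6]))\<^sup>2"
  by (subst form_inner_list[where F = F, OF _ a a]) (simp_all add: F Let_def power2_eq_square)

lemma form_inner_3:
  assumes F: "\<And>i. i \<in> {1..6} \<Longrightarrow> su3_frame \<kappa> \<Omega> i = F i" and a: "alt_form 3 \<alpha>"
  shows "form_inner \<kappa> \<Omega> 3 \<alpha> \<alpha> = (\<alpha> ((!) [F 1, F 2, F 3]))\<^sup>2 + (\<alpha> ((!) [F 1, F 2, F 4]))\<^sup>2 + (\<alpha> ((!) [F 1, F 2, F 5]))\<^sup>2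
    + (\<alpha> ((!) [F 1, F 2, F 6]))\<^sup>2 + (\<alpha> ((!) [F 1, F 3, F 4]))\<^sup>2 + (\<alpha> ((!) [F 1, F 3, F 5]))\<^sup>2
    + (\<alpha> ((!) [F 1, F 3, F 6]))\<^sup>2 + (\<alpha> ((!) [F 1, F 4, F 5]))\<^sup>2 + (\<alpha> ((!) [F 1, F 4, F 6]))\<^sup>2
    + (\<alpha> ((!) [F 1, F 5, F 6]))\<^sup>2 + (\<alpha> ((!) [F 2, F 3, F 4]))\<^sup>2 + (\<alpha> ((!) [F 2, F 3, F 5]))\<^sup>2
    + (\<alpha> ((!) [F 2, F 3, F 6]))\<^sup>2 + (\<alpha> ((!) [F 2, F 4, F 5]))\<^sup>2 + (\<alpha> ((!) [F 2, F 4, F 6]))\<^sup>2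
    + (\<alpha> ((!) [F 2, F 5, F 6]))\<^sup>2 + (\<alpha> ((!) [F 3, F 4, F 5]))\<^sup>2 + (\<alpha> ((!) [F 3, F 4, F 6]))\<^sup>2
    + (\<alpha> ((!) [F 3, F 5, F 6]))\<^sup>2 + (\<alpha> ((!) [F 4, F 5, F 6]))\<^sup>2"
  by (subst form_inner_list[where F = F, OF _ a a]) (simp_all add: F Let_def power2_eq_square)

lemma form_inner_6:
  assumes F: "\<And>i. i \<in> {1..6} \<Longrightarrow> su3_frame \<kappa> \<Omega> i = F i" and a: "alt_form 6 \<alpha>"
  shows "form_inner \<kappa> \<Omega> 6 \<alpha> \<beta> =
    \<alpha> ((!) [F 1, F 2, F 3, F 4, F 5, F 6]) * \<beta> (\<lambda>k. su3_frame \<kappa> \<Omega> ([1,2,3,4,5,6] ! k))"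
proof -
  have s: "sorted_list_of_set (set [1,2,3,4,5,6]) = [1,2,3,4,5,6::nat]"
    by (rule sorted_list_of_set_subseqs) (simp add: Let_def)
  have "\<alpha> (\<lambda>k. su3_frame \<kappa> \<Omega> ([1,2,3,4,5,6] ! k)) = \<alpha> ((!) [F 1, F 2, F 3, F 4, F 5, F 6])"
    by (rule alt_form_cong[OF a]) (auto simp: less_Suc_eq eval_nat_numeral F)
  then show ?thesis
    unfolding form_inner_def sum_subsets_1_6 by (simp add: Let_def s[simplified])
qed

lemma linear_one_form: "alt_form 1 \<alpha> \<Longrightarrow> linear (\<lambda>u. \<alpha> ((!) [u]))"
proof -
  assume a: "alt_form 1 \<alpha>"
  have upd: "((!) [0])(0 := u) = (!) [u]" for u
    by (auto simp: fun_eq_iff nth_Cons split: nat.split)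
  show ?thesis using alt_form_linear[OF a, of 0 "(!) [0]"] unfolding upd by simp
qed

text \<open>\<open>\<kappa>\<^sup>3/6\<close> on six vectors is the Pfaffian of their Gram matrix with respect to \<open>\<kappa>\<close>. In contrast to the sum over
  permutations this polynomial is small enough to be differentiated.\<close>

lemma volume_pfaffian:
  assumes a: "alt_form 2 \<kappa>"
  defines "K u v \<equiv> \<kappa> ((!) [u, v])"
  shows "su3_volume \<kappa> ((!) [a, b, c, d, p, q]) = (
    K a b * (K c d * K p q - K c p * K d q + K c q * K d p) - K a c * (K b d * K p q - K b p * K d q + K b q * K d p)
    + K a d * (K b c * K p q - K b p * K c q + K b q * K c p) - K a p * (K b c * K d q - K b d * K c q + K b q * K c d)
    + K a q * (K b c * K d p - K b d * K c p + K b p * K c d))" (is "_ = ?P")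
proof -
  have a4: "alt_form 4 (wedge 2 2 \<kappa> \<kappa>)" using alt_form_wedge[OF a a] by simp
  have "wedge 2 4 \<kappa> (wedge 2 2 \<kappa> \<kappa>) ((!) [a, b, c, d, p, q]) = 6 * ?P"
    unfolding wedge_2_4[OF a a4] wedge_2_2[OF a a] K_def by algebra
  then show ?thesis by (simp add: su3_volume_def)
qed

context SU3_frame
begin

definition sharp where "sharp \<theta> = (\<Sum>a=1..6. \<theta> ((!) [E a]) *\<^sub>R E a)"

lemma e_sharp: "a \<in> {1..6} \<Longrightarrow> e a (sharp \<theta>) = \<theta> ((!) [E a])"
proof -
  assume a: "a \<in> {1..6}"
  have "e a (sharp \<theta>) = (\<Sum>b=1..6. \<theta> ((!) [E b]) * e a (E b))"
    unfolding sharp_def by (simp add: linear_sum[OF lin[OF a]] e_scaleR[OF a])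
  also have "\<dots> = (\<Sum>b=1..6. if b = a then \<theta> ((!) [E b]) else 0)"
    by (rule sum.cong) (use a in \<open>auto simp: dual[OF a]\<close>)
  finally show ?thesis using a by simp
qed

lemma g_sharp:
  assumes \<theta>: "alt_form 1 \<theta>" shows "g (sharp \<theta>) w = \<theta> ((!) [w])"
proof -
  have "\<theta> ((!) [w]) = \<theta> ((!) [\<Sum>a=1..6. e a w *\<^sub>R E a])" using expand[of w] by simp
  also have "\<dots> = (\<Sum>a=1..6. e a w * \<theta> ((!) [E a]))"
    unfolding linear_sum[OF linear_one_form[OF \<theta>]] by (simp add: linear_cmul[OF linear_one_form[OF \<theta>]])
  also have "\<dots> = g (sharp \<theta>) w"
    unfolding g_def by (rule sum.cong[OF refl]) (simp only: e_sharp mult.commute)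
  finally show ?thesis by simp
qed

lemma volume_contract_frame:
  "su3_volume \<kappa> ((!) [X, E 2, E 3, E 4, E 5, E 6]) = e 1 X"
  "su3_volume \<kappa> ((!) [X, E 1, E 3, E 4, E 5, E 6]) = - e 2 X"
  "su3_volume \<kappa> ((!) [X, E 1, E 2, E 4, E 5, E 6]) = e 3 X"
  "su3_volume \<kappa> ((!) [X, E 1, E 2, E 3, E 5, E 6]) = - e 4 X"
  "su3_volume \<kappa> ((!) [X, E 1, E 2, E 3, E 4, E 6]) = e 5 X"
  "su3_volume \<kappa> ((!) [X, E 1, E 2, E 3, E 4, E 5]) = - e 6 X"
  unfolding volume_pfaffian[OF alt_kappa] kappa_list dual_explicit by simp_all

text \<open>The Hodge dual of a one-form is the contraction of the volume form with the metrically dual vector,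
  since \<open>\<alpha> \<and> \<iota>\<^sub>X vol = \<alpha>(X) vol\<close>.\<close>

lemma hodge_1:
  assumes \<theta>: "alt_form 1 \<theta>"
  shows "hodge \<kappa> \<Omega> 1 \<theta> = contract (sharp \<theta>) (su3_volume \<kappa>)"
proof -
  let ?F = "su3_frame \<kappa> \<Omega>"
  interpret o: SU3_frame \<kappa> \<Omega> "su3_coframe \<kappa> \<Omega>" ?F
    by unfold_locales (simp add: su3_frame_def adapted_frame_dual[OF adapted_su3_coframe])
  have "g (o.sharp \<theta> - sharp \<theta>) w = 0" for w
    using o.g_sharp[OF \<theta>, of w] g_sharp[OF \<theta>, of w] g_eq[OF adapted_su3_coframe, of "o.sharp \<theta>" w]
    by (simp add: g_diff_left o.g_def)
  then have X: "o.sharp \<theta> = sharp \<theta>" using g_nondegenerate[of "o.sharp \<theta> - sharp \<theta>"] by simp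
  have inner: "form_inner \<kappa> \<Omega> 1 \<alpha> \<theta> = \<alpha> ((!) [sharp \<theta>])" if \<alpha>: "alt_form 1 \<alpha>" for \<alpha>
  proof -
    have "\<alpha> ((!) [o.sharp \<theta>]) = (\<Sum>i=1..6. \<theta> ((!) [?F i]) * \<alpha> ((!) [?F i]))"
      unfolding o.sharp_def linear_sum[OF linear_one_form[OF \<alpha>]] by (simp add: linear_cmul[OF linear_one_form[OF \<alpha>]])
    then show ?thesis unfolding form_inner_1[of \<kappa> \<Omega>, OF refl \<alpha> \<theta>] X by (simp add: mult.commute)
  qed
  let ?P = "\<lambda>\<gamma>. alt_form (6 - 1) \<gamma> \<and> (\<forall>\<alpha>. alt_form 1 \<alpha> \<longrightarrow>
        wedge 1 (6 - 1) \<alpha> \<gamma> = (\<lambda>v. form_inner \<kappa> \<Omega> 1 \<alpha> \<theta> * su3_volume \<kappa> v))"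
  have ex: "?P (contract (sharp \<theta>) (su3_volume \<kappa>))"
  proof (intro conjI allI impI ext)
    show "alt_form (6 - 1) (contract (sharp \<theta>) (su3_volume \<kappa>))"
      by (rule alt_form_contract) (simp add: alt_volume)
    show "wedge 1 (6 - 1) \<alpha> (contract (sharp \<theta>) (su3_volume \<kappa>)) v = form_inner \<kappa> \<Omega> 1 \<alpha> \<theta> * su3_volume \<kappa> v"
      if "alt_form 1 \<alpha>" for \<alpha> v
      using wedge_contract_top[OF that alt_volume] inner[OF that] by simp
  qed
  show ?thesis
    unfolding hodge_def
  proof (rule the_equality, rule ex)
    fix \<gamma> assume \<gamma>: "?P \<gamma>"
    show "\<gamma> = contract (sharp \<theta>) (su3_volume \<kappa>)"
      using \<gamma> ex by (intro five_form_eqI) simp_all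
  qed
qed

text \<open>Every form of top degree is its value on the selected frame times the volume form.\<close>

lemma hodge_6: "hodge \<kappa> \<Omega> 6 \<beta> = (\<lambda>v. \<beta> (\<lambda>k. su3_frame \<kappa> \<Omega> ([1,2,3,4,5,6] ! k)))"
proof -
  let ?F = "su3_frame \<kappa> \<Omega>"
  let ?l = "(!) [?F 1, ?F 2, ?F 3, ?F 4, ?F 5, ?F 6]" and ?c = "\<beta> (\<lambda>k. ?F ([1,2,3,4,5,6] ! k))"
  interpret o: SU3_frame \<kappa> \<Omega> "su3_coframe \<kappa> \<Omega>" ?F
    by unfold_locales (simp add: su3_frame_def adapted_frame_dual[OF adapted_su3_coframe])
  have top: "\<alpha> v = \<alpha> ?l * su3_volume \<kappa> v" if \<alpha>: "alt_form 6 \<alpha>" for \<alpha> v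
  proof -
    have "\<alpha> v - \<alpha> ?l * su3_volume \<kappa> v = 0"
      by (rule top_form_eq_0[OF alt_form_diff[OF \<alpha> alt_form_cmul[OF alt_volume]] o.span_frame])
        (simp add: o.volume_frame del: One_nat_def)
    then show ?thesis by simp
  qed
  let ?P = "\<lambda>\<gamma>. alt_form (6 - 6) \<gamma> \<and> (\<forall>\<alpha>. alt_form 6 \<alpha> \<longrightarrow>
        wedge 6 (6 - 6) \<alpha> \<gamma> = (\<lambda>v. form_inner \<kappa> \<Omega> 6 \<alpha> \<beta> * su3_volume \<kappa> v))"
  show ?thesis
    unfolding hodge_def
  proof (rule the_equality)
    show "?P (\<lambda>v. ?c)"
    proof (intro conjI allI impI ext)
      show "alt_form (6 - 6) (\<lambda>v. ?c)" by (simp add: alt_form_0I)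
      show "wedge 6 (6 - 6) \<alpha> (\<lambda>v. ?c) v = form_inner \<kappa> \<Omega> 6 \<alpha> \<beta> * su3_volume \<kappa> v" if "alt_form 6 \<alpha>" for \<alpha> v
        using wedge_6_0[OF that alt_form_0I, of ?c v] top[OF that, of v]
        by (simp add: form_inner_6[OF refl that])
    qed
    fix \<gamma> assume \<gamma>: "?P \<gamma>"
    then have a: "alt_form 0 \<gamma>" by simp
    have "wedge 6 0 (su3_volume \<kappa>) \<gamma> ?l = form_inner \<kappa> \<Omega> 6 (su3_volume \<kappa>) \<beta> * su3_volume \<kappa> ?l"
      using \<gamma> alt_volume by simp
    then have "\<gamma> ((!) []) = ?c"
      by (simp add: wedge_6_0[OF alt_volume a] form_inner_6[OF refl alt_volume] o.volume_frame del: One_nat_def)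
    then show "\<gamma> = (\<lambda>v. ?c)" using alt_form_args(1)[OF a] by (simp add: fun_eq_iff)
  qed
qed

end

section \<open>The codifferential of a one-form\<close>

context su3_chart
begin

text \<open>The derivative of the duality relation \<open>e\<^sup>a(E\<^sub>b) = \<delta>\<^sub>a\<^sub>b\<close>.\<close>

lemma e_dE:
  assumes x: "x \<in> U" and a: "a \<in> {1..6}" and b: "b \<in> {1..6}"
  shows "e x a (\<chi> l. dd (\<lambda>y. E y b $ l) x u) = - De x a u (E x b)"
proof -
  have "dd (\<lambda>y. e y a (E y b)) x u = De x a u (E x b) + e x a (\<chi> l. dd (\<lambda>y. E y b $ l) x u)"
    unfolding De_def by (rule dd_apply[OF U(1) x smooth_e[OF a] lin[OF _ a] smooth_E[OF b]])
  moreover have "dd (\<lambda>y. e y a (E y b)) x u = dd (\<lambda>y. if a = b then 1 else 0) x u"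
    by (rule dd_local[OF x dual[OF _ a b] differentiable_const])
  ultimately show ?thesis by simp
qed

lemma smooth_one_form:
  assumes "\<And>y. y \<in> U \<Longrightarrow> alt_form 1 (\<theta> y)" "\<And>v. smooth_on U (\<lambda>y. \<theta> y v)" "b \<in> {1..6}"
  shows "smooth_on U (\<lambda>y. \<theta> y ((!) [E y b]))"
  by (rule smooth_on_apply[OF U(1), of "\<lambda>y u. \<theta> y ((!) [u])"])
    (use assms linear_one_form smooth_E in auto)

text \<open>Relative to a constant volume form the volume form is multiplication by a function, the Pfaffian of
  \<open>\<kappa>\<close> in a constant basis. At the base point its derivative is the trace of the derivative of the coframe.\<close>

lemma volume_relative:
  assumes x: "x \<in> U" and y: "y \<in> U"
  defines "l \<equiv> (!) [E x 1, E x 2, E x 3, E x 4, E x 5, E x 6]"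
  shows "su3_volume (\<kappa> y) v = su3_volume (\<kappa> y) l * su3_volume (\<kappa> x) v"
proof -
  note px = SU3[OF x] and py = SU3[OF y]
  have "su3_volume (\<kappa> y) v - su3_volume (\<kappa> y) l * su3_volume (\<kappa> x) v = 0"
    unfolding l_def
    by (rule top_form_eq_0[OF alt_form_diff[OF SU3_frame.alt_volume[OF py] alt_form_cmul[OF SU3_frame.alt_volume[OF px]]]
          SU3_frame.span_frame[OF px]]) (simp add: SU3_frame.volume_frame[OF px] del: One_nat_def)
  then show ?thesis by simp
qed

lemma differentiable_kappa: "y \<in> U \<Longrightarrow> (\<lambda>z. \<kappa> z v) differentiable (at y)"
  using Ck_kappa[of 1 v] U(2) by auto

lemma volume_density:
  assumes x: "x \<in> U"
  defines "\<rho> \<equiv> \<lambda>y. su3_volume (\<kappa> y) ((!) [E x 1, E x 2, E x 3, E x 4, E x 5, E x 6])"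
  shows "\<rho> x = 1" "\<rho> differentiable (at x)" "dd \<rho> x u = (\<Sum>a=1..6. De x a u (E x a))"
proof -
  interpret SU3_frame "\<kappa> x" "\<Omega> x" "e x" "E x" by (rule SU3[OF x])
  show "\<rho> x = 1" unfolding \<rho>_def by (rule volume_frame)
  define K where "K i j y = \<kappa> y ((!) [E x i, E x j])" for i j y
  note d = differentiable_kappa[OF x, of "(!) [E x i, E x j]" for i j, folded K_def]
  define P where "P = (\<lambda>y.
    K 1 2 y * (K 3 4 y * K 5 6 y - K 3 5 y * K 4 6 y + K 3 6 y * K 4 5 y)
    - K 1 3 y * (K 2 4 y * K 5 6 y - K 2 5 y * K 4 6 y + K 2 6 y * K 4 5 y)
    + K 1 4 y * (K 2 3 y * K 5 6 y - K 2 5 y * K 3 6 y + K 2 6 y * K 3 5 y)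
    - K 1 5 y * (K 2 3 y * K 4 6 y - K 2 4 y * K 3 6 y + K 2 6 y * K 3 4 y)
    + K 1 6 y * (K 2 3 y * K 4 5 y - K 2 4 y * K 3 5 y + K 2 5 y * K 3 4 y))"
  have \<rho>P: "\<rho> y = P y" if "y \<in> U" for y
    unfolding \<rho>_def P_def K_def by (rule volume_pfaffian[OF SU3_frame.alt_kappa[OF SU3[OF that]]])
  have dP: "P differentiable (at x)"
    unfolding P_def by (intro differentiable_add differentiable_diff differentiable_mult d)
  then obtain P' where "(P has_derivative P') (at x)" unfolding differentiable_def by blast
  then have "(\<rho> has_derivative P') (at x)"
    by (rule has_derivative_transform_within_open[OF _ U(1) x]) (simp add: \<rho>P)
  then show "\<rho> differentiable (at x)" unfolding differentiable_def by blast
  have K: "K i j x = \<kappa> x ((!) [E x i, E x j])" for i j by (simp add: K_def)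
  have "dd \<rho> x u = dd P x u" by (rule dd_local[OF x \<rho>P dP])
  also have "\<dots> = dd (K 1 2) x u + dd (K 3 4) x u + dd (K 5 6) x u"
    unfolding P_def
    by (simp only: dd_add dd_diff dd_mult d differentiable_mult differentiable_add differentiable_diff
        K kappa_list dual_explicit) simp
  also have "\<dots> = (\<Sum>a=1..6. De x a u (E x a))"
    unfolding K_def dd_kappa[OF x] dual_explicit sum_1_6 by simp
  finally show "dd \<rho> x u = (\<Sum>a=1..6. De x a u (E x a))" .
qed

text \<open>The form \<open>*\<theta>\<close> is \<open>\<iota>\<^sub>X vol\<close> for the vector field \<open>X\<close> dual to \<open>\<theta>\<close>, and its exterior derivative is the divergence of
  \<open>X\<close> times \<open>vol\<close>. In the constant basis that agrees with the frame at \<open>x\<close> this is the divergence of \<open>\<rho> X\<close>, where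
  \<open>\<rho>\<close> is the density of \<open>vol\<close>. The derivatives of the frame combine with the derivative of \<open>\<rho>\<close> to the
  connection terms, as the symmetric \<open>\<gamma>\<close> cancels.\<close>

lemma codiff_one_form:
  assumes x: "x \<in> U" and F: "\<And>i. i \<in> {1..6} \<Longrightarrow> su3_frame (\<kappa> x) (\<Omega> x) i = E x i"
    and \<theta>: "\<And>y. y \<in> U \<Longrightarrow> alt_form 1 (\<theta> y)" and sm: "\<And>v. smooth_on U (\<lambda>y. \<theta> y v)"
  shows "hodge (\<kappa> x) (\<Omega> x) 6 (ext_deriv 5 (\<lambda>y. hodge (\<kappa> y) (\<Omega> y) 1 (\<theta> y)) x) v =
    (\<Sum>a=1..6. dd (\<lambda>y. \<theta> y ((!) [E y a])) x (E x a)) - (\<Sum>b=1..6. \<theta> x ((!) [E x b]) * (\<Sum>a=1..6. \<omega> x (E x a) b a))"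
proof -
  interpret SU3_frame "\<kappa> x" "\<Omega> x" "e x" "E x" by (rule SU3[OF x])
  let ?L = "[E x 1, E x 2, E x 3, E x 4, E x 5, E x 6]"
  let ?v = "\<lambda>k. su3_frame (\<kappa> x) (\<Omega> x) ([1,2,3,4,5,6] ! k)"
  define \<rho> where "\<rho> y = su3_volume (\<kappa> y) ((!) ?L)" for y
  define X where "X y = (\<Sum>b=1..6. \<theta> y ((!) [E y b]) *\<^sub>R E y b)" for y
  have vL: "?v k = ?L ! k" if "k < 6" for k
    using that by (auto simp: less_Suc_eq eval_nat_numeral F)
  have star: "hodge (\<kappa> y) (\<Omega> y) 1 (\<theta> y) = contract (X y) (su3_volume (\<kappa> y))" if "y \<in> U" for y
    unfolding SU3_frame.hodge_1[OF SU3[OF that] \<theta>[OF that]] SU3_frame.sharp_def[OF SU3[OF that]] X_def ..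
  have vol: "su3_volume (\<kappa> x) ((!) (Z # take i ?L @ drop (Suc i) ?L)) = (-1) ^ i * e x (Suc i) Z" if "i \<le> 5" for i Z
  proof -
    have "i = 0 \<or> i = 1 \<or> i = 2 \<or> i = 3 \<or> i = 4 \<or> i = 5" using that by linarith
    moreover have "Suc 0 = 1" "Suc 1 = 2" "Suc 2 = 3" "Suc 3 = 4" "Suc 4 = 5" "Suc 5 = 6" by simp_all
    ultimately show ?thesis
      using volume_contract_frame[of Z]
      by (elim disjE) (simp_all add: eval_nat_numeral)
  qed
  have sX: "smooth_on U (\<lambda>y. X y $ l)" for l
    unfolding X_def sum_component vector_scaleR_component real_scaleR_def
    by (intro smooth_on_sum[OF U(1)] smooth_on_mult[OF U(1)] smooth_one_form[OF \<theta> sm] smooth_E)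
  have seX: "smooth_on U (\<lambda>y. e x a (X y))" if a: "a \<in> {1..6}" for a
    by (rule smooth_on_apply[OF U(1) smooth_on_const _ sX]) (rule lin[OF a])
  note d\<rho> = volume_density[OF x, folded \<rho>_def]
  have summand: "dd (\<lambda>y. hodge (\<kappa> y) (\<Omega> y) 1 (\<theta> y) (\<lambda>j. if j < i then ?v j else ?v (Suc j))) x (?v i)
      = (-1) ^ i * dd (\<lambda>y. \<rho> y * e x (Suc i) (X y)) x (E x (Suc i))" if i: "i \<le> 5" for i
  proof -
    have ai: "Suc i \<in> {1..6}" using i by simp
    note dd1 = differentiable_mult[OF d\<rho>(2) smooth_on_differentiable[OF seX[OF ai] x]]
    have eq: "hodge (\<kappa> y) (\<Omega> y) 1 (\<theta> y) (\<lambda>j. if j < i then ?v j else ?v (Suc j)) = (-1) ^ i * (\<rho> y * e x (Suc i) (X y))"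
      if y: "y \<in> U" for y
    proof -
      have "alt_form 5 (contract (X y) (su3_volume (\<kappa> y)))"
        by (rule alt_form_contract) (simp add: SU3_frame.alt_volume[OF SU3[OF y]])
      then have "contract (X y) (su3_volume (\<kappa> y)) (\<lambda>j. if j < i then ?v j else ?v (Suc j))
          = contract (X y) (su3_volume (\<kappa> y)) ((!) (take i ?L @ drop (Suc i) ?L))"
      proof (rule alt_form_cong)
        fix j :: nat assume j: "j < 5"
        show "(if j < i then ?v j else ?v (Suc j)) = (take i ?L @ drop (Suc i) ?L) ! j"
          using i j vL[of j] vL[of "Suc j"] by (simp add: nth_append)
      qed
      also have "\<dots> = su3_volume (\<kappa> y) ((!) (X y # take i ?L @ drop (Suc i) ?L))" by (rule contract_nth)
      also have "\<dots> = \<rho> y * su3_volume (\<kappa> x) ((!) (X y # take i ?L @ drop (Suc i) ?L))"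
        unfolding \<rho>_def by (rule volume_relative[OF x y])
      finally show ?thesis unfolding star[OF y] vol[OF i] by simp
    qed
    have "?v i = E x (Suc i)"
      using i by (auto simp: le_Suc_eq eval_nat_numeral F)
    then show ?thesis
      using dd_local[OF x eq differentiable_mult[OF differentiable_const dd1]] dd_cmult[OF dd1] by simp
  qed
  have "hodge (\<kappa> x) (\<Omega> x) 6 (ext_deriv 5 (\<lambda>y. hodge (\<kappa> y) (\<Omega> y) 1 (\<theta> y)) x) v
      = (\<Sum>i\<le>5. (-1) ^ i * ((-1) ^ i * dd (\<lambda>y. \<rho> y * e x (Suc i) (X y)) x (E x (Suc i))))"
    unfolding hodge_6 ext_deriv_def by (rule sum.cong[OF refl]) (simp only: summand atMost_iff)
  also have "\<dots> = (\<Sum>i\<le>5. dd (\<lambda>y. \<rho> y * e x (Suc i) (X y)) x (E x (Suc i)))"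
    by (rule sum.cong[OF refl]) (simp flip: mult.assoc power_mult_distrib)
  also have "\<dots> = (\<Sum>a=1..6. dd (\<lambda>y. \<rho> y * e x a (X y)) x (E x a))"
    by (simp add: sum_1_6 eval_nat_numeral)
  also have "\<dots> = (\<Sum>a=1..6. dd (\<lambda>y. \<theta> y ((!) [E y a])) x (E x a) - (\<Sum>b=1..6. \<theta> x ((!) [E x b]) * De x a (E x a) (E x b))
      + (\<Sum>b=1..6. De x b (E x a) (E x b)) * \<theta> x ((!) [E x a]))"
  proof (rule sum.cong[OF refl])
    fix a assume a: "a \<in> {1..6::nat}"
    have eX: "e x a (X x) = \<theta> x ((!) [E x a])" using e_sharp[OF a, of "\<theta> x"] by (simp add: sharp_def X_def)
    have "dd (\<lambda>y. e x a (X y)) x u = dd (\<lambda>y. \<theta> y ((!) [E y a])) x u - (\<Sum>b=1..6. \<theta> x ((!) [E x b]) * De x a u (E x b))" for u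
    proof -
      have "dd (\<lambda>y. e x a (X y)) x u = dd (\<lambda>y. \<Sum>b=1..6. \<theta> y ((!) [E y b]) * e x a (E y b)) x u"
        unfolding X_def linear_sum[OF lin[OF a]] linear_cmul[OF lin[OF a]] real_scaleR_def ..
      also have "\<dots> = (\<Sum>b=1..6. \<theta> x ((!) [E x b]) * dd (\<lambda>y. e x a (E y b)) x u
          + dd (\<lambda>y. \<theta> y ((!) [E y b])) x u * e x a (E x b))"
      proof -
        have s: "(\<lambda>y. \<theta> y ((!) [E y b])) differentiable (at x)" "(\<lambda>y. e x a (E y b)) differentiable (at x)" if "b \<in> {1..6}" for b
          by (rule smooth_on_differentiable[OF smooth_one_form[OF \<theta> sm that] x], simp_all)
            (rule smooth_on_differentiable[OF smooth_on_apply[OF U(1) smooth_on_const _ smooth_E[OF that]] x], rule lin[OF a])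
        show ?thesis by (subst dd_sum) (auto simp: dd_mult s intro!: differentiable_mult s)
      qed
      also have "\<dots> = (\<Sum>b=1..6. (if b = a then dd (\<lambda>y. \<theta> y ((!) [E y b])) x u else 0) - \<theta> x ((!) [E x b]) * De x a u (E x b))"
      proof (rule sum.cong[OF refl])
        fix b assume b: "b \<in> {1..6::nat}"
        have "dd (\<lambda>y. e x a (E y b)) x u = - De x a u (E x b)"
          using dd_apply[OF U(1) x smooth_on_const lin[OF a] smooth_E[OF b], of u] e_dE[OF x a b, of u] by simp
        then show "\<theta> x ((!) [E x b]) * dd (\<lambda>y. e x a (E y b)) x u + dd (\<lambda>y. \<theta> y ((!) [E y b])) x u * e x a (E x b)
          = (if b = a then dd (\<lambda>y. \<theta> y ((!) [E y b])) x u else 0) - \<theta> x ((!) [E x b]) * De x a u (E x b)"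
          using dual[OF a b] by auto
      qed
      finally show ?thesis using a by (simp add: sum_subtractf)
    qed
    then show "dd (\<lambda>y. \<rho> y * e x a (X y)) x (E x a) = dd (\<lambda>y. \<theta> y ((!) [E y a])) x (E x a)
      - (\<Sum>b=1..6. \<theta> x ((!) [E x b]) * De x a (E x a) (E x b)) + (\<Sum>b=1..6. De x b (E x a) (E x b)) * \<theta> x ((!) [E x a])"
      using dd_mult[OF d\<rho>(2) smooth_on_differentiable[OF seX[OF a] x], of "E x a"] d\<rho>(1,3) eX by simp
  qed
  also have "\<dots> = (\<Sum>a=1..6. dd (\<lambda>y. \<theta> y ((!) [E y a])) x (E x a))
      - (\<Sum>b=1..6. \<theta> x ((!) [E x b]) * (\<Sum>a=1..6. De x a (E x a) (E x b) - De x a (E x b) (E x a)))"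
  proof -
    have "(\<Sum>a=1..6. \<Sum>b=1..6. \<theta> x ((!) [E x b]) * De x a (E x a) (E x b))
        = (\<Sum>b=1..6. \<theta> x ((!) [E x b]) * (\<Sum>a=1..6. De x a (E x a) (E x b)))"
      unfolding sum_distrib_left by (rule sum.swap)
    then show ?thesis
      by (simp add: sum.distrib sum_subtractf right_diff_distrib sum_distrib_left mult.commute del: One_nat_def)
  qed
  also have "(\<Sum>b=1..6. \<theta> x ((!) [E x b]) * (\<Sum>a=1..6. De x a (E x a) (E x b) - De x a (E x b) (E x a)))
      = (\<Sum>b=1..6. \<theta> x ((!) [E x b]) * (\<Sum>a=1..6. \<omega> x (E x a) b a))"
  proof (intro sum.cong refl arg_cong2[of _ _ _ _ "(*)"])
    fix a b assume a: "a \<in> {1..6::nat}" and b: "b \<in> {1..6::nat}"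
    have "sym x a a b = sym x a b a" unfolding sym_def by (rule \<gamma>_sym)
    then show "De x a (E x a) (E x b) - De x a (E x b) (E x a) = \<omega> x (E x a) b a"
      unfolding De_frame \<omega>_diag[OF x a] \<omega>_antisym[OF x a b] by simp
  qed
  finally show ?thesis .
qed

end

section \<open>Scalar curvature from torsion\<close>

lemma su3_perp_trace_cong:
  assumes "\<And>a b i j. a \<in> {1..6} \<Longrightarrow> b \<in> {1..6} \<Longrightarrow> i \<in> {1..6} \<Longrightarrow> j \<in> {1..6} \<Longrightarrow> X a b i j = Y a b i j"
  shows "su3_perp_trace X = su3_perp_trace Y"
  unfolding su3_perp_trace_def using assms by simp

context su3_chart
begin

text \<open>In \<open>F\<close> the connection is differentiated on constant vectors. Passing to its components along the frame adds
  derivatives of the frame, which amount to the brackets \<open>[E\<^sub>i, E\<^sub>j] = \<nabla>\<^sub>E\<^sub>i E\<^sub>j - \<nabla>\<^sub>E\<^sub>j E\<^sub>i\<close>.\<close>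

lemma curvature_components:
  assumes x: "x \<in> U" and a: "a \<in> {1..6}" and b: "b \<in> {1..6}" and i: "i \<in> {1..6}" and j: "j \<in> {1..6}"
  defines "w \<equiv> \<lambda>i. \<omega> x (E x i)" and "D \<equiv> \<lambda>i j a b. dd (\<lambda>y. \<omega> y (E y j) a b) x (E x i)"
  shows "F x a b (E x i) (E x j) = (D i j a b - D j i a b)
    + ((\<Sum>c=1..6. w i a c * w j c b - w j a c * w i c b) - (\<Sum>c=1..6. w c a b * (w i c j - w j c i)))"
proof -
  have 1: "dd (\<lambda>y. \<omega> y (E x j) a b) x u = dd (\<lambda>y. \<omega> y (E y j) a b) x u + (\<Sum>c=1..6. De x c u (E x j) * w c a b)"
    if j: "j \<in> {1..6}" for j u
  proof -
    have l: "linear (\<lambda>v. \<omega> y v a b)" if "y \<in> U" for y by (rule \<omega>_linear[OF that a])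
    let ?Z = "\<chi> l. dd (\<lambda>y. E y j $ l) x u"
    have "\<omega> x ?Z a b = (\<lambda>v. \<omega> x v a b) (\<Sum>c=1..6. e x c ?Z *\<^sub>R E x c)"
      using expand[OF x, of ?Z] by simp
    also have "\<dots> = (\<Sum>c=1..6. e x c ?Z * w c a b)"
      unfolding linear_sum[OF l[OF x]] linear_cmul[OF l[OF x]] w_def real_scaleR_def ..
    also have "\<dots> = - (\<Sum>c=1..6. De x c u (E x j) * w c a b)"
      unfolding sum_negf[symmetric] by (rule sum.cong[OF refl]) (simp add: e_dE[OF x _ j])
    finally show ?thesis
      using dd_apply[OF U(1) x smooth_\<omega>[OF a b] l smooth_E[OF j], of u] by simp
  qed
  have 2: "De x c (E x i) (E x j) - De x c (E x j) (E x i) = - (w i c j - w j c i)" for c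
    unfolding De_frame w_def using \<gamma>_sym[of x c "E x i" "E x j"] by (simp add: sym_def)
  have "(\<Sum>c=1..6. De x c (E x i) (E x j) * w c a b) - (\<Sum>c=1..6. De x c (E x j) (E x i) * w c a b)
      = - (\<Sum>c=1..6. w c a b * (w i c j - w j c i))"
    unfolding sum_subtractf[symmetric] sum_negf[symmetric] left_diff_distrib[symmetric] 2
    by (rule sum.cong[OF refl]) algebra
  then show ?thesis
    unfolding F_def 1[OF j] 1[OF i] D_def w_def by simp
qed

lemma smooth_\<omega>_frame:
  "a \<in> {1..6} \<Longrightarrow> b \<in> {1..6} \<Longrightarrow> i \<in> {1..6} \<Longrightarrow> smooth_on U (\<lambda>y. \<omega> y (E y i) a b)"
  by (rule smooth_on_apply[OF U(1), of "\<lambda>y v. \<omega> y v a b"]) (auto intro: smooth_\<omega> \<omega>_linear smooth_E)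

lemma dd_torsion_vec:
  assumes x: "x \<in> U" and j: "j \<in> {1..6}"
  defines "D \<equiv> \<lambda>i j a b. dd (\<lambda>y. \<omega> y (E y j) a b) x (E x i)"
  shows "dd (\<lambda>y. torsion_vec (mu y) (tors y) j) x (E x j) =
    torsion_vec (\<lambda>i. D j i 1 2 + D j i 3 4 + D j i 5 6) (\<lambda>k i. [0, D j i 3 5 - D j i 4 6, - D j i 3 6 - D j i 4 5, - D j i 1 5 + D j i 2 6, D j i 1 6 + D j i 2 5, D j i 1 3 - D j i 2 4, - D j i 1 4 - D j i 2 3] ! k) j"
proof -
  have d: "(\<lambda>y. \<omega> y (E y i) a b) differentiable (at x)" if "a \<in> {1..6}" "b \<in> {1..6}" "i \<in> {1..6}" for a b i
    by (rule smooth_on_differentiable[OF smooth_\<omega>_frame[OF that] x])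
  have "\<forall>j\<in>{1..6}. dd (\<lambda>y. torsion_vec (mu y) (tors y) j) x u =
    torsion_vec (\<lambda>i. dd (\<lambda>y. \<omega> y (E y i) 1 2) x u + dd (\<lambda>y. \<omega> y (E y i) 3 4) x u + dd (\<lambda>y. \<omega> y (E y i) 5 6) x u)
      (\<lambda>k i. [0, dd (\<lambda>y. \<omega> y (E y i) 3 5) x u - dd (\<lambda>y. \<omega> y (E y i) 4 6) x u, - dd (\<lambda>y. \<omega> y (E y i) 3 6) x u - dd (\<lambda>y. \<omega> y (E y i) 4 5) x u, - dd (\<lambda>y. \<omega> y (E y i) 1 5) x u + dd (\<lambda>y. \<omega> y (E y i) 2 6) x u, dd (\<lambda>y. \<omega> y (E y i) 1 6) x u + dd (\<lambda>y. \<omega> y (E y i) 2 5) x u, dd (\<lambda>y. \<omega> y (E y i) 1 3) x u - dd (\<lambda>y. \<omega> y (E y i) 2 4) x u, - dd (\<lambda>y. \<omega> y (E y i) 1 4) x u - dd (\<lambda>y. \<omega> y (E y i) 2 3) x u] ! k) j" for u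
    unfolding ball_1_6 torsion_vec_simps tors_simps mu_def
    by (simp add: dd_add dd_diff dd_uminus d differentiable_add differentiable_diff differentiable_minus)
  then show ?thesis using j unfolding D_def by blast
qed

text \<open>The trace of the curvature splits into derivatives of \<open>V = - (\<pi>\<^sub>1 + \<nu>\<^sub>1)\<close> and quadratic terms. The connection
  traces among the latter complete the former to divergences.\<close>

lemma scalar_curvature_torsion:
  assumes x: "x \<in> U"
    and a1: "\<And>y. y \<in> U \<Longrightarrow> alt_form 1 (\<pi>1 y)" "\<And>y. y \<in> U \<Longrightarrow> alt_form 1 (\<nu>1 y)"
    and sm: "\<And>v. smooth_on U (\<lambda>y. \<pi>1 y v)" "\<And>v. smooth_on U (\<lambda>y. \<nu>1 y v)"
    and vec: "\<And>y j. y \<in> U \<Longrightarrow> j \<in> {1..6} \<Longrightarrow> torsion_vec (mu y) (tors y) j = - (\<pi>1 y ((!) [E y j]) + \<nu>1 y ((!) [E y j]))"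
  defines "dvg \<equiv> \<lambda>\<theta>. (\<Sum>a=1..6. dd (\<lambda>y. \<theta> y ((!) [E y a])) x (E x a))
      - (\<Sum>b=1..6. \<theta> x ((!) [E x b]) * (\<Sum>a=1..6. \<omega> x (E x a) b a))"
  shows "scalar_curvature met x = - 2 * dvg \<pi>1 - 2 * dvg \<nu>1 + 2 * torsion_quad (mu x) (tors x)"
proof -
  define w where "w i = \<omega> x (E x i)" for i
  define D where "D i j a b = dd (\<lambda>y. \<omega> y (E y j) a b) x (E x i)" for i j a b
  let ?F = "\<lambda>a b i j. F x a b (E x i) (E x j)"
  let ?q = "\<lambda>a b i j. (\<Sum>c=1..6. w i a c * w j c b - w j a c * w i c b) - (\<Sum>c=1..6. w c a b * (w i c j - w j c i))"
  have "scalar_curvature met x = (\<Sum>a=1..6. \<Sum>b=1..6. ?F a b a b)" by (rule scalar_curvature_frame[OF x])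
  also have "\<dots> = 2 * su3_perp_trace ?F"
    by (rule scalar_eq_su3_perp_trace) (rule F_antisym[OF x] F_swap bianchi[OF x]; assumption)+
  also have "su3_perp_trace ?F = su3_perp_trace (\<lambda>a b i j. (D i j a b - D j i a b) + ?q a b i j)"
    by (rule su3_perp_trace_cong) (unfold D_def w_def, rule curvature_components[OF x])
  also have "\<dots> = su3_perp_trace (\<lambda>a b i j. D i j a b - D j i a b) + su3_perp_trace ?q"
    by (rule su3_perp_trace_add)
  also have "su3_perp_trace (\<lambda>a b i j. D i j a b - D j i a b) = (\<Sum>j=1..6. dd (\<lambda>y. torsion_vec (mu y) (tors y) j) x (E x j))"
    unfolding su3_perp_trace_derivative by (rule sum.cong[OF refl]) (unfold D_def, rule dd_torsion_vec[OF x, symmetric])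
  also have "\<dots> = (\<Sum>j=1..6. - (dd (\<lambda>y. \<pi>1 y ((!) [E y j])) x (E x j) + dd (\<lambda>y. \<nu>1 y ((!) [E y j])) x (E x j)))"
  proof (rule sum.cong[OF refl])
    fix j assume j: "j \<in> {1..6::nat}"
    note d = smooth_on_differentiable[OF smooth_one_form[OF a1(1) sm(1) j] x]
      smooth_on_differentiable[OF smooth_one_form[OF a1(2) sm(2) j] x]
    have "dd (\<lambda>y. torsion_vec (mu y) (tors y) j) x (E x j) = dd (\<lambda>y. - (\<pi>1 y ((!) [E y j]) + \<nu>1 y ((!) [E y j]))) x (E x j)"
      by (rule dd_local[OF x vec[OF _ j] differentiable_minus[OF differentiable_add[OF d]]])
    then show "dd (\<lambda>y. torsion_vec (mu y) (tors y) j) x (E x j) =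
        - (dd (\<lambda>y. \<pi>1 y ((!) [E y j])) x (E x j) + dd (\<lambda>y. \<nu>1 y ((!) [E y j])) x (E x j))"
      by (simp only: dd_uminus[OF differentiable_add[OF d]] dd_add[OF d])
  qed
  also have "su3_perp_trace ?q = torsion_quad (mu x) (tors x) - (\<Sum>j=1..6. torsion_vec (mu x) (tors x) j * (\<Sum>i=1..6. w i j i))"
  proof (rule su3_perp_trace_quadratic)
    show "w i a b = - w i b a" if "a \<in> {1..6}" "b \<in> {1..6}" for i a b
      unfolding w_def by (rule \<omega>_antisym[OF x that])
  qed (unfold w_def mu_def tors_simps, (rule refl)+)
  also have "(\<Sum>j=1..6. torsion_vec (mu x) (tors x) j * (\<Sum>i=1..6. w i j i))
      = (\<Sum>j=1..6. - (\<pi>1 x ((!) [E x j]) + \<nu>1 x ((!) [E x j])) * (\<Sum>i=1..6. w i j i))"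
    by (rule sum.cong[OF refl]) (simp only: vec[OF x])
  finally show ?thesis
    unfolding dvg_def w_def sum_negf sum.distrib mult_minus_left distrib_right by argo
qed

end

section \<open>The scalar curvature of an SU(3)-manifold\<close>

lemma diff_form_alt: "diff_form A r \<omega> \<Longrightarrow> c \<in> A \<Longrightarrow> x \<in> chart_img c \<Longrightarrow> alt_form r (\<omega> c x)"
  by (simp add: diff_form_def)

lemma diff_form_smooth: "diff_form A r \<omega> \<Longrightarrow> c \<in> A \<Longrightarrow> smooth_on (chart_img c) (\<lambda>x. \<omega> c x v)"
  by (simp add: diff_form_def)

lemma Lambda2_8_form: "\<phi> \<in> Lambda2_8 A \<kappa> \<Omega> \<Longrightarrow> diff_form A 2 \<phi>"
  by (simp add: Lambda2_8_def)

lemma Lambda3_12_form: "\<gamma> \<in> Lambda3_12 A \<kappa> \<Omega> \<Longrightarrow> diff_form A 3 \<gamma>"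
  by (simp add: Lambda3_12_def)

lemma Lambda2_8_at:
  assumes "\<phi> \<in> Lambda2_8 A \<kappa> \<Omega>" "c \<in> A" "x \<in> chart_img c"
  shows "form_J (\<kappa> c x) (\<Omega> c x) (\<phi> c x) = \<phi> c x"
    and "wedge 2 4 (\<phi> c x) (wedge 2 2 (\<kappa> c x) (\<kappa> c x)) = (\<lambda>_. 0)"
  using assms by (simp_all add: Lambda2_8_def form_field_J_def)

lemma Lambda3_12_at:
  assumes "\<gamma> \<in> Lambda3_12 A \<kappa> \<Omega>" "c \<in> A" "x \<in> chart_img c"
  shows "wedge 3 2 (\<gamma> c x) (\<kappa> c x) = (\<lambda>_. 0)" and "wedge 3 3 (\<gamma> c x) (\<Omega> c x) = (\<lambda>_. 0)"
    and "wedge 3 3 (\<gamma> c x) (form_J (\<kappa> c x) (\<Omega> c x) (\<Omega> c x)) = (\<lambda>_. 0)"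
  using assms by (simp_all add: Lambda3_12_def form_field_J_def)

lemma torsion_forms_at:
  assumes "torsion_forms A \<kappa> \<Omega> \<pi>0 \<sigma>0 \<pi>1 \<nu>1 \<pi>2 \<sigma>2 \<nu>3" "c \<in> A" "p \<in> chart_dom c" "x = chart_map c p"
  shows "ext_deriv 2 (\<kappa> c) x v = - 3/2 * \<sigma>0 p * \<Omega> c x v + 3/2 * \<pi>0 p * form_field_J \<kappa> \<Omega> \<Omega> c x v
      + wedge 1 2 (\<nu>1 c x) (\<kappa> c x) v + \<nu>3 c x v"
    and "ext_deriv 3 (\<Omega> c) x v = \<pi>0 p * wedge 2 2 (\<kappa> c x) (\<kappa> c x) v
      + wedge 1 3 (\<pi>1 c x) (\<Omega> c x) v - wedge 2 2 (\<pi>2 c x) (\<kappa> c x) v"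
    and "ext_deriv 3 (form_field_J \<kappa> \<Omega> \<Omega> c) x v = \<sigma>0 p * wedge 2 2 (\<kappa> c x) (\<kappa> c x) v
      + wedge 1 3 (form_field_J \<kappa> \<Omega> \<pi>1 c x) (\<Omega> c x) v - wedge 2 2 (\<sigma>2 c x) (\<kappa> c x) v"
  using assms unfolding torsion_forms_def by blast+

theorem theorem3p4:
  fixes X :: "'a topology" and A :: "'a chart set"
    and \<kappa> \<Omega> \<pi>1 \<nu>1 \<pi>2 \<sigma>2 \<nu>3 :: "'a form_field"
    and \<pi>0 \<sigma>0 :: "'a \<Rightarrow> real"
  assumes "smooth_6_manifold X A"
    and "su3_structure A \<kappa> \<Omega>"
    and "torsion_forms A \<kappa> \<Omega> \<pi>0 \<sigma>0 \<pi>1 \<nu>1 \<pi>2 \<sigma>2 \<nu>3"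
  shows "\<forall>c\<in>A. \<forall>p\<in>chart_dom c. \<forall>x. x = chart_map c p \<longrightarrow>
    scalar_curvature (induced_metric \<kappa> \<Omega> c) x =
      15/2 * (\<pi>0 p)\<^sup>2 + 15/2 * (\<sigma>0 p)\<^sup>2
      + 2 * form0_value (codiff \<kappa> \<Omega> 1 \<pi>1 c x) + 2 * form0_value (codiff \<kappa> \<Omega> 1 \<nu>1 c x)
      - inner_at \<kappa> \<Omega> 1 \<nu>1 \<nu>1 c x
      - 1/2 * inner_at \<kappa> \<Omega> 2 \<sigma>2 \<sigma>2 c x - 1/2 * inner_at \<kappa> \<Omega> 2 \<pi>2 \<pi>2 c x
      - 1/2 * inner_at \<kappa> \<Omega> 3 \<nu>3 \<nu>3 c x
      + 4 * inner_at \<kappa> \<Omega> 1 \<pi>1 \<nu>1 c x"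
proof (intro ballI allI impI)
  fix c p x
  assume c: "c \<in> A" and p: "p \<in> chart_dom c" and xp: "x = chart_map c p"
  have G: "diff_form A 2 \<kappa>" "diff_form A 3 \<Omega>" "\<And>y. y \<in> chart_img c \<Longrightarrow> \<exists>e. adapted (\<kappa> c y) (\<Omega> c y) e"
    using assms(2) c by (simp_all add: su3_structure_def)
  have T: "diff_form A 1 \<pi>1" "diff_form A 1 \<nu>1" "\<pi>2 \<in> Lambda2_8 A \<kappa> \<Omega>" "\<sigma>2 \<in> Lambda2_8 A \<kappa> \<Omega>" "\<nu>3 \<in> Lambda3_12 A \<kappa> \<Omega>"
    using assms(3) by (simp_all only: torsion_forms_def)
  let ?S = "chart_img c"
  have xS: "x \<in> ?S" unfolding chart_img_def xp by (rule imageI[OF p])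
  interpret R: su3_region ?S "\<kappa> c" "\<Omega> c"
  proof
    show "open ?S" using assms(1) c by (simp add: smooth_6_manifold_def is_chart_def)
    show "\<exists>e. adapted (\<kappa> c y) (\<Omega> c y) e" if "y \<in> ?S" for y by (rule G(3)[OF that])
    show "Ck_on k ?S (\<lambda>y. \<kappa> c y v)" "Ck_on k ?S (\<lambda>y. \<Omega> c y v)" for k v
      using diff_form_smooth[OF G(1) c] diff_form_smooth[OF G(2) c] by (simp_all add: smooth_on_def)
  qed
  \<comment> \<open>The frame agrees at \<open>x\<close> with the one that defines inner products and the Hodge star at \<open>x\<close>.\<close>
  obtain U E where nbhd: "open U" "x \<in> U" "U \<subseteq> ?S"
    and E: "\<And>y. y \<in> U \<Longrightarrow> adapted_frame (\<kappa> c y) (\<Omega> c y) (\<lambda>i. su3_metric (\<kappa> c y) (\<Omega> c y) (E y i)) (E y)"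
    "\<And>k i l. i \<in> {1..6} \<Longrightarrow> Ck_on k U (\<lambda>y. E y i $ l)"
    and Ex: "\<And>i. i \<in> {1..6} \<Longrightarrow> E x i = su3_frame (\<kappa> c x) (\<Omega> c x) i"
    by (rule R.smooth_frame[OF xS]) (rule that)
  note F = Ex[symmetric]
  interpret su3_chart ?S "\<kappa> c" "\<Omega> c" U E
    by unfold_locales (rule nbhd E; assumption?)+
  have J: "form_field_J \<kappa> \<Omega> \<omega> c = (\<lambda>y. form_J (\<kappa> c y) (\<Omega> c y) (\<omega> c y))" for \<omega>
    by (rule ext) (rule form_field_J_def)
  have alt: "alt_form 1 (\<pi>1 c y)" "alt_form 1 (\<nu>1 c y)" "alt_form 2 (\<pi>2 c y)" "alt_form 2 (\<sigma>2 c y)" "alt_form 3 (\<nu>3 c y)"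
    if "y \<in> U" for y
    by (rule diff_form_alt[OF _ c subsetD[OF nbhd(3) that]], rule T Lambda2_8_form[OF T(3)] Lambda2_8_form[OF T(4)] Lambda3_12_form[OF T(5)])+
  have sm: "smooth_on U (\<lambda>y. \<pi>1 c y v)" "smooth_on U (\<lambda>y. \<nu>1 c y v)" for v
    by (rule smooth_on_subset[OF diff_form_smooth[OF T(1) c] nbhd(3)], rule smooth_on_subset[OF diff_form_smooth[OF T(2) c] nbhd(3)])
  have eqs: "torsion_equations (tors y) (mu y) (\<lambda>i. \<pi>1 c y ((!) [E y i])) (\<lambda>i. \<nu>1 c y ((!) [E y i]))
      (\<lambda>i j. \<pi>2 c y ((!) [E y i, E y j])) (\<lambda>i j. \<sigma>2 c y ((!) [E y i, E y j]))
      (\<lambda>i j k. \<nu>3 c y ((!) [E y i, E y j, E y k])) (\<pi>0 q) (\<sigma>0 q)"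
    if y: "y \<in> U" and q: "q \<in> chart_dom c" "y = chart_map c q" for y q
  proof -
    have yS: "y \<in> ?S" using y nbhd(3) by blast
    note L = Lambda2_8_at[OF T(3) c yS] Lambda2_8_at[OF T(4) c yS] Lambda3_12_at[OF T(5) c yS]
    show ?thesis
      by (rule torsion_equations_at[OF y alt[OF y] _ _ _ L])
        (use torsion_forms_at[OF assms(3) c q] in \<open>simp_all only: J\<close>)
  qed
  have vec: "torsion_vec (mu y) (tors y) j = - (\<pi>1 c y ((!) [E y j]) + \<nu>1 c y ((!) [E y j]))"
    if y: "y \<in> U" and j: "j \<in> {1..6}" for y j
  proof -
    obtain q where "q \<in> chart_dom c" "y = chart_map c q"
      using y nbhd(3) unfolding chart_img_def by blast
    from torsion_equations.torsion_vec_eq[OF eqs[OF y this] j] show ?thesis .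
  qed
  have codiff: "form0_value (codiff \<kappa> \<Omega> 1 \<theta> c x) =
      - ((\<Sum>a=1..6. dd (\<lambda>y. \<theta> c y ((!) [E y a])) x (E x a))
        - (\<Sum>b=1..6. \<theta> c x ((!) [E x b]) * (\<Sum>a=1..6. \<omega> x (E x a) b a)))"
    if "diff_form A 1 \<theta>" for \<theta>
  proof -
    have "hodge (\<kappa> c x) (\<Omega> c x) 6 (ext_deriv 5 (\<lambda>y. hodge (\<kappa> c y) (\<Omega> c y) 1 (\<theta> c y)) x) (\<lambda>_. 0) =
      (\<Sum>a=1..6. dd (\<lambda>y. \<theta> c y ((!) [E y a])) x (E x a))
        - (\<Sum>b=1..6. \<theta> c x ((!) [E x b]) * (\<Sum>a=1..6. \<omega> x (E x a) b a))"
      by (rule codiff_one_form[OF nbhd(2)])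
        (rule F diff_form_alt[OF that c subsetD[OF nbhd(3)]] smooth_on_subset[OF diff_form_smooth[OF that c] nbhd(3)]; assumption?)+
    then show ?thesis unfolding form0_value_def codiff_def by simp
  qed
  have inner: "inner_at \<kappa> \<Omega> 1 \<alpha> \<beta> c x = (\<Sum>i=1..6. \<alpha> c x ((!) [E x i]) * \<beta> c x ((!) [E x i]))"
    if "alt_form 1 (\<alpha> c x)" "alt_form 1 (\<beta> c x)" for \<alpha> \<beta>
    unfolding inner_at_def by (rule form_inner_1[OF _ that]) (rule F)
  have curvature: "scalar_curvature (induced_metric \<kappa> \<Omega> c) x =
      2 * form0_value (codiff \<kappa> \<Omega> 1 \<pi>1 c x) + 2 * form0_value (codiff \<kappa> \<Omega> 1 \<nu>1 c x)
      + 2 * torsion_quad (mu x) (tors x)"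
  proof -
    have "induced_metric \<kappa> \<Omega> c = R.met" by (rule ext) (rule induced_metric_def)
    then show ?thesis
      unfolding codiff[OF T(1)] codiff[OF T(2)] using scalar_curvature_torsion[of x "\<pi>1 c" "\<nu>1 c"] nbhd(2) alt(1,2) sm vec by simp
  qed
  let ?f = "su3_frame (\<kappa> c x) (\<Omega> c x)"
  have frame: "?f 1 = E x 1" "?f 2 = E x 2" "?f 3 = E x 3" "?f 4 = E x 4" "?f 5 = E x 5" "?f 6 = E x 6"
    by (rule F, simp)+
  show "scalar_curvature (induced_metric \<kappa> \<Omega> c) x =
      15/2 * (\<pi>0 p)\<^sup>2 + 15/2 * (\<sigma>0 p)\<^sup>2
      + 2 * form0_value (codiff \<kappa> \<Omega> 1 \<pi>1 c x) + 2 * form0_value (codiff \<kappa> \<Omega> 1 \<nu>1 c x)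
      - inner_at \<kappa> \<Omega> 1 \<nu>1 \<nu>1 c x
      - 1/2 * inner_at \<kappa> \<Omega> 2 \<sigma>2 \<sigma>2 c x - 1/2 * inner_at \<kappa> \<Omega> 2 \<pi>2 \<pi>2 c x
      - 1/2 * inner_at \<kappa> \<Omega> 3 \<nu>3 \<nu>3 c x
      + 4 * inner_at \<kappa> \<Omega> 1 \<pi>1 \<nu>1 c x"
    unfolding curvature torsion_equations.torsion_quad_eq[OF eqs[OF nbhd(2) p xp]]
      inner[where \<alpha> = \<nu>1 and \<beta> = \<nu>1, OF alt(2,2)[OF nbhd(2)]]
      inner[where \<alpha> = \<pi>1 and \<beta> = \<nu>1, OF alt(1,2)[OF nbhd(2)]]
      inner_at_def[of \<kappa> \<Omega> 2] inner_at_def[of \<kappa> \<Omega> 3]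
      form_inner_2[OF refl alt(4)[OF nbhd(2)]] form_inner_2[OF refl alt(3)[OF nbhd(2)]] form_inner_3[OF refl alt(5)[OF nbhd(2)]]
      frame sum_1_6 power2_eq_square
    by argo
qed

end
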